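(* Let $F:(M_1^{m_1},g_1)\to(M_2^{m_2},g_2)$ be a Riemannian map between Riemannian manifolds with rank $r<m_2$. Then for any unit vector $X\in\Gamma(\ker F_\ast)^\perp$ we have $$(\star)\quad {\rm Ric}^{\mathcal H}(X)\le {\rm Ric}^{\mathcal R}(F_\ast X)+\frac14\|{\rm trace}\,B^{\mathcal H}\|^2 .$$ (i) The equality case of $(\star)$ holds for all $X\in\Gamma(\ker F_\ast)^\perp$ if and only if $$(\nabla F_\ast)(X,Y)=0\ \text{ for all } Y\in\Gamma(\ker F_\ast)^\perp \text{ orthogonal to } X,\qquad (\nabla F_\ast)(X,X)=\frac{{\rm trace}\,B^{\mathcal H}}{2}.$$ (ii) The equality case of $(\star)$ holds identically for all $X\in\Gamma(\ker F_\ast)^\perp$ if and only if either $B^{\mathcal H}=0$ or $r=2$, and $B_{11}^{\mathcal H^\alpha}=B_{22}^{\mathcal H^\alpha}$, $\alpha\in\{3,\ldots,m_2\}$. Equivalently, the equality case of $(\star)$ holds identically for all $X\in\Gamma(\ker F_\ast)^\perp$ if and only if $F$ is (a) totally geodesic when $r>2$; (b) umbilical when $r=2$.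
   Context: Let $F:(M_1,g_1)\to(M_2,g_2)$ be a smooth map between Riemannian manifolds of rank $r$, with dimensions $m_1,m_2$ and orthogonal decompositions $T_pM_1=\ker F_{\ast p}\oplus(\ker F_{\ast p})^\perp$ and $T_{F(p)}M_2={\rm range}\,F_{\ast p}\oplus({\rm range}\,F_{\ast p})^\perp$. $F$ is called a Riemannian map if $g_1(X,Y)=g_2(F_\ast X,F_\ast Y)$ for all $X,Y\in\Gamma(\ker F_\ast)^\perp$. Vectors in $(\ker F_\ast)^\perp$ are called horizontal. The second fundamental form of $F$ is $(\nabla F_\ast)(Z_1,Z_2)=\nabla^2_{F_\ast Z_1}F_\ast Z_2-F_\ast(\nabla^1_{Z_1}Z_2)$ for $Z_1,Z_2\in\Gamma(TM_1)$, where $\nabla^1$ is the Levi-Civita connection of $M_1$ and $\nabla^2$ is the (pulled-back) Levi-Civita connection of $M_2$; for horizontal $X,Y$ it takes values in $({\rm range}\,F_\ast)^\perp$. At a point let $\{h_1,\ldots,h_r\}$ be an orthonormal basis of $(\ker F_\ast)^\perp$ and $\{V_{r+1},\ldots,V_{m_2}\}$ an orthonormal basis of $({\rm range}\,F_\ast)^\perp$. $B^{\mathcal H}$ denotes the restriction of $\nabla F_\ast$ to horizontal vectors, with components $B_{ij}^{\mathcal H^\alpha}=g_2((\nabla F_\ast)(h_i,h_j),V_\alpha)$, $1\le i,j\le r$, $r+1\le\alpha\le m_2$; ${\rm trace}\,B^{\mathcal H}=\sum_{i=1}^r(\nabla F_\ast)(h_i,h_i)$ and $\|{\rm trace}\,B^{\mathcal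 H}\|^2=g_2({\rm trace}\,B^{\mathcal H},{\rm trace}\,B^{\mathcal H})$. $R^{M_1},R^{M_2}$ are the Riemannian curvature tensors, with the sign for which $g(R(X,Y)Y,X)$ is the sectional curvature for orthonormal $X,Y$. The Ricci curvatures are ${\rm Ric}^{\mathcal H}(h_j)=\sum_{i=1}^r g_1(R^{M_1}(h_i,h_j)h_j,h_i)$ and ${\rm Ric}^{\mathcal R}(F_\ast h_j)=\sum_{i=1}^r g_2(R^{M_2}(F_\ast h_i,F_\ast h_j)F_\ast h_j,F_\ast h_i)$; for a unit horizontal $X$ the basis is chosen with $h_1=X$. The terms "totally geodesic" and "umbilical" have their usual meanings for Riemannian maps: $F$ is totally geodesic if $\nabla F_\ast=0$, and umbilical if $(\nabla F_\ast)(X,Y)=g_1(X,Y)\,H_2$ for all horizontal $X,Y$, for some vector field $H_2$ with values in $({\rm range}\,F_\ast)^\perp$.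
   Formalization: The printed equivalences fail in general (e.g. non-integrable horizontal distribution): in (i), (ii), (b) the right-hand side also requires (∇F_* )(X,V)=0 for vertical V, and in (a) the equality side also requires (∇F_* )(V,W)=0 for vertical V, W. *)

theory Defs
  imports "HOL-Analysis.Analysis"
begin

section \<open>Smooth functions between normed spaces\<close>

text \<open>\<open>S\<close> is always an open set; on finite-dimensional domains \<open>Ck_on k S f\<close> says that \<open>f\<close>
  is of class \<open>C^k\<close> on \<open>S\<close>.\<close>

fun Ck_on :: "nat \<Rightarrow> 'a::real_normed_vector set \<Rightarrow> ('a \<Rightarrow> 'b::real_normed_vector) \<Rightarrow> bool" where
  "Ck_on 0 S f \<longleftrightarrow> continuous_on S f"
| "Ck_on (Suc k) S f \<longleftrightarrow>
     (\<forall>x\<in>S. f differentiable (at x)) \<and> (\<forall>v. Ck_on k S (\<lambda>x. frechet_derivative f (at x) v))"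

definition smooth_on :: "'a::real_normed_vector set \<Rightarrow> ('a \<Rightarrow> 'b::real_normed_vector) \<Rightarrow> bool" where
  "smooth_on S f \<longleftrightarrow> (\<forall>k. Ck_on k S f)"


section \<open>Manifolds and tangent vectors\<close>

text \<open>A chart is a pair of its domain and its coordinate map; the dimension of the manifold is
  \<open>CARD('m)\<close>.\<close>

type_synonym ('a, 'm) chart = "'a set \<times> ('a \<Rightarrow> real ^ 'm)"

text \<open>A tangent vector is encoded by the family of its coordinate vectors in all charts. The type
  contains arbitrary families; compatibility under changes of charts is imposed by
  \<open>tangent_space\<close> below, which is a linear subspace of this type.\<close>

typedef ('a, 'm::finite) tvec = "UNIV :: (('a, 'm) chart \<Rightarrow> real ^ 'm) set"
  morphisms coords Tvec by simp

instantiation tvec :: (type, finite) real_vector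
begin

definition zero_tvec_def: "0 = Tvec (\<lambda>c. 0)"
definition plus_tvec_def: "X + Y = Tvec (\<lambda>c. coords X c + coords Y c)"
definition minus_tvec_def: "X - Y = Tvec (\<lambda>c. coords X c - coords Y c)"
definition uminus_tvec_def: "- X = Tvec (\<lambda>c. - coords X c)"
definition scaleR_tvec_def: "a *\<^sub>R X = Tvec (\<lambda>c. a *\<^sub>R coords X c)"

instance
  by standard
    (simp_all add: zero_tvec_def plus_tvec_def minus_tvec_def uminus_tvec_def scaleR_tvec_def
      Tvec_inverse coords_inverse algebra_simps)

end

record ('a, 'm::finite) riem =
  rm_top :: "'a topology"
  rm_atlas :: "('a, 'm) chart set"
  rm_metric :: "'a \<Rightarrow> ('a, 'm) tvec \<Rightarrow> ('a, 'm) tvec \<Rightarrow> real"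

definition chart_inv :: "('a, 'm::finite) chart \<Rightarrow> real ^ 'm \<Rightarrow> 'a" where
  "chart_inv c = inv_into (fst c) (snd c)"

definition local_rep ::
  "('a \<Rightarrow> 'b) \<Rightarrow> ('a, 'm::finite) chart \<Rightarrow> ('b, 'n::finite) chart \<Rightarrow> real ^ 'm \<Rightarrow> real ^ 'n" where
  "local_rep F c d = snd d \<circ> F \<circ> chart_inv c"

abbreviation transition ::
  "('a, 'm::finite) chart \<Rightarrow> ('a, 'm) chart \<Rightarrow> real ^ 'm \<Rightarrow> real ^ 'm" where
  "transition \<equiv> local_rep (\<lambda>p. p)"

definition smooth_manifold :: "('a, 'm::finite) riem \<Rightarrow> bool" where
  "smooth_manifold M \<longleftrightarrow>
     Hausdorff_space (rm_top M) \<and> second_countable (rm_top M) \<and>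
     (\<Union>c\<in>rm_atlas M. fst c) = topspace (rm_top M) \<and>
     (\<forall>c\<in>rm_atlas M. openin (rm_top M) (fst c) \<and> open (snd c ` fst c) \<and>
        homeomorphic_map (subtopology (rm_top M) (fst c)) (top_of_set (snd c ` fst c)) (snd c)) \<and>
     (\<forall>c\<in>rm_atlas M. \<forall>d\<in>rm_atlas M. smooth_on (snd c ` (fst c \<inter> fst d)) (transition c d))"

definition charts_at :: "('a, 'm::finite) riem \<Rightarrow> 'a \<Rightarrow> ('a, 'm) chart set" where
  "charts_at M p = {c \<in> rm_atlas M. p \<in> fst c}"

definition tangent_space :: "('a, 'm::finite) riem \<Rightarrow> 'a \<Rightarrow> ('a, 'm) tvec set" where
  "tangent_space M p =
     {X. (\<forall>c. c \<notin> charts_at M p \<longrightarrow> coords X c = 0) \<and>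
         (\<forall>c\<in>charts_at M p. \<forall>d\<in>charts_at M p.
            coords X d = frechet_derivative (transition c d) (at (snd c p)) (coords X c))}"

text \<open>The tangent vector at \<open>p\<close> with coordinates \<open>u\<close> in the chart \<open>c\<close>.\<close>

definition tangent_vec ::
  "('a, 'm::finite) riem \<Rightarrow> ('a, 'm) chart \<Rightarrow> 'a \<Rightarrow> real ^ 'm \<Rightarrow> ('a, 'm) tvec" where
  "tangent_vec M c p u =
     Tvec (\<lambda>d. if d \<in> charts_at M p
               then frechet_derivative (transition c d) (at (snd c p)) u else 0)"

text \<open>The differential, the second fundamental form and the curvature tensor are computed in some
  chart around each point; being tensorial, they do not depend on the choice.\<close>

definition chart_at :: "('a, 'm::finite) riem \<Rightarrow> 'a \<Rightarrow> ('a, 'm) chart" where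
  "chart_at M p = (SOME c. c \<in> charts_at M p)"


section \<open>Riemannian manifolds and the Levi-Civita connection\<close>

definition metric_coeff ::
  "('a, 'm::finite) riem \<Rightarrow> ('a, 'm) chart \<Rightarrow> real ^ 'm \<Rightarrow> real ^ 'm \<Rightarrow> real ^ 'm \<Rightarrow> real" where
  "metric_coeff M c x u v =
     (let p = chart_inv c x in rm_metric M p (tangent_vec M c p u) (tangent_vec M c p v))"

definition riemannian_manifold :: "('a, 'm::finite) riem \<Rightarrow> bool" where
  "riemannian_manifold M \<longleftrightarrow>
     smooth_manifold M \<and>
     (\<forall>p\<in>topspace (rm_top M).
        (\<forall>X\<in>tangent_space M p. \<forall>Y\<in>tangent_space M p.
           rm_metric M p X Y = rm_metric M p Y X \<and>
           (\<forall>a. rm_metric M p (a *\<^sub>R X) Y = a * rm_metric M p X Y) \<and>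
           (\<forall>Z\<in>tangent_space M p.
              rm_metric M p (X + Y) Z = rm_metric M p X Z + rm_metric M p Y Z)) \<and>
        (\<forall>X\<in>tangent_space M p. X \<noteq> 0 \<longrightarrow> rm_metric M p X X > 0)) \<and>
     (\<forall>c\<in>rm_atlas M. \<forall>u v. smooth_on (snd c ` fst c) (\<lambda>x. metric_coeff M c x u v))"

text \<open>A connection is given in each chart by \<open>\<nabla>\<^sub>u Y = DY(u) + \<Gamma>(u, Y)\<close>. More generally, for a map \<open>f\<close>
  (the coordinate expression of \<open>F\<close>) the pulled-back connection differentiates a vector field \<open>W\<close>
  along \<open>f\<close>; the connection itself is the case of the identity.\<close>

type_synonym ('a, 'm) connection =
  "('a, 'm) chart \<Rightarrow> real ^ 'm \<Rightarrow> real ^ 'm \<Rightarrow> real ^ 'm \<Rightarrow> real ^ 'm"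

definition cov_deriv ::
  "('v \<Rightarrow> 'v \<Rightarrow> 'v \<Rightarrow> 'v) \<Rightarrow> 'v \<Rightarrow> ('v \<Rightarrow> 'v) \<Rightarrow> 'v \<Rightarrow> 'v::real_normed_vector" where
  "cov_deriv \<Gamma> u Y x = frechet_derivative Y (at x) u + \<Gamma> x u (Y x)"

definition pullback_cov_deriv ::
  "('w \<Rightarrow> 'w \<Rightarrow> 'w \<Rightarrow> 'w) \<Rightarrow> ('v \<Rightarrow> 'w) \<Rightarrow> 'v \<Rightarrow> ('v \<Rightarrow> 'w) \<Rightarrow>
     'v::real_normed_vector \<Rightarrow> 'w::real_normed_vector" where
  "pullback_cov_deriv \<Gamma> f u W x =
     frechet_derivative W (at x) u + \<Gamma> (f x) (frechet_derivative f (at x) u) (W x)"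

definition lie_bracket ::
  "('v \<Rightarrow> 'v) \<Rightarrow> ('v \<Rightarrow> 'v) \<Rightarrow> 'v::real_normed_vector \<Rightarrow> 'v" where
  "lie_bracket X Y x = frechet_derivative Y (at x) (X x) - frechet_derivative X (at x) (Y x)"

text \<open>No transformation rule under changes of charts is imposed: it follows from the uniqueness of
  the Levi-Civita connection on each chart domain.\<close>

definition levi_civita :: "('a, 'm::finite) riem \<Rightarrow> ('a, 'm) connection \<Rightarrow> bool" where
  "levi_civita M \<Gamma> \<longleftrightarrow>
     (\<forall>c\<in>rm_atlas M. let U = snd c ` fst c; G = metric_coeff M c; D = cov_deriv (\<Gamma> c) in
        (\<forall>x\<in>U. bilinear (\<Gamma> c x)) \<and>
        (\<forall>u v. smooth_on U (\<lambda>x. \<Gamma> c x u v)) \<and>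
        (\<forall>X Y. smooth_on U X \<longrightarrow> smooth_on U Y \<longrightarrow>
           (\<forall>x\<in>U. D (X x) Y x - D (Y x) X x = lie_bracket X Y x)) \<and>
        (\<forall>Y Z. smooth_on U Y \<longrightarrow> smooth_on U Z \<longrightarrow>
           (\<forall>x\<in>U. \<forall>u. frechet_derivative (\<lambda>y. G y (Y y) (Z y)) (at x) u =
                        G x (D u Y x) (Z x) + G x (Y x) (D u Z x))))"

text \<open>\<open>R(X,Y)Z = \<nabla>\<^sub>X \<nabla>\<^sub>Y Z - \<nabla>\<^sub>Y \<nabla>\<^sub>X Z - \<nabla>\<^bsub>[X,Y]\<^esub> Z\<close>, evaluated on the extensions of the three vectors
  with constant coefficients in the chart, for which \<open>[X,Y] = 0\<close>.\<close>

definition curvature ::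
  "('a, 'm::finite) riem \<Rightarrow> ('a, 'm) connection \<Rightarrow> 'a \<Rightarrow>
     ('a, 'm) tvec \<Rightarrow> ('a, 'm) tvec \<Rightarrow> ('a, 'm) tvec \<Rightarrow> ('a, 'm) tvec" where
  "curvature M \<Gamma> p X Y Z =
     (let c = chart_at M p; D = cov_deriv (\<Gamma> c);
          u = coords X c; v = coords Y c; w = coords Z c in
      tangent_vec M c p
        (D u (\<lambda>y. D v (\<lambda>_. w) y) (snd c p) - D v (\<lambda>y. D u (\<lambda>_. w) y) (snd c p)))"


section \<open>Riemannian maps\<close>

definition smooth_map :: "('a, 'm::finite) riem \<Rightarrow> ('b, 'n::finite) riem \<Rightarrow> ('a \<Rightarrow> 'b) \<Rightarrow> bool" where
  "smooth_map M N F \<longleftrightarrow>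
     continuous_map (rm_top M) (rm_top N) F \<and>
     (\<forall>c\<in>rm_atlas M. \<forall>d\<in>rm_atlas N.
        smooth_on (snd c ` (fst c \<inter> F -` fst d)) (local_rep F c d))"

definition differential ::
  "('a, 'm::finite) riem \<Rightarrow> ('b, 'n::finite) riem \<Rightarrow> ('a \<Rightarrow> 'b) \<Rightarrow> 'a \<Rightarrow>
     ('a, 'm) tvec \<Rightarrow> ('b, 'n) tvec" where
  "differential M N F p X =
     (let c = chart_at M p; d = chart_at N (F p) in
      tangent_vec N d (F p) (frechet_derivative (local_rep F c d) (at (snd c p)) (coords X c)))"

definition kernel_at ::
  "('a, 'm::finite) riem \<Rightarrow> ('b, 'n::finite) riem \<Rightarrow> ('a \<Rightarrow> 'b) \<Rightarrow> 'a \<Rightarrow> ('a, 'm) tvec set" where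
  "kernel_at M N F p = {X \<in> tangent_space M p. differential M N F p X = 0}"

definition horizontal ::
  "('a, 'm::finite) riem \<Rightarrow> ('b, 'n::finite) riem \<Rightarrow> ('a \<Rightarrow> 'b) \<Rightarrow> 'a \<Rightarrow> ('a, 'm) tvec set" where
  "horizontal M N F p =
     {X \<in> tangent_space M p. \<forall>V\<in>kernel_at M N F p. rm_metric M p X V = 0}"

definition range_at ::
  "('a, 'm::finite) riem \<Rightarrow> ('b, 'n::finite) riem \<Rightarrow> ('a \<Rightarrow> 'b) \<Rightarrow> 'a \<Rightarrow> ('b, 'n) tvec set" where
  "range_at M N F p = differential M N F p ` tangent_space M p"

definition range_perp ::
  "('a, 'm::finite) riem \<Rightarrow> ('b, 'n::finite) riem \<Rightarrow> ('a \<Rightarrow> 'b) \<Rightarrow> 'a \<Rightarrow> ('b, 'n) tvec set" where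
  "range_perp M N F p =
     {W \<in> tangent_space N (F p). \<forall>Z\<in>range_at M N F p. rm_metric N (F p) W Z = 0}"

definition riemannian_map ::
  "('a, 'm::finite) riem \<Rightarrow> ('b, 'n::finite) riem \<Rightarrow> ('a \<Rightarrow> 'b) \<Rightarrow> nat \<Rightarrow> bool" where
  "riemannian_map M N F r \<longleftrightarrow>
     smooth_map M N F \<and>
     (\<forall>p\<in>topspace (rm_top M).
        dim (range_at M N F p) = r \<and>
        (\<forall>X\<in>horizontal M N F p. \<forall>Y\<in>horizontal M N F p.
           rm_metric M p X Y = rm_metric N (F p) (differential M N F p X) (differential M N F p Y)))"

text \<open>The second fundamental form \<open>(\<nabla>F\<^sub>*)(X,Y) = \<nabla>\<^sup>2\<^sub>X F\<^sub>*Y - F\<^sub>*(\<nabla>\<^sup>1\<^sub>X Y)\<close>, with \<open>Y\<close> extended with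
  constant coefficients in the chart.\<close>

definition second_fundamental_form ::
  "('a, 'm::finite) riem \<Rightarrow> ('a, 'm) connection \<Rightarrow> ('b, 'n::finite) riem \<Rightarrow> ('b, 'n) connection \<Rightarrow>
     ('a \<Rightarrow> 'b) \<Rightarrow> 'a \<Rightarrow> ('a, 'm) tvec \<Rightarrow> ('a, 'm) tvec \<Rightarrow> ('b, 'n) tvec" where
  "second_fundamental_form M \<Gamma>\<^sub>1 N \<Gamma>\<^sub>2 F p X Y =
     (let c = chart_at M p; d = chart_at N (F p); f = local_rep F c d; x = snd c p;
          u = coords X c; v = coords Y c in
      tangent_vec N d (F p)
        (pullback_cov_deriv (\<Gamma>\<^sub>2 d) f u (\<lambda>y. frechet_derivative f (at y) v) x
         - frechet_derivative f (at x) (cov_deriv (\<Gamma>\<^sub>1 c) u (\<lambda>_. v) x)))"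

definition totally_geodesic ::
  "('a, 'm::finite) riem \<Rightarrow> ('a, 'm) connection \<Rightarrow> ('b, 'n::finite) riem \<Rightarrow> ('b, 'n) connection \<Rightarrow>
     ('a \<Rightarrow> 'b) \<Rightarrow> bool" where
  "totally_geodesic M \<Gamma>\<^sub>1 N \<Gamma>\<^sub>2 F \<longleftrightarrow>
     (\<forall>p\<in>topspace (rm_top M). \<forall>X\<in>tangent_space M p. \<forall>Y\<in>tangent_space M p.
        second_fundamental_form M \<Gamma>\<^sub>1 N \<Gamma>\<^sub>2 F p X Y = 0)"

text \<open>\<open>H\<close> is determined by this condition when the rank is positive, and is then automatically
  smooth.\<close>

definition umbilical ::
  "('a, 'm::finite) riem \<Rightarrow> ('a, 'm) connection \<Rightarrow> ('b, 'n::finite) riem \<Rightarrow> ('b, 'n) connection \<Rightarrow>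
     ('a \<Rightarrow> 'b) \<Rightarrow> bool" where
  "umbilical M \<Gamma>\<^sub>1 N \<Gamma>\<^sub>2 F \<longleftrightarrow>
     (\<exists>H. \<forall>p\<in>topspace (rm_top M). H p \<in> range_perp M N F p \<and>
        (\<forall>X\<in>horizontal M N F p. \<forall>Y\<in>horizontal M N F p.
           second_fundamental_form M \<Gamma>\<^sub>1 N \<Gamma>\<^sub>2 F p X Y = rm_metric M p X Y *\<^sub>R H p))"


section \<open>Orthonormal bases, traces and Ricci curvatures\<close>

definition orthonormal_basis ::
  "('v \<Rightarrow> 'v \<Rightarrow> real) \<Rightarrow> 'v::real_vector set \<Rightarrow> nat set \<Rightarrow> (nat \<Rightarrow> 'v) \<Rightarrow> bool" where
  "orthonormal_basis g S I h \<longleftrightarrow>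
     h ` I \<subseteq> S \<and> S \<subseteq> span (h ` I) \<and> (\<forall>i\<in>I. \<forall>j\<in>I. g (h i) (h j) = (if i = j then 1 else 0))"

definition horizontal_basis ::
  "('a, 'm::finite) riem \<Rightarrow> ('b, 'n::finite) riem \<Rightarrow> ('a \<Rightarrow> 'b) \<Rightarrow> nat \<Rightarrow> 'a \<Rightarrow>
     (nat \<Rightarrow> ('a, 'm) tvec) \<Rightarrow> bool" where
  "horizontal_basis M N F r p h \<longleftrightarrow>
     orthonormal_basis (rm_metric M p) (horizontal M N F p) {1..r} h"

definition range_perp_basis ::
  "('a, 'm::finite) riem \<Rightarrow> ('b, 'n::finite) riem \<Rightarrow> ('a \<Rightarrow> 'b) \<Rightarrow> nat \<Rightarrow> 'a \<Rightarrow>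
     (nat \<Rightarrow> ('b, 'n) tvec) \<Rightarrow> bool" where
  "range_perp_basis M N F r p V \<longleftrightarrow>
     orthonormal_basis (rm_metric N (F p)) (range_perp M N F p) {r + 1..CARD('n)} V"

definition trace_B ::
  "('a, 'm::finite) riem \<Rightarrow> ('a, 'm) connection \<Rightarrow> ('b, 'n::finite) riem \<Rightarrow> ('b, 'n) connection \<Rightarrow>
     ('a \<Rightarrow> 'b) \<Rightarrow> nat \<Rightarrow> 'a \<Rightarrow> (nat \<Rightarrow> ('a, 'm) tvec) \<Rightarrow> ('b, 'n) tvec" where
  "trace_B M \<Gamma>\<^sub>1 N \<Gamma>\<^sub>2 F r p h =
     (\<Sum>i=1..r. second_fundamental_form M \<Gamma>\<^sub>1 N \<Gamma>\<^sub>2 F p (h i) (h i))"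

definition B_comp ::
  "('a, 'm::finite) riem \<Rightarrow> ('a, 'm) connection \<Rightarrow> ('b, 'n::finite) riem \<Rightarrow> ('b, 'n) connection \<Rightarrow>
     ('a \<Rightarrow> 'b) \<Rightarrow> 'a \<Rightarrow> (nat \<Rightarrow> ('a, 'm) tvec) \<Rightarrow> (nat \<Rightarrow> ('b, 'n) tvec) \<Rightarrow>
     nat \<Rightarrow> nat \<Rightarrow> nat \<Rightarrow> real" where
  "B_comp M \<Gamma>\<^sub>1 N \<Gamma>\<^sub>2 F p h V \<alpha> i j =
     rm_metric N (F p) (second_fundamental_form M \<Gamma>\<^sub>1 N \<Gamma>\<^sub>2 F p (h i) (h j)) (V \<alpha>)"

text \<open>\<open>Ric_H \<dots> h j\<close> is the horizontal Ricci curvature of \<open>h j\<close>, \<open>Ric_R \<dots> h j\<close> the Ricci curvature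
  on the range of the image of \<open>h j\<close>.\<close>

definition Ric_H ::
  "('a, 'm::finite) riem \<Rightarrow> ('a, 'm) connection \<Rightarrow> nat \<Rightarrow> 'a \<Rightarrow> (nat \<Rightarrow> ('a, 'm) tvec) \<Rightarrow>
     nat \<Rightarrow> real" where
  "Ric_H M \<Gamma>\<^sub>1 r p h j = (\<Sum>i=1..r. rm_metric M p (curvature M \<Gamma>\<^sub>1 p (h i) (h j) (h j)) (h i))"

definition Ric_R ::
  "('a, 'm::finite) riem \<Rightarrow> ('b, 'n::finite) riem \<Rightarrow> ('b, 'n) connection \<Rightarrow> ('a \<Rightarrow> 'b) \<Rightarrow>
     nat \<Rightarrow> 'a \<Rightarrow> (nat \<Rightarrow> ('a, 'm) tvec) \<Rightarrow> nat \<Rightarrow> real" where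
  "Ric_R M N \<Gamma>\<^sub>2 F r p h j =
     (let D = differential M N F p in
      \<Sum>i=1..r. rm_metric N (F p) (curvature N \<Gamma>\<^sub>2 (F p) (D (h i)) (D (h j)) (D (h j))) (D (h i)))"

text \<open>Right-hand side of the inequality for the first vector of the basis \<open>h\<close>.\<close>

definition ricci_bound ::
  "('a, 'm::finite) riem \<Rightarrow> ('a, 'm) connection \<Rightarrow> ('b, 'n::finite) riem \<Rightarrow> ('b, 'n) connection \<Rightarrow>
     ('a \<Rightarrow> 'b) \<Rightarrow> nat \<Rightarrow> 'a \<Rightarrow> (nat \<Rightarrow> ('a, 'm) tvec) \<Rightarrow> real" where
  "ricci_bound M \<Gamma>\<^sub>1 N \<Gamma>\<^sub>2 F r p h =
     Ric_R M N \<Gamma>\<^sub>2 F r p h 1 +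
     1 / 4 * rm_metric N (F p) (trace_B M \<Gamma>\<^sub>1 N \<Gamma>\<^sub>2 F r p h) (trace_B M \<Gamma>\<^sub>1 N \<Gamma>\<^sub>2 F r p h)"

definition equality_identically ::
  "('a, 'm::finite) riem \<Rightarrow> ('a, 'm) connection \<Rightarrow> ('b, 'n::finite) riem \<Rightarrow> ('b, 'n) connection \<Rightarrow>
     ('a \<Rightarrow> 'b) \<Rightarrow> nat \<Rightarrow> bool" where
  "equality_identically M \<Gamma>\<^sub>1 N \<Gamma>\<^sub>2 F r \<longleftrightarrow>
     (\<forall>p\<in>topspace (rm_top M). \<forall>X\<in>horizontal M N F p. rm_metric M p X X = 1 \<longrightarrow>
        (\<forall>h. horizontal_basis M N F r p h \<longrightarrow> h 1 = X \<longrightarrow>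
           Ric_H M \<Gamma>\<^sub>1 r p h 1 = ricci_bound M \<Gamma>\<^sub>1 N \<Gamma>\<^sub>2 F r p h))"

text \<open>\<open>(\<nabla>F\<^sub>*)(X,V) = 0\<close> for all horizontal \<open>X\<close> and vertical \<open>V\<close>; equivalently, the horizontal
  distribution is integrable. This holds trivially if \<open>F\<close> is an immersion. It is needed in the
  characterisation of equality because for orthonormal horizontal \<open>X\<close>, \<open>Y\<close> the Gauss equation of
  \<open>F\<close> is
  \<open>K\<^sub>1(X,Y) = K\<^sub>2(F\<^sub>*X,F\<^sub>*Y) + g\<^sub>2(B(X,X),B(Y,Y)) - |B(X,Y)|\<^sup>2 - 3|v(\<nabla>\<^sup>1\<^sub>X Y)|\<^sup>2\<close>,
  \<open>v\<close> denoting the vertical part, and the last term vanishes for all horizontal \<open>Y\<close> iff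
  \<open>(\<nabla>F\<^sub>*)(X,V) = 0\<close> for all vertical \<open>V\<close>.\<close>

definition mixed_vanishing ::
  "('a, 'm::finite) riem \<Rightarrow> ('a, 'm) connection \<Rightarrow> ('b, 'n::finite) riem \<Rightarrow> ('b, 'n) connection \<Rightarrow>
     ('a \<Rightarrow> 'b) \<Rightarrow> bool" where
  "mixed_vanishing M \<Gamma>\<^sub>1 N \<Gamma>\<^sub>2 F \<longleftrightarrow>
     (\<forall>p\<in>topspace (rm_top M). \<forall>X\<in>horizontal M N F p. \<forall>V\<in>kernel_at M N F p.
        second_fundamental_form M \<Gamma>\<^sub>1 N \<Gamma>\<^sub>2 F p X V = 0)"

text \<open>\<open>(\<nabla>F\<^sub>*)(V,W) = 0\<close> for all vertical \<open>V\<close>, \<open>W\<close>: the fibres are totally geodesic.\<close>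

definition vertical_vanishing ::
  "('a, 'm::finite) riem \<Rightarrow> ('a, 'm) connection \<Rightarrow> ('b, 'n::finite) riem \<Rightarrow> ('b, 'n) connection \<Rightarrow>
     ('a \<Rightarrow> 'b) \<Rightarrow> bool" where
  "vertical_vanishing M \<Gamma>\<^sub>1 N \<Gamma>\<^sub>2 F \<longleftrightarrow>
     (\<forall>p\<in>topspace (rm_top M). \<forall>V\<in>kernel_at M N F p. \<forall>W\<in>kernel_at M N F p.
        second_fundamental_form M \<Gamma>\<^sub>1 N \<Gamma>\<^sub>2 F p V W = 0)"

end

theory Submission
  imports Defs
begin

text \<open>In coordinates let \<open>B\<close> be the second fundamental form of \<open>F\<close> and
  \<open>C(u,v,w) = g\<^sub>2(B(u,v), F\<^sub>* w)\<close>. The endomorphism \<open>P = (F\<^sub>*)\<^sup>* F\<^sub>*\<close> is a smooth field of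
  orthogonal projections onto the horizontal spaces. Differentiating \<open>g\<^sub>1(P v, w) = g\<^sub>2(F\<^sub>* v, F\<^sub>* w)\<close>
  shows that \<open>C(u,v,w)\<close> is antisymmetric in horizontal \<open>v\<close>, \<open>w\<close>; as it is symmetric in \<open>u\<close>, \<open>v\<close>, it
  vanishes for horizontal \<open>u\<close>, \<open>v\<close>, and
  \<open>g\<^sub>1(a(u,v), k) = C(u,k,v)\<close> for vertical \<open>k\<close>, where \<open>a(u,v)\<close> is the vertical part of the derivative
  of the horizontal field \<open>P v\<close> in the direction \<open>u\<close>. Commuting derivatives along \<open>F\<close>, and
  differentiating \<open>C(P v, P w, z) = 0\<close> once more, gives the Gauss equation
  \<open>K\<^sub>1(u,v) = K\<^sub>2(F\<^sub>* u, F\<^sub>* v) + g\<^sub>2(B(u,u),B(v,v)) - |B(u,v)|\<^sup>2 - 3|a(u,v)|\<^sup>2\<close>.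
  Summed over an orthonormal basis with first vector \<open>X\<close>, it exhibits the defect of the inequality as
  \<open>|B(X,X) - trace B / 2|\<^sup>2 + \<Sum>|B(h\<^sub>i,X)|\<^sup>2 + 3\<Sum>|a(h\<^sub>i,X)|\<^sup>2\<close>.\<close>

section \<open>Differential calculus\<close>

text \<open>The obstacle is that horizontality is a pointwise condition, while the Gauss equation
  differentiates horizontal vectors, and a constant extension of a horizontal vector need not stay
  horizontal. Extending by \<open>P\<close> repairs this. \<open>P\<close> is differentiable because
  its defining identity is a linear system for \<open>P v\<close> with the invertible Gram matrix of
  the metric. The factor 3 is 2 + 1: the derivative of \<open>C v v u\<close> along \<open>u\<close>
  yields two copies of the squared length of \<open>a u v\<close>, that of \<open>C u v u\<close>
  along \<open>v\<close> one more. The factor 1/4 comes from completing a square: with b = B(X,X)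
  and T = trace B, the Gauss terms contain <T,b> - |b|^2 = |T|^2/4 - |b - T/2|^2. If equality holds
  for every unit vector, each member of a basis can be moved to the first place, so B(h_i,h_i) = T/2
  for all i, and summing gives T = (r/2) T. Hence T can be nonzero only in rank 2. The terms in
  \<open>a\<close> vanish exactly if B(X,V) = 0 for all vertical V: such a B(X,V) lies in the range,
  and its pairing with the image of h_i is minus that of a(h_i,X) with V.\<close>

lemma has_derivative_frechet_derivative:
  "f differentiable (at x) \<Longrightarrow> (f has_derivative frechet_derivative f (at x)) (at x)"
  by (simp add: frechet_derivative_works)

lemma frechet_derivative_eqI:
  "(f has_derivative f') (at x) \<Longrightarrow> frechet_derivative f (at x) = f'"
  by (simp add: frechet_derivative_at[symmetric])

lemma smooth_on_differentiable:
  "smooth_on S f \<Longrightarrow> x \<in> S \<Longrightarrow> f differentiable (at x)"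
  by (metis Ck_on.simps(2) smooth_on_def)

lemma smooth_on_frechet_derivative:
  "smooth_on S f \<Longrightarrow> smooth_on S (\<lambda>x. frechet_derivative f (at x) v)"
  by (metis Ck_on.simps(2) smooth_on_def)

lemma smooth_on_continuous_on: "smooth_on S f \<Longrightarrow> continuous_on S f"
  by (metis Ck_on.simps(1) smooth_on_def)

lemma Ck_on_const: "Ck_on k S (\<lambda>x. c)"
  by (induction k arbitrary: c) auto

lemma smooth_on_const: "smooth_on S (\<lambda>x. c)"
  by (simp add: smooth_on_def Ck_on_const)

section \<open>Symmetry of second derivatives for real-valued functions\<close>

lemma mean_value_direction:
  fixes g :: "'a::real_normed_vector \<Rightarrow> real"
  assumes "0 < t" and "\<And>s. 0 \<le> s \<Longrightarrow> s \<le> t \<Longrightarrow> g differentiable (at (z + s *\<^sub>R w))"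
  obtains s where "0 < s" "s < t"
    "g (z + t *\<^sub>R w) - g z = t * frechet_derivative g (at (z + s *\<^sub>R w)) w"
proof -
  let ?D = "\<lambda>s. frechet_derivative g (at (z + s *\<^sub>R w))"
  have der: "((\<lambda>s. g (z + s *\<^sub>R w)) has_real_derivative ?D s w) (at s)"
    if "0 \<le> s" "s \<le> t" for s
  proof -
    have "((\<lambda>s. z + s *\<^sub>R w) has_derivative (\<lambda>h. h *\<^sub>R w)) (at s)"
      by (auto intro!: derivative_eq_intros)
    from has_derivative_compose[OF this has_derivative_frechet_derivative[OF assms(2)[OF that]]]
    have "((\<lambda>s. g (z + s *\<^sub>R w)) has_derivative (\<lambda>h. ?D s (h *\<^sub>R w))) (at s)" .
    moreover have "(\<lambda>h. ?D s (h *\<^sub>R w)) = (*) (?D s w)"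
      using linear_frechet_derivative[OF assms(2)[OF that]] by (auto simp: linear_scale)
    ultimately show ?thesis by (simp add: has_field_derivative_def)
  qed
  obtain s where "0 < s" "s < t"
    "g (z + t *\<^sub>R w) - g (z + 0 *\<^sub>R w) = (t - 0) * ?D s w"
    using MVT2[OF \<open>0 < t\<close>, of "\<lambda>s. g (z + s *\<^sub>R w)" "\<lambda>s. ?D s w"] der by blast
  then show thesis by (intro that[of s]) auto
qed

text \<open>The mean value theorem is applied to the increment of \<open>f\<close> along
  \<open>v\<close>, in direction \<open>u\<close>, and then to the derivative along
  \<open>u\<close>, in direction \<open>v\<close>. The left-hand side is symmetric in
  \<open>u\<close> and \<open>v\<close>, so the same quantity can be read in both orders.\<close>

lemma second_difference:
  fixes f :: "'a::real_normed_vector \<Rightarrow> real"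
  assumes S: "open S" and "smooth_on S f" "0 < t"
    and box: "\<And>a b. 0 \<le> a \<Longrightarrow> a \<le> t \<Longrightarrow> 0 \<le> b \<Longrightarrow> b \<le> t \<Longrightarrow> x + a *\<^sub>R u + b *\<^sub>R v \<in> S"
  obtains a b where "0 < a" "a < t" "0 < b" "b < t"
    "f (x + t *\<^sub>R u + t *\<^sub>R v) - f (x + t *\<^sub>R u) - f (x + t *\<^sub>R v) + f x =
     t * t * frechet_derivative (\<lambda>y. frechet_derivative f (at y) u) (at (x + a *\<^sub>R u + b *\<^sub>R v)) v"
proof -
  let ?g = "\<lambda>y. f (y + t *\<^sub>R v) - f y" and ?D = "\<lambda>y. frechet_derivative f (at y)"
  have fd: "f differentiable (at y)" if "y \<in> S" for y
    using assms(2) smooth_on_differentiable that by blast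
  have gder: "(?g has_derivative (\<lambda>h. ?D (y + t *\<^sub>R v) h - ?D y h)) (at y)"
    if "y \<in> S" "y + t *\<^sub>R v \<in> S" for y
  proof -
    have "((\<lambda>y. y + t *\<^sub>R v) has_derivative (\<lambda>h. h)) (at y)"
      by (auto intro!: derivative_eq_intros)
    from has_derivative_compose[OF this has_derivative_frechet_derivative[OF fd[OF that(2)]]]
    show ?thesis
      by (intro has_derivative_diff has_derivative_frechet_derivative fd that) auto
  qed
  have in1: "x + s *\<^sub>R u \<in> S" "x + s *\<^sub>R u + t *\<^sub>R v \<in> S" if "0 \<le> s" "s \<le> t" for s
    using box[of s 0] box[of s t] that \<open>0 < t\<close> by auto
  obtain a where a: "0 < a" "a < t"
    "?g (x + t *\<^sub>R u) - ?g x = t * frechet_derivative ?g (at (x + a *\<^sub>R u)) u"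
    by (rule mean_value_direction[OF \<open>0 < t\<close>, where g = ?g and z = x and w = u])
      (use gder in1 differentiable_def in blast)
  have ga: "frechet_derivative ?g (at (x + a *\<^sub>R u)) u =
      ?D (x + a *\<^sub>R u + t *\<^sub>R v) u - ?D (x + a *\<^sub>R u) u"
    using frechet_derivative_eqI[OF gder[of "x + a *\<^sub>R u"]] in1[of a] a by simp
  obtain b where b: "0 < b" "b < t"
    "?D (x + a *\<^sub>R u + t *\<^sub>R v) u - ?D (x + a *\<^sub>R u) u
      = t * frechet_derivative (\<lambda>y. ?D y u) (at (x + a *\<^sub>R u + b *\<^sub>R v)) v"
    by (rule mean_value_direction[OF \<open>0 < t\<close>, where g = "\<lambda>y. ?D y u" and z = "x + a *\<^sub>R u" and w = v])
      (use a box in \<open>auto intro!: smooth_on_differentiable smooth_on_frechet_derivative assms(2)\<close>)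
  show thesis
    using a b ga by (intro that[of a b]) (auto simp: algebra_simps)
qed

text \<open>Both readings of the second difference, divided by \<open>t * t\<close>, are values of
  the two mixed derivatives at points close to \<open>x\<close>. Continuity of these derivatives
  makes their values at \<open>x\<close> agree up to any \<open>e\<close>.\<close>

lemma second_derivative_symmetric_real:
  fixes f :: "'a::real_normed_vector \<Rightarrow> real"
  assumes S: "open S" "x \<in> S" and f: "smooth_on S f"
  shows "frechet_derivative (\<lambda>y. frechet_derivative f (at y) u) (at x) v =
         frechet_derivative (\<lambda>y. frechet_derivative f (at y) v) (at x) u"
proof -
  let ?P = "\<lambda>y. frechet_derivative (\<lambda>y. frechet_derivative f (at y) u) (at y) v"
  let ?Q = "\<lambda>y. frechet_derivative (\<lambda>y. frechet_derivative f (at y) v) (at y) u"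
  have cont: "continuous_on S ?P" "continuous_on S ?Q"
    using f by (auto intro!: smooth_on_continuous_on smooth_on_frechet_derivative)
  have near: "dist (?P x) (?Q x) < e" if e: "e > 0" for e
  proof -
    obtain d1 where d1: "d1 > 0" "\<And>y. y \<in> S \<Longrightarrow> dist y x < d1 \<Longrightarrow> dist (?P y) (?P x) < e / 2"
      using cont(1)[unfolded continuous_on_iff, rule_format, OF S(2) half_gt_zero[OF e]] by blast
    obtain d2 where d2: "d2 > 0" "\<And>y. y \<in> S \<Longrightarrow> dist y x < d2 \<Longrightarrow> dist (?Q y) (?Q x) < e / 2"
      using cont(2)[unfolded continuous_on_iff, rule_format, OF S(2) half_gt_zero[OF e]] by blast
    obtain d3 where d3: "d3 > 0" "ball x d3 \<subseteq> S"
      using S openE by blast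
    define d where "d = min d1 (min d2 d3)"
    have "d > 0" using d1 d2 d3 by (simp add: d_def)
    \<comment> \<open>The summand 1 keeps the divisor positive when \<open>u\<close> and
      \<open>v\<close> both vanish. The resulting \<open>t\<close> keeps the whole parallelogram
      within distance \<open>d\<close> of \<open>x\<close>.\<close>
    have N: "norm u + norm v + 1 > 0" by (simp add: add_nonneg_pos)
    then obtain t where "t > 0" and t: "t * (norm u + norm v + 1) = d / 2"
      using \<open>d > 0\<close> by (metis divide_pos_pos half_gt_zero nonzero_divide_eq_eq less_irrefl)
    have close: "dist (x + a *\<^sub>R u + b *\<^sub>R v) x < d" if "0 \<le> a" "a \<le> t" "0 \<le> b" "b \<le> t" for a b
    proof -
      have "dist (x + a *\<^sub>R u + b *\<^sub>R v) x = norm (a *\<^sub>R u + b *\<^sub>R v)"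
        by (simp add: dist_norm algebra_simps)
      also have "\<dots> \<le> a * norm u + b * norm v"
        using that by (metis abs_of_nonneg norm_scaleR norm_triangle_ineq)
      also have "\<dots> \<le> t * norm u + t * norm v"
        using that by (intro add_mono mult_right_mono) auto
      also have "\<dots> \<le> t * (norm u + norm v + 1)"
        using \<open>t > 0\<close> by (simp add: algebra_simps)
      also have "\<dots> = d / 2" by (rule t)
      also have "\<dots> < d" using \<open>d > 0\<close> by simp
      finally show ?thesis .
    qed
    have box: "x + a *\<^sub>R u + b *\<^sub>R v \<in> S" if "0 \<le> a" "a \<le> t" "0 \<le> b" "b \<le> t" for a b
    proof -
      have "dist x (x + a *\<^sub>R u + b *\<^sub>R v) < d3"
        using close[OF that] by (simp add: d_def dist_commute)
      then show ?thesis using d3 by (auto simp: mem_ball)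
    qed
    have box': "x + a *\<^sub>R v + b *\<^sub>R u \<in> S" if "0 \<le> a" "a \<le> t" "0 \<le> b" "b \<le> t" for a b
      using box[of b a] that by (simp add: algebra_simps)
    obtain a b where ab: "0 < a" "a < t" "0 < b" "b < t"
      "f (x + t *\<^sub>R u + t *\<^sub>R v) - f (x + t *\<^sub>R u) - f (x + t *\<^sub>R v) + f x
        = t * t * ?P (x + a *\<^sub>R u + b *\<^sub>R v)"
      by (rule second_difference[OF S(1) f \<open>t > 0\<close> box]) auto
    obtain a' b' where ab': "0 < a'" "a' < t" "0 < b'" "b' < t"
      "f (x + t *\<^sub>R v + t *\<^sub>R u) - f (x + t *\<^sub>R v) - f (x + t *\<^sub>R u) + f x
        = t * t * ?Q (x + a' *\<^sub>R v + b' *\<^sub>R u)"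
      by (rule second_difference[OF S(1) f \<open>t > 0\<close> box']) auto
    have sw: "x + a' *\<^sub>R v + b' *\<^sub>R u = x + b' *\<^sub>R u + a' *\<^sub>R v"
      "x + t *\<^sub>R v + t *\<^sub>R u = x + t *\<^sub>R u + t *\<^sub>R v" by (simp_all add: algebra_simps)
    have "t * t * ?P (x + a *\<^sub>R u + b *\<^sub>R v) = t * t * ?Q (x + b' *\<^sub>R u + a' *\<^sub>R v)"
      using ab(5) ab'(5) unfolding sw by linarith
    then have "?P (x + a *\<^sub>R u + b *\<^sub>R v) = ?Q (x + b' *\<^sub>R u + a' *\<^sub>R v)"
      using \<open>t > 0\<close> by simp
    moreover have "dist (?P (x + a *\<^sub>R u + b *\<^sub>R v)) (?P x) < e / 2"
      using ab close[of a b] box[of a b] by (intro d1) (auto simp: d_def)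
    moreover have "dist (?Q (x + b' *\<^sub>R u + a' *\<^sub>R v)) (?Q x) < e / 2"
      using ab' close[of b' a'] box[of b' a'] by (intro d2) (auto simp: d_def)
    ultimately show ?thesis
      using dist_triangle_half_r[of "?P (x + a *\<^sub>R u + b *\<^sub>R v)" "?P x" e "?Q x"] by simp
  qed
  then have "\<not> dist (?P x) (?Q x) > 0" by blast
  then show ?thesis by simp
qed

section \<open>Passage to vector values through components\<close>

lemma frechet_derivative_inner:
  fixes f :: "'a::real_normed_vector \<Rightarrow> 'b::real_inner"
  assumes "f differentiable (at x)"
  shows "frechet_derivative (\<lambda>y. f y \<bullet> e) (at x) = (\<lambda>h. frechet_derivative f (at x) h \<bullet> e)"
  using has_derivative_frechet_derivative[OF assms]
  by (intro frechet_derivative_eqI) (auto intro!: derivative_eq_intros)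

lemma frechet_derivative_cong_open:
  assumes "open S" "x \<in> S" "\<And>y. y \<in> S \<Longrightarrow> f y = g y"
  shows "frechet_derivative f (at x) = frechet_derivative g (at x)"
proof -
  have "(f has_derivative D) (at x) \<longleftrightarrow> (g has_derivative D) (at x)" for D
    using assms has_derivative_transform_within_open[of f D x UNIV S g]
      has_derivative_transform_within_open[of g D x UNIV S f] by auto
  then show ?thesis by (simp add: frechet_derivative_def)
qed

lemma differentiable_cong_open:
  assumes "f differentiable (at x)" "open S" "x \<in> S" "\<And>y. y \<in> S \<Longrightarrow> f y = g y"
  shows "g differentiable (at x)"
  using assms has_derivative_transform_within_open[of f _ x UNIV S g] by (auto simp: differentiable_def)

lemma Ck_on_cong_open:
  assumes "open S" "\<And>y. y \<in> S \<Longrightarrow> f y = g y" "Ck_on k S f"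
  shows "Ck_on k S g"
  using assms(2,3)
proof (induction k arbitrary: f g)
  case 0
  then show ?case using continuous_on_cong[of S S f g] by simp
next
  case (Suc k)
  have "Ck_on k S (\<lambda>x. frechet_derivative g (at x) v)" for v
  proof (rule Suc.IH)
    show "Ck_on k S (\<lambda>x. frechet_derivative f (at x) v)" using Suc.prems by simp
    show "frechet_derivative f (at y) v = frechet_derivative g (at y) v" if "y \<in> S" for y
      using frechet_derivative_cong_open[OF assms(1) that, of f g] Suc.prems by simp
  qed
  moreover have "g differentiable (at y)" if "y \<in> S" for y
    using differentiable_cong_open[OF _ assms(1) that, of f g] Suc.prems that by simp
  ultimately show ?case by simp
qed

lemma smooth_on_inner:
  fixes f :: "'a::real_normed_vector \<Rightarrow> 'b::real_inner"
  assumes "open S" "smooth_on S f"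
  shows "smooth_on S (\<lambda>x. f x \<bullet> e)"
proof -
  have "Ck_on k S (\<lambda>x. f x \<bullet> e)" if "smooth_on S f" for k f
    using that
  proof (induction k arbitrary: f)
    case 0
    then have "continuous_on S f" by (rule smooth_on_continuous_on)
    then show ?case by (simp add: continuous_on_inner)
  next
    case (Suc k)
    have "Ck_on k S (\<lambda>x. frechet_derivative (\<lambda>y. f y \<bullet> e) (at x) v)" for v
      using Ck_on_cong_open[OF assms(1) _ Suc.IH[OF smooth_on_frechet_derivative[OF Suc.prems]], of v]
        smooth_on_differentiable[OF Suc.prems] by (simp add: frechet_derivative_inner)
    then show ?case using smooth_on_differentiable[OF Suc.prems] by simp
  qed
  then show ?thesis using assms(2) unfolding smooth_on_def[of S "\<lambda>x. f x \<bullet> e"] by blast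
qed

lemma second_derivative_symmetric:
  fixes f :: "'a::real_normed_vector \<Rightarrow> 'b::euclidean_space"
  assumes S: "open S" "x \<in> S" and f: "smooth_on S f"
  shows "frechet_derivative (\<lambda>y. frechet_derivative f (at y) u) (at x) v =
         frechet_derivative (\<lambda>y. frechet_derivative f (at y) v) (at x) u"
proof (rule euclidean_eqI)
  fix e :: 'b assume "e \<in> Basis"
  have *: "frechet_derivative (\<lambda>y. frechet_derivative f (at y) u) (at x) v \<bullet> e =
    frechet_derivative (\<lambda>y. frechet_derivative (\<lambda>y. f y \<bullet> e) (at y) u) (at x) v" for u v
  proof -
    have "frechet_derivative (\<lambda>y. frechet_derivative f (at y) u) (at x) v \<bullet> e =
      frechet_derivative (\<lambda>y. frechet_derivative f (at y) u \<bullet> e) (at x) v"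
      using smooth_on_differentiable[OF smooth_on_frechet_derivative[OF f] S(2)]
      by (simp add: frechet_derivative_inner)
    also have "\<dots> = frechet_derivative (\<lambda>y. frechet_derivative (\<lambda>y. f y \<bullet> e) (at y) u) (at x) v"
      using smooth_on_differentiable[OF f]
      by (subst frechet_derivative_cong_open[OF S]) (simp_all add: frechet_derivative_inner)
    finally show ?thesis .
  qed
  show "frechet_derivative (\<lambda>y. frechet_derivative f (at y) u) (at x) v \<bullet> e =
    frechet_derivative (\<lambda>y. frechet_derivative f (at y) v) (at x) u \<bullet> e"
    unfolding * using second_derivative_symmetric_real[OF S smooth_on_inner[OF S(1) f]] .
qed

section \<open>Product rules for families of linear and bilinear maps\<close>

lemma bilinear_derivative:
  fixes \<beta> :: "'a::real_normed_vector \<Rightarrow> 'v::euclidean_space \<Rightarrow> 'w::euclidean_space \<Rightarrow> 'z::real_normed_vector"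
  assumes S: "open S" "x \<in> S" and bil: "\<And>y. y \<in> S \<Longrightarrow> bilinear (\<beta> y)"
    and diff: "\<And>u v. (\<lambda>y. \<beta> y u v) differentiable (at x)"
    and W: "W differentiable (at x)" and Z: "Z differentiable (at x)"
  shows "((\<lambda>y. \<beta> y (W y) (Z y)) has_derivative
    (\<lambda>h. frechet_derivative (\<lambda>y. \<beta> y (W x) (Z x)) (at x) h
      + \<beta> x (frechet_derivative W (at x) h) (Z x)
      + \<beta> x (W x) (frechet_derivative Z (at x) h))) (at x)"
proof -
  \<comment> \<open>Expansion in the standard basis writes the family as a finite sum of products of
    coordinates with \<open>\<beta> y i j\<close>, so differentiability for fixed arguments is
    enough.\<close>
  have expand: "\<beta> y w z = (\<Sum>i\<in>Basis. \<Sum>j\<in>Basis. ((w \<bullet> i) * (z \<bullet> j)) *\<^sub>R \<beta> y i j)"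
    if y: "y \<in> S" for y w z
  proof -
    have l: "linear (\<lambda>a. \<beta> y a b)" and r: "linear (\<beta> y a)" for a b
      using bil[OF y] by (simp_all add: bilinear_def)
    have "\<beta> y w z = \<beta> y (\<Sum>i\<in>Basis. (w \<bullet> i) *\<^sub>R i) (\<Sum>j\<in>Basis. (z \<bullet> j) *\<^sub>R j)"
      by (simp add: euclidean_representation)
    also have "\<dots> = (\<Sum>i\<in>Basis. (w \<bullet> i) *\<^sub>R \<beta> y i (\<Sum>j\<in>Basis. (z \<bullet> j) *\<^sub>R j))"
      by (simp only: linear_sum[OF l] linear_scale[OF l])
    also have "\<dots> = (\<Sum>i\<in>Basis. \<Sum>j\<in>Basis. ((w \<bullet> i) * (z \<bullet> j)) *\<^sub>R \<beta> y i j)"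
      by (simp only: linear_sum[OF r] linear_scale[OF r] scaleR_sum_right scaleR_scaleR)
    finally show ?thesis .
  qed
  let ?d = "\<lambda>f. frechet_derivative f (at x)"
  define D where "D h w z = (\<Sum>i\<in>Basis. \<Sum>j\<in>Basis. ((w \<bullet> i) * (z \<bullet> j)) *\<^sub>R ?d (\<lambda>y. \<beta> y i j) h)"
    for h w z
  have main: "((\<lambda>y. \<beta> y (W y) (Z y)) has_derivative
    (\<lambda>h. D h (W x) (Z x) + \<beta> x (?d W h) (Z x) + \<beta> x (W x) (?d Z h))) (at x)"
    if W: "W differentiable (at x)" and Z: "Z differentiable (at x)" for W Z
  proof -
    have 1: "((\<lambda>y. ((W y \<bullet> i) * (Z y \<bullet> j)) *\<^sub>R \<beta> y i j) has_derivative
      (\<lambda>h. ((W x \<bullet> i) * (Z x \<bullet> j)) *\<^sub>R ?d (\<lambda>y. \<beta> y i j) h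
        + ((?d W h \<bullet> i) * (Z x \<bullet> j)) *\<^sub>R \<beta> x i j
        + ((W x \<bullet> i) * (?d Z h \<bullet> j)) *\<^sub>R \<beta> x i j)) (at x)" for i j
    proof -
      have "((\<lambda>y. W y \<bullet> i) has_derivative (\<lambda>h. ?d W h \<bullet> i)) (at x)"
        "((\<lambda>y. Z y \<bullet> j) has_derivative (\<lambda>h. ?d Z h \<bullet> j)) (at x)"
        using W Z by (auto intro!: has_derivative_inner_left has_derivative_frechet_derivative)
      from has_derivative_scaleR[OF has_derivative_mult[OF this]
          has_derivative_frechet_derivative[OF diff[of i j]]]
      show ?thesis by (rule has_derivative_eq_rhs) (simp add: algebra_simps)
    qed
    have "((\<lambda>y. \<Sum>i\<in>Basis. \<Sum>j\<in>Basis. ((W y \<bullet> i) * (Z y \<bullet> j)) *\<^sub>R \<beta> y i j) has_derivative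
      (\<lambda>h. \<Sum>i\<in>Basis. \<Sum>j\<in>Basis. ((W x \<bullet> i) * (Z x \<bullet> j)) *\<^sub>R ?d (\<lambda>y. \<beta> y i j) h
        + ((?d W h \<bullet> i) * (Z x \<bullet> j)) *\<^sub>R \<beta> x i j
        + ((W x \<bullet> i) * (?d Z h \<bullet> j)) *\<^sub>R \<beta> x i j)) (at x)"
      by (intro has_derivative_sum 1)
    moreover have "(\<lambda>h. \<Sum>i\<in>Basis. \<Sum>j\<in>Basis. ((W x \<bullet> i) * (Z x \<bullet> j)) *\<^sub>R ?d (\<lambda>y. \<beta> y i j) h
        + ((?d W h \<bullet> i) * (Z x \<bullet> j)) *\<^sub>R \<beta> x i j
        + ((W x \<bullet> i) * (?d Z h \<bullet> j)) *\<^sub>R \<beta> x i j)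
      = (\<lambda>h. D h (W x) (Z x) + \<beta> x (?d W h) (Z x) + \<beta> x (W x) (?d Z h))"
      by (simp add: D_def expand[OF S(2), of "?d W _"] expand[OF S(2), of _ "?d Z _"] sum.distrib)
    ultimately have "((\<lambda>y. \<Sum>i\<in>Basis. \<Sum>j\<in>Basis. ((W y \<bullet> i) * (Z y \<bullet> j)) *\<^sub>R \<beta> y i j) has_derivative
        (\<lambda>h. D h (W x) (Z x) + \<beta> x (?d W h) (Z x) + \<beta> x (W x) (?d Z h))) (at x)"
      by simp
    then show ?thesis
      by (rule has_derivative_transform_within_open[OF _ S]) (rule expand[symmetric])
  qed
  \<comment> \<open>The rule just proved, read for constant fields, identifies the coordinate sum
    \<open>D\<close> with the derivative of \<open>\<beta>\<close> at frozen arguments.\<close>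
  have "D h w z = ?d (\<lambda>y. \<beta> y w z) h" for h w z
    using frechet_derivative_eqI[OF main[of "\<lambda>_. w" "\<lambda>_. z"]] bil[OF S(2)]
    by (simp add: bilinear_lzero bilinear_rzero)
  then show ?thesis using main[OF W Z] by simp
qed

text \<open>A linear family is read as a bilinear one by multiplying with a real first argument,
  which is then set to the constant 1.\<close>

lemma linear_derivative:
  fixes L :: "'a::real_normed_vector \<Rightarrow> 'v::euclidean_space \<Rightarrow> 'z::real_normed_vector"
  assumes S: "open S" "x \<in> S" and lin: "\<And>y. y \<in> S \<Longrightarrow> linear (L y)"
    and diff: "\<And>u. (\<lambda>y. L y u) differentiable (at x)"
    and W: "W differentiable (at x)"
  shows "((\<lambda>y. L y (W y)) has_derivative
    (\<lambda>h. frechet_derivative (\<lambda>y. L y (W x)) (at x) h + L x (frechet_derivative W (at x) h))) (at x)"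
proof -
  have bil: "bilinear (\<lambda>(a::real) w. a *\<^sub>R L y w)" if "y \<in> S" for y
    using lin[OF that] by (auto simp: bilinear_def linear_iff algebra_simps)
  have d: "(\<lambda>y. u *\<^sub>R L y v) differentiable (at x)" for u v
    using diff[of v] by (intro differentiable_scaleR differentiable_const)
  show ?thesis
    using bilinear_derivative[where \<beta> = "\<lambda>y a w. a *\<^sub>R L y w" and W = "\<lambda>_. 1", OF S bil d differentiable_const W]
    by simp
qed

section \<open>Differentiable dependence of solutions of linear systems\<close>

lemma det_differentiable:
  fixes A :: "'a::real_normed_vector \<Rightarrow> real^'n^'n"
  assumes "\<And>i j. (\<lambda>y. A y $ i $ j) differentiable (at x)"
  shows "(\<lambda>y. det (A y)) differentiable (at x)"
proof -
  have "((\<lambda>y. \<Prod>i\<in>UNIV. A y $ i $ p i) has_derivative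
     (\<lambda>h. \<Sum>i\<in>UNIV. frechet_derivative (\<lambda>y. A y $ i $ p i) (at x) h * (\<Prod>j\<in>UNIV - {i}. A x $ j $ p j))) (at x)"
    for p
    by (rule has_derivative_prod) (rule has_derivative_frechet_derivative[OF assms])
  then have "(\<lambda>y. \<Prod>i\<in>UNIV. A y $ i $ p i) differentiable (at x)" for p
    by (auto simp: differentiable_def)
  then show ?thesis
    unfolding det_def by (intro differentiable_sum differentiable_mult differentiable_const) auto
qed

text \<open>Cramer's rule writes each component of \<open>q\<close> as a quotient of determinants
  with differentiable entries. All that is known of \<open>q\<close> is that it solves the
  system.\<close>

lemma solution_differentiable:
  fixes A :: "'a::real_normed_vector \<Rightarrow> real^'n^'n" and q b :: "'a \<Rightarrow> real^'n"
  assumes S: "open S" "x \<in> S" and q: "\<And>y. y \<in> S \<Longrightarrow> A y *v q y = b y"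
    and A: "\<And>i j. (\<lambda>y. A y $ i $ j) differentiable (at x)" "\<And>y. y \<in> S \<Longrightarrow> det (A y) \<noteq> 0"
    and b: "\<And>i. (\<lambda>y. b y $ i) differentiable (at x)"
  shows "q differentiable (at x)"
proof -
  let ?n = "\<lambda>k y. det (\<chi> i j. if j = k then b y $ i else A y $ i $ j)"
  have "(\<lambda>y. (\<chi> i j. if j = k then b y $ i else A y $ i $ j) $ i $ j) differentiable (at x)" for k i j
    using A(1) b by (cases "j = k") auto
  then have "(\<lambda>y. ?n k y / det (A y)) differentiable (at x)" for k
    using S A by (intro differentiable_divide det_differentiable) auto
  then have "(\<lambda>y. q y $ k) differentiable (at x)" for k
  proof (rule differentiable_cong_open[OF _ S])
    fix y assume y: "y \<in> S"
    show "?n k y / det (A y) = q y $ k"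
      using cramer[OF A(2)[OF y], of "q y" "b y"] q[OF y] by (metis (no_types, lifting) vec_lambda_beta)
  qed
  then show ?thesis
    by (subst differentiable_componentwise_within[of _ _ UNIV, simplified])
      (auto simp: Basis_vec_def inner_axis)
qed

section \<open>Inner products on subspaces\<close>

text \<open>The axioms are relative to \<open>S\<close> because the metric of a manifold is
  constrained only on tangent spaces, while the type of tangent vectors contains arbitrary
  coordinate families.\<close>

locale inner_product_on =
  fixes S :: "'v::real_vector set" and g :: "'v \<Rightarrow> 'v \<Rightarrow> real"
  assumes subspace: "subspace S"
    and sym: "x \<in> S \<Longrightarrow> y \<in> S \<Longrightarrow> g x y = g y x"
    and add_left: "x \<in> S \<Longrightarrow> y \<in> S \<Longrightarrow> z \<in> S \<Longrightarrow> g (x + y) z = g x z + g y z"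
    and scale_left: "x \<in> S \<Longrightarrow> y \<in> S \<Longrightarrow> g (a *\<^sub>R x) y = a * g x y"
    and pos: "x \<in> S \<Longrightarrow> x \<noteq> 0 \<Longrightarrow> g x x > 0"
begin

lemmas closed = subspace_add[OF subspace] subspace_scale[OF subspace] subspace_0[OF subspace]
  subspace_diff[OF subspace]

lemma closed_sum: "(\<And>i. i \<in> I \<Longrightarrow> f i \<in> S) \<Longrightarrow> sum f I \<in> S"
  by (rule subspace_sum[OF subspace])

lemma add_right: "x \<in> S \<Longrightarrow> y \<in> S \<Longrightarrow> z \<in> S \<Longrightarrow> g z (x + y) = g z x + g z y"
  by (simp add: sym[of z] add_left closed)

lemma scale_right: "x \<in> S \<Longrightarrow> y \<in> S \<Longrightarrow> g y (a *\<^sub>R x) = a * g y x"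
  by (simp add: sym[of y] scale_left closed)

lemma zero_left: "x \<in> S \<Longrightarrow> g 0 x = 0"
  using scale_left[of 0 x 0] closed by simp

lemma diff_left: "x \<in> S \<Longrightarrow> y \<in> S \<Longrightarrow> z \<in> S \<Longrightarrow> g (x - y) z = g x z - g y z"
  using add_left[of x "(-1) *\<^sub>R y" z] scale_left[of y z "-1"] subspace_scale[OF subspace, of y "-1"] by simp

lemma diff_right: "x \<in> S \<Longrightarrow> y \<in> S \<Longrightarrow> z \<in> S \<Longrightarrow> g z (x - y) = g z x - g z y"
  by (simp add: sym[of z] diff_left closed)

lemma sum_left: "(\<And>i. i \<in> I \<Longrightarrow> f i \<in> S) \<Longrightarrow> z \<in> S \<Longrightarrow> g (sum f I) z = (\<Sum>i\<in>I. g (f i) z)"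
  by (induction I rule: infinite_finite_induct) (simp_all add: zero_left add_left closed_sum)

lemma sum_right: "(\<And>i. i \<in> I \<Longrightarrow> f i \<in> S) \<Longrightarrow> z \<in> S \<Longrightarrow> g z (sum f I) = (\<Sum>i\<in>I. g z (f i))"
  by (simp add: sym[of z] sum_left closed_sum)

lemma nonneg: "x \<in> S \<Longrightarrow> g x x \<ge> 0"
  using pos[of x] zero_left[of x] by (cases "x = 0") auto

lemma self_zero_iff: "x \<in> S \<Longrightarrow> g x x = 0 \<longleftrightarrow> x = 0"
  using pos[of x] zero_left[of x] by (cases "x = 0") auto

lemma subspace_inner_product: "subspace T \<Longrightarrow> T \<subseteq> S \<Longrightarrow> inner_product_on T g"
  by unfold_locales (auto intro: sym add_left scale_left pos)

section \<open>Orthonormal families and Gram-Schmidt\<close>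

definition orthonormal :: "(nat \<Rightarrow> 'v) \<Rightarrow> nat set \<Rightarrow> bool" where
  "orthonormal e I \<longleftrightarrow> finite I \<and> e ` I \<subseteq> S \<and> (\<forall>i\<in>I. \<forall>j\<in>I. g (e i) (e j) = (if i = j then 1 else 0))"

lemma orthonormalD:
  assumes "orthonormal e I"
  shows "finite I" "i \<in> I \<Longrightarrow> e i \<in> S" "i \<in> I \<Longrightarrow> j \<in> I \<Longrightarrow> g (e i) (e j) = (if i = j then 1 else 0)"
  using assms by (auto simp: orthonormal_def)

lemma orthonormal_basis_iff:
  "finite I \<Longrightarrow> orthonormal_basis g S I e \<longleftrightarrow> orthonormal e I \<and> S \<subseteq> span (e ` I)"
  by (auto simp: orthonormal_basis_def orthonormal_def)

lemma orthonormal_coefficient: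
  assumes e: "orthonormal e I" and j: "j \<in> I"
  shows "g (\<Sum>i\<in>I. c i *\<^sub>R e i) (e j) = c j"
proof -
  have "g (\<Sum>i\<in>I. c i *\<^sub>R e i) (e j) = (\<Sum>i\<in>I. g (c i *\<^sub>R e i) (e j))"
    using orthonormalD[OF e] j by (intro sum_left) (auto intro: closed)
  also have "\<dots> = (\<Sum>i\<in>I. if i = j then c i else 0)"
    using orthonormalD[OF e] j by (intro sum.cong) (auto simp: scale_left)
  also have "\<dots> = c j" using orthonormalD(1)[OF e] j by simp
  finally show ?thesis .
qed

lemma orthonormal_inj_on: "orthonormal e I \<Longrightarrow> inj_on e I"
  by (rule inj_onI) (metis orthonormalD(3) zero_neq_one)

lemma orthonormal_span:
  assumes e: "orthonormal e I" and x: "x \<in> span (e ` I)"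
  shows "x = (\<Sum>i\<in>I. g x (e i) *\<^sub>R e i)"
proof -
  obtain c where "x = (\<Sum>v\<in>e ` I. c v *\<^sub>R v)"
    using x orthonormalD(1)[OF e] by (auto simp: span_finite)
  then have "x = (\<Sum>i\<in>I. c (e i) *\<^sub>R e i)"
    by (simp add: sum.reindex[OF orthonormal_inj_on[OF e]])
  then show ?thesis using orthonormal_coefficient[OF e, of _ "\<lambda>i. c (e i)"] by simp
qed

lemma orthonormal_independent:
  assumes e: "orthonormal e I"
  shows "independent (e ` I)"
proof (rule independent_if_scalars_zero)
  show "finite (e ` I)" using orthonormalD(1)[OF e] by simp
  fix c v assume "(\<Sum>v\<in>e ` I. c v *\<^sub>R v) = 0" "v \<in> e ` I"
  then obtain j where j: "j \<in> I" "v = e j" and "(\<Sum>i\<in>I. c (e i) *\<^sub>R e i) = 0"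
    by (auto simp: sum.reindex[OF orthonormal_inj_on[OF e]])
  then show "c v = 0"
    using orthonormal_coefficient[OF e j(1), of "\<lambda>i. c (e i)"] orthonormalD(2)[OF e j(1)]
    by (simp add: zero_left)
qed

lemma orthonormal_basis_dim:
  assumes "orthonormal_basis g S I e" "finite I"
  shows "dim S = card I"
proof -
  have e: "orthonormal e I" and sp: "S \<subseteq> span (e ` I)" using assms orthonormal_basis_iff by auto
  have "span (e ` I) = span S"
  proof
    show "span (e ` I) \<subseteq> span S" using orthonormalD(2)[OF e] by (intro span_mono) auto
    show "span S \<subseteq> span (e ` I)" using span_mono[OF sp] by (simp add: span_span)
  qed
  then have "dim S = card (e ` I)" using orthonormal_independent[OF e] by (rule dim_eq_card)
  then show ?thesis using orthonormal_inj_on[OF e] by (simp add: card_image)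
qed

lemma projection_orthogonal:
  assumes e: "orthonormal e I" and x: "x \<in> S" and y: "y \<in> span (e ` I)"
  shows "g (x - (\<Sum>i\<in>I. g x (e i) *\<^sub>R e i)) y = 0"
proof -
  let ?p = "\<Sum>i\<in>I. g x (e i) *\<^sub>R e i"
  have p: "?p \<in> S" using orthonormalD(2)[OF e] by (intro closed_sum closed)
  have "g (x - ?p) (e j) = 0" if "j \<in> I" for j
    using orthonormal_coefficient[OF e that, of "\<lambda>i. g x (e i)"] orthonormalD(2)[OF e that] p x
    by (simp add: diff_left)
  moreover have "g (x - ?p) y = (\<Sum>i\<in>I. g y (e i) * g (x - ?p) (e i))"
    using orthonormalD(2)[OF e] closed(4)[OF x p]
    by (subst orthonormal_span[OF e y], subst sum_right) (auto intro: closed simp: scale_right)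
  ultimately show ?thesis by simp
qed

text \<open>Gram-Schmidt: a vector outside the current span is made orthogonal and normalised. The
  measure \<open>card A - k\<close> decreases because an independent family in the span of
  \<open>A\<close> has at most \<open>card A\<close> members. The given vectors are kept, so that a
  basis of a subspace can be completed.\<close>

lemma orthonormal_extend:
  assumes A: "finite A" "S \<subseteq> span A" and "orthonormal e {a + 1..a + k}"
  shows "\<exists>e'. (\<forall>i\<in>{a + 1..a + k}. e' i = e i) \<and> orthonormal_basis g S {a + 1..a + dim S} e'"
  using assms(3)
proof (induction "card A - k" arbitrary: e k rule: less_induct)
  case less
  let ?I = "{a + 1..a + k}"
  note e = orthonormalD[OF less.prems]
  show ?case
  proof (cases "S \<subseteq> span (e ` ?I)")
    case True
    then have "orthonormal_basis g S ?I e" using less.prems by (simp add: orthonormal_basis_iff)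
    then show ?thesis using orthonormal_basis_dim[of ?I e] by auto
  next
    case False
    then obtain w where w: "w \<in> S" "w \<notin> span (e ` ?I)" by auto
    define z where "z = w - (\<Sum>i\<in>?I. g w (e i) *\<^sub>R e i)"
    have zS: "z \<in> S" unfolding z_def using e(2) w(1) by (intro closed closed_sum) auto
    have "(\<Sum>i\<in>?I. g w (e i) *\<^sub>R e i) \<in> span (e ` ?I)"
      by (intro span_sum span_scale span_base) auto
    then have "z \<noteq> 0" using w(2) by (auto simp: z_def)
    then have zpos: "g z z > 0" using zS by (rule pos[rotated])
    have orth: "g z (e i) = 0" if "i \<in> ?I" for i
      unfolding z_def using less.prems w(1) by (rule projection_orthogonal) (use that in \<open>auto intro: span_base\<close>)
    define n where "n = (1 / sqrt (g z z)) *\<^sub>R z"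
    define e1 where "e1 = e(a + Suc k := n)"
    have nS: "n \<in> S" using zS by (simp add: n_def closed)
    have nn: "g n n = 1" using zS zpos by (simp add: n_def scale_left scale_right closed)
    have on: "g n (e i) = 0" "g (e i) n = 0" if "i \<in> ?I" for i
      using orth[OF that] zS e(2)[OF that] nS
      by (simp_all add: n_def scale_left scale_right closed sym[of "e i"])
    have I: "{a + 1..a + Suc k} = insert (a + Suc k) ?I" by auto
    have e1: "e1 (a + Suc k) = n" "\<And>i. i \<in> ?I \<Longrightarrow> e1 i = e i" by (auto simp: e1_def)
    have on1: "orthonormal e1 {a + 1..a + Suc k}"
      unfolding orthonormal_def I using e nS nn on e1 by auto
    have "card (e1 ` {a + 1..a + Suc k}) \<le> card A"
      by (rule independent_span_bound[THEN conjunct2, OF A(1) orthonormal_independent[OF on1]])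
        (use orthonormalD(2)[OF on1] A(2) in auto)
    then have "Suc k \<le> card A"
      using orthonormal_inj_on[OF on1] by (simp add: card_image)
    then have "card A - Suc k < card A - k" by simp
    from less.hyps[OF this on1] obtain e'
      where "\<forall>i\<in>{a + 1..a + Suc k}. e' i = e1 i" "orthonormal_basis g S {a + 1..a + dim S} e'"
      by blast
    then show ?thesis using e1 I by (intro exI[of _ e']) auto
  qed
qed

lemma orthonormal_basis_exists:
  assumes "finite A" "S \<subseteq> span A"
  obtains e where "orthonormal_basis g S {a + 1..a + dim S} e"
  using orthonormal_extend[OF assms, of _ a 0] by (auto simp: orthonormal_def)

end

text \<open>\<open>k\<close> is the orthogonal projection of \<open>x\<close>, written in an
  orthonormal basis of \<open>K\<close>. With \<open>K\<close> the kernel of the differential, this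
  splits vectors into horizontal and vertical parts.\<close>

lemma orthogonal_decomposition:
  assumes S: "inner_product_on S g" and A: "finite A" "S \<subseteq> span A"
    and K: "subspace K" "K \<subseteq> S" and x: "x \<in> S"
  obtains k where "k \<in> K" "\<And>y. y \<in> K \<Longrightarrow> g (x - k) y = 0"
proof -
  interpret S: inner_product_on S g by fact
  interpret K: inner_product_on K g by (rule S.subspace_inner_product[OF K])
  obtain e where e: "orthonormal_basis g K {0 + 1..0 + dim K} e"
    using K.orthonormal_basis_exists[OF A(1)] A(2) K(2) by blast
  let ?I = "{0 + 1..0 + dim K}"
  have eK: "K.orthonormal e ?I" and sp: "K \<subseteq> span (e ` ?I)"
    using e by (auto simp: K.orthonormal_basis_iff)
  then have eS: "S.orthonormal e ?I" using K(2) by (auto simp: K.orthonormal_def S.orthonormal_def)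
  show thesis
  proof (rule that)
    show "(\<Sum>i\<in>?I. g x (e i) *\<^sub>R e i) \<in> K"
      using K.orthonormalD(2)[OF eK] by (intro K.closed_sum K.closed)
    show "g (x - (\<Sum>i\<in>?I. g x (e i) *\<^sub>R e i)) y = 0" if "y \<in> K" for y
      using S.projection_orthogonal[OF eS x, of y] sp that by auto
  qed
qed

section \<open>The Gauss equation in coordinates\<close>

text \<open>This and \<open>coord_sff\<close> are the bodies of \<open>curvature\<close> and
  \<open>second_fundamental_form\<close> with the charts stripped off, so that the Gauss equation
  becomes a statement about open sets of coordinate spaces.\<close>

definition coord_curvature ::
  "('v \<Rightarrow> 'v \<Rightarrow> 'v \<Rightarrow> 'v) \<Rightarrow> 'v \<Rightarrow> 'v \<Rightarrow> 'v \<Rightarrow> 'v \<Rightarrow> 'v::real_normed_vector" where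
  "coord_curvature \<Gamma> x u v w =
     cov_deriv \<Gamma> u (\<lambda>y. cov_deriv \<Gamma> v (\<lambda>_. w) y) x - cov_deriv \<Gamma> v (\<lambda>y. cov_deriv \<Gamma> u (\<lambda>_. w) y) x"

definition coord_sff ::
  "('v \<Rightarrow> 'v \<Rightarrow> 'v \<Rightarrow> 'v) \<Rightarrow> ('w \<Rightarrow> 'w \<Rightarrow> 'w \<Rightarrow> 'w) \<Rightarrow> ('v \<Rightarrow> 'w) \<Rightarrow>
     'v::real_normed_vector \<Rightarrow> 'v \<Rightarrow> 'v \<Rightarrow> 'w::real_normed_vector" where
  "coord_sff \<Gamma>1 \<Gamma>2 f x u v =
     pullback_cov_deriv \<Gamma>2 f u (\<lambda>y. frechet_derivative f (at y) v) x
       - frechet_derivative f (at x) (cov_deriv \<Gamma>1 u (\<lambda>_. v) x)"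

definition coord_horizontal ::
  "('v \<Rightarrow> 'v \<Rightarrow> 'v \<Rightarrow> real) \<Rightarrow> ('v \<Rightarrow> 'w::real_normed_vector) \<Rightarrow>
     'v::real_normed_vector \<Rightarrow> 'v \<Rightarrow> bool" where
  "coord_horizontal G f x u \<longleftrightarrow> (\<forall>k. frechet_derivative f (at x) k = 0 \<longrightarrow> G x u k = 0)"

text \<open>The Levi-Civita conditions tested on constant fields, whose bracket is zero: vanishing
  torsion becomes symmetry of \<open>\<Gamma>\<close>, and compatibility becomes a formula for the
  derivatives of the metric coefficients.\<close>

locale metric_connection =
  fixes U :: "(real^'m) set" and G :: "real^'m \<Rightarrow> real^'m \<Rightarrow> real^'m \<Rightarrow> real"
    and \<Gamma> :: "real^'m \<Rightarrow> real^'m \<Rightarrow> real^'m \<Rightarrow> real^'m"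
  assumes open_domain: "open U"
    and metric_bilinear: "x \<in> U \<Longrightarrow> bilinear (G x)"
    and metric_sym: "x \<in> U \<Longrightarrow> G x u v = G x v u"
    and metric_pos: "x \<in> U \<Longrightarrow> u \<noteq> 0 \<Longrightarrow> G x u u > 0"
    and metric_differentiable: "x \<in> U \<Longrightarrow> (\<lambda>y. G y u v) differentiable (at x)"
    and connection_bilinear: "x \<in> U \<Longrightarrow> bilinear (\<Gamma> x)"
    and connection_sym: "x \<in> U \<Longrightarrow> \<Gamma> x u v = \<Gamma> x v u"
    and connection_differentiable: "x \<in> U \<Longrightarrow> (\<lambda>y. \<Gamma> y u v) differentiable (at x)"
    and metric_compatible: "x \<in> U \<Longrightarrow>
      frechet_derivative (\<lambda>y. G y a b) (at x) u = G x (\<Gamma> x u a) b + G x a (\<Gamma> x u b)"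
begin

lemma inner_product_on_metric: "x \<in> U \<Longrightarrow> inner_product_on UNIV (G x)"
  by unfold_locales
    (auto intro: metric_sym metric_pos simp: bilinear_ladd[OF metric_bilinear] bilinear_lmul[OF metric_bilinear])

lemmas metric_simps = bilinear_ladd[OF metric_bilinear] bilinear_radd[OF metric_bilinear]
  bilinear_lsub[OF metric_bilinear] bilinear_rsub[OF metric_bilinear]
  bilinear_lmul[OF metric_bilinear] bilinear_rmul[OF metric_bilinear]
  bilinear_lzero[OF metric_bilinear] bilinear_rzero[OF metric_bilinear]
  bilinear_lneg[OF metric_bilinear] bilinear_rneg[OF metric_bilinear]

lemmas connection_simps = bilinear_ladd[OF connection_bilinear] bilinear_radd[OF connection_bilinear]
  bilinear_lmul[OF connection_bilinear] bilinear_rmul[OF connection_bilinear]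
  bilinear_lzero[OF connection_bilinear] bilinear_rzero[OF connection_bilinear]

section \<open>Nondegeneracy and the Gram matrix of the metric\<close>

lemma metric_eqI: "x \<in> U \<Longrightarrow> (\<And>w. G x u w = G x v w) \<Longrightarrow> u = v"
  using metric_pos[of x "u - v"] by (fastforce simp: metric_simps)

lemma metric_representation:
  assumes "x \<in> U"
  shows "((\<chi> i j. G x (axis j 1) (axis i 1)) *v q) $ i = G x q (axis i 1)"
proof -
  have "G x q (axis i 1) = G x (\<Sum>j\<in>UNIV. (q $ j) *\<^sub>R axis j 1) (axis i 1)"
    using basis_expansion[of q] by (simp add: scalar_mult_eq_scaleR)
  also have "\<dots> = (\<Sum>j\<in>UNIV. q $ j * G x (axis j 1) (axis i 1))"
    using assms metric_bilinear[OF assms]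
    by (subst linear_sum[where f = "\<lambda>u. G x u (axis i 1)"]) (auto simp: bilinear_def metric_simps)
  finally show ?thesis by (simp add: matrix_vector_mult_def mult.commute)
qed

text \<open>A vector in the kernel of the Gram matrix pairs to zero with every axis, hence with
  itself, which positivity allows only for zero.\<close>

lemma metric_matrix_det:
  assumes "x \<in> U"
  shows "det (\<chi> i j. G x (axis j 1) (axis i 1)) \<noteq> 0"
proof -
  have "u = 0" if "(\<chi> i j. G x (axis j 1) (axis i 1)) *v u = 0" for u
  proof -
    have z: "G x u (axis i 1) = 0" for i
      using metric_representation[OF assms, of u i] that by simp
    have "G x u u = G x (\<Sum>j\<in>UNIV. (u $ j) *\<^sub>R axis j 1) u"
      using basis_expansion[of u] by (simp add: scalar_mult_eq_scaleR)
    also have "\<dots> = (\<Sum>j\<in>UNIV. u $ j * G x (axis j 1) u)"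
      using assms metric_bilinear[OF assms]
      by (subst linear_sum[where f = "\<lambda>w. G x w u"]) (auto simp: bilinear_def metric_simps)
    also have "\<dots> = 0" by (simp add: metric_sym[OF assms, of _ u] z)
    finally show ?thesis using metric_pos[OF assms, of u] by fastforce
  qed
  then show ?thesis
    by (simp add: invertible_det_nz[symmetric] invertible_left_inverse matrix_left_invertible_ker)
qed

text \<open>Tested against the coordinate axes, the representing property of \<open>q\<close> is a
  linear system with the Gram matrix. This is the source of the differentiability of the horizontal
  projection.\<close>

lemma riesz_differentiable:
  assumes x: "x \<in> U" and q: "\<And>y w. y \<in> U \<Longrightarrow> G y (q y) w = b y w"
    and b: "\<And>w. (\<lambda>y. b y w) differentiable (at x)"
  shows "q differentiable (at x)"
proof (rule solution_differentiable[OF open_domain x,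
      where A = "\<lambda>y. \<chi> i j. G y (axis j 1) (axis i 1)" and b = "\<lambda>y. \<chi> i. b y (axis i 1)"])
  show "(\<chi> i j. G y (axis j 1) (axis i 1)) *v q y = (\<chi> i. b y (axis i 1))" if "y \<in> U" for y
    using metric_representation[OF that] q[OF that] by (simp add: vec_eq_iff)
qed (simp_all add: metric_differentiable[OF x] metric_matrix_det b)

lemma metric_cov_deriv:
  assumes x: "x \<in> U" and W: "W differentiable (at x)" "Z differentiable (at x)"
  shows "((\<lambda>y. G y (W y) (Z y)) has_derivative
    (\<lambda>u. G x (cov_deriv \<Gamma> u W x) (Z x) + G x (W x) (cov_deriv \<Gamma> u Z x))) (at x)"
  by (rule has_derivative_eq_rhs[OF bilinear_derivative[OF open_domain x metric_bilinear
          metric_differentiable[OF x] W]])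
    (simp_all add: cov_deriv_def metric_compatible[OF x] metric_simps[OF x] algebra_simps)

end

section \<open>Calculus along a map between coordinate domains\<close>

locale coordinate_map =
  source: metric_connection U G\<^sub>1 \<Gamma>\<^sub>1 + target: metric_connection V G\<^sub>2 \<Gamma>\<^sub>2
  for U :: "(real^'m) set" and G\<^sub>1 \<Gamma>\<^sub>1 and V :: "(real^'n) set" and G\<^sub>2 \<Gamma>\<^sub>2 +
  fixes f :: "real^'m \<Rightarrow> real^'n"
  assumes smooth: "smooth_on U f"
    and maps_into: "x \<in> U \<Longrightarrow> f x \<in> V"
    and isometric: "x \<in> U \<Longrightarrow> coord_horizontal G\<^sub>1 f x u \<Longrightarrow> coord_horizontal G\<^sub>1 f x v \<Longrightarrow>
      G\<^sub>2 (f x) (frechet_derivative f (at x) u) (frechet_derivative f (at x) v) = G\<^sub>1 x u v"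
begin

abbreviation "df y \<equiv> frechet_derivative f (at y)"
abbreviation "B \<equiv> coord_sff \<Gamma>\<^sub>1 \<Gamma>\<^sub>2 f"
abbreviation "nab \<equiv> pullback_cov_deriv \<Gamma>\<^sub>2 f"
abbreviation "D \<equiv> cov_deriv \<Gamma>\<^sub>1"
abbreviation "hor \<equiv> coord_horizontal G\<^sub>1 f"

lemma f_differentiable: "x \<in> U \<Longrightarrow> f differentiable (at x)"
  using smooth by (rule smooth_on_differentiable)

lemma df_linear: "x \<in> U \<Longrightarrow> linear (df x)"
  by (simp add: f_differentiable linear_frechet_derivative)

lemmas df_simps = linear_add[OF df_linear] linear_diff[OF df_linear] linear_scale[OF df_linear]
  linear_0[OF df_linear] linear_neg[OF df_linear]

lemma df_differentiable: "x \<in> U \<Longrightarrow> (\<lambda>y. df y v) differentiable (at x)"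
  by (rule smooth_on_differentiable[OF smooth_on_frechet_derivative[OF smooth]])

lemmas target_metric_simps = target.metric_simps[OF maps_into]
lemmas target_connection_simps = target.connection_simps[OF maps_into]

lemma pull_differentiable:
  "x \<in> U \<Longrightarrow> \<phi> differentiable (at (f x)) \<Longrightarrow> (\<lambda>y. \<phi> (f y)) differentiable (at x)"
  using differentiable_chain_at[of f x \<phi>] f_differentiable by (simp add: o_def)

lemma pull_frechet_derivative:
  "x \<in> U \<Longrightarrow> \<phi> differentiable (at (f x)) \<Longrightarrow>
    frechet_derivative (\<lambda>y. \<phi> (f y)) (at x) u = frechet_derivative \<phi> (at (f x)) (df x u)"
  using frechet_derivative_compose[of f x \<phi>] f_differentiable by (simp add: o_def fun_eq_iff)

lemma metric_pull:
  assumes x: "x \<in> U" and E: "E differentiable (at x)" "E' differentiable (at x)"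
  shows "((\<lambda>y. G\<^sub>2 (f y) (E y) (E' y)) has_derivative
    (\<lambda>u. G\<^sub>2 (f x) (nab u E x) (E' x) + G\<^sub>2 (f x) (E x) (nab u E' x))) (at x)"
  by (rule has_derivative_eq_rhs[OF bilinear_derivative[where \<beta> = "\<lambda>y. G\<^sub>2 (f y)", OF source.open_domain x
          target.metric_bilinear[OF maps_into]
          pull_differentiable[OF x target.metric_differentiable[OF maps_into[OF x]]] E]])
    (simp_all add: pullback_cov_deriv_def target_metric_simps[OF x] algebra_simps
      pull_frechet_derivative[OF x target.metric_differentiable[OF maps_into[OF x]]]
      target.metric_compatible[OF maps_into[OF x]])

lemma connection_pull:
  assumes x: "x \<in> U" and E: "E differentiable (at x)" "E' differentiable (at x)"
  shows "((\<lambda>y. \<Gamma>\<^sub>2 (f y) (E y) (E' y)) has_derivative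
    (\<lambda>u. frechet_derivative (\<lambda>z. \<Gamma>\<^sub>2 z (E x) (E' x)) (at (f x)) (df x u)
       + \<Gamma>\<^sub>2 (f x) (frechet_derivative E (at x) u) (E' x)
       + \<Gamma>\<^sub>2 (f x) (E x) (frechet_derivative E' (at x) u))) (at x)"
  by (rule has_derivative_eq_rhs[OF bilinear_derivative[where \<beta> = "\<lambda>y. \<Gamma>\<^sub>2 (f y)", OF source.open_domain x
          target.connection_bilinear[OF maps_into]
          pull_differentiable[OF x target.connection_differentiable[OF maps_into[OF x]]] E]])
    (simp_all add: pull_frechet_derivative[OF x target.connection_differentiable[OF maps_into[OF x]]])

lemma push_derivative:
  assumes x: "x \<in> U" and W: "W differentiable (at x)"
  shows "((\<lambda>y. df y (W y)) has_derivative
    (\<lambda>u. frechet_derivative (\<lambda>y. df y (W x)) (at x) u + df x (frechet_derivative W (at x) u))) (at x)"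
  by (rule linear_derivative[OF source.open_domain x df_linear df_differentiable[OF x] W])

lemma push_differentiable:
  "x \<in> U \<Longrightarrow> W differentiable (at x) \<Longrightarrow> (\<lambda>y. df y (W y)) differentiable (at x)"
  using push_derivative by (auto simp: differentiable_def)

lemma sff_eq: "B x u v = nab u (\<lambda>y. df y v) x - df x (\<Gamma>\<^sub>1 x u v)"
  by (simp add: coord_sff_def cov_deriv_def)

text \<open>The definition of \<open>B\<close> extends its second argument with constant
  coefficients. The product rule shows that any differentiable field gives the same value, which is
  needed for the non-constant fields \<open>P y v\<close>.\<close>

lemma nab_push:
  assumes x: "x \<in> U" and W: "W differentiable (at x)"
  shows "nab u (\<lambda>y. df y (W y)) x = B x u (W x) + df x (D u W x)"
  by (simp add: sff_eq pullback_cov_deriv_def frechet_derivative_eqI[OF push_derivative[OF x W]]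
      cov_deriv_def df_simps[OF x])

lemma nab_add:
  assumes "x \<in> U" "E differentiable (at x)" "E' differentiable (at x)"
  shows "nab u (\<lambda>y. E y + E' y) x = nab u E x + nab u E' x"
  using frechet_derivative_eqI[OF has_derivative_add[OF assms(2,3)[THEN has_derivative_frechet_derivative]]]
  by (simp add: pullback_cov_deriv_def target_connection_simps[OF assms(1)])

text \<open>Second derivatives of \<open>f\<close> commute, and both connections are
  torsion-free.\<close>

lemma sff_sym: "x \<in> U \<Longrightarrow> B x u v = B x v u"
  unfolding sff_eq pullback_cov_deriv_def
  using second_derivative_symmetric[OF source.open_domain _ smooth, of x u v]
    target.connection_sym[OF maps_into, of x "df x u" "df x v"] source.connection_sym[of x u v] smooth
  by simp

lemma sff_linear_left: "x \<in> U \<Longrightarrow> linear (\<lambda>u. B x u v)"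
  using linear_frechet_derivative[OF df_differentiable, of x v]
  by (auto simp: linear_iff sff_eq pullback_cov_deriv_def df_simps target_connection_simps
      source.connection_simps algebra_simps)

lemma sff_bilinear: "x \<in> U \<Longrightarrow> bilinear (B x)"
  using sff_linear_left[of x] sff_sym[of x] by (simp add: bilinear_def)

lemmas sff_simps = bilinear_ladd[OF sff_bilinear] bilinear_radd[OF sff_bilinear]
  bilinear_lsub[OF sff_bilinear] bilinear_rsub[OF sff_bilinear]
  bilinear_lmul[OF sff_bilinear] bilinear_rmul[OF sff_bilinear]
  bilinear_lzero[OF sff_bilinear] bilinear_rzero[OF sff_bilinear]
  bilinear_lneg[OF sff_bilinear] bilinear_rneg[OF sff_bilinear]

lemma sff_differentiable:
  assumes x: "x \<in> U"
  shows "(\<lambda>y. B y u v) differentiable (at x)"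
proof -
  have "(\<lambda>y. frechet_derivative (\<lambda>y. df y v) (at y) u) differentiable (at x)"
    by (rule smooth_on_differentiable[OF smooth_on_frechet_derivative[OF smooth_on_frechet_derivative[OF smooth]] x])
  moreover have "(\<lambda>y. \<Gamma>\<^sub>2 (f y) (df y u) (df y v)) differentiable (at x)"
    using connection_pull[OF x df_differentiable[OF x] df_differentiable[OF x]] by (auto simp: differentiable_def)
  moreover have "(\<lambda>y. df y (\<Gamma>\<^sub>1 y u v)) differentiable (at x)"
    by (rule push_differentiable[OF x source.connection_differentiable[OF x]])
  ultimately show ?thesis
    unfolding sff_eq pullback_cov_deriv_def by (intro differentiable_add differentiable_diff)
qed

text \<open>The directions \<open>u\<close> and \<open>v\<close> are constant, so no bracket
  appears. The second derivatives of \<open>E\<close> and of \<open>f\<close> cancel by symmetry,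
  and what remains is the curvature of the target along the image directions.\<close>

lemma nab_commutator:
  assumes x: "x \<in> U" and E: "smooth_on U E"
  shows "nab u (\<lambda>y. nab v E y) x - nab v (\<lambda>y. nab u E y) x
    = coord_curvature \<Gamma>\<^sub>2 (f x) (df x u) (df x v) (E x)"
proof -
  let ?E' = "\<lambda>v y. frechet_derivative E (at y) v"
  have dE': "?E' v differentiable (at y)" if "y \<in> U" for v y
    by (rule smooth_on_differentiable[OF smooth_on_frechet_derivative[OF E] that])
  have "frechet_derivative (\<lambda>y. nab v E y) (at x) u =
     frechet_derivative (?E' v) (at x) u
       + (frechet_derivative (\<lambda>z. \<Gamma>\<^sub>2 z (df x v) (E x)) (at (f x)) (df x u)
       + \<Gamma>\<^sub>2 (f x) (frechet_derivative (\<lambda>y. df y v) (at x) u) (E x)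
       + \<Gamma>\<^sub>2 (f x) (df x v) (?E' u x))" for u v
    unfolding pullback_cov_deriv_def
    by (subst frechet_derivative_eqI[OF has_derivative_add[OF has_derivative_frechet_derivative[OF dE'[OF x]]
            connection_pull[OF x df_differentiable[OF x] smooth_on_differentiable[OF E x]]]]) simp
  note d = this
  have c: "cov_deriv \<Gamma>\<^sub>2 a (\<lambda>y. cov_deriv \<Gamma>\<^sub>2 b (\<lambda>_. w) y) z
    = frechet_derivative (\<lambda>y. \<Gamma>\<^sub>2 y b w) (at z) a + \<Gamma>\<^sub>2 z a (\<Gamma>\<^sub>2 z b w)" for a b w z
    by (simp add: cov_deriv_def)
  show ?thesis
    unfolding pullback_cov_deriv_def[of _ _ _ "\<lambda>y. nab _ E y"] d coord_curvature_def c
    using second_derivative_symmetric[OF source.open_domain x E, of u v]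
      second_derivative_symmetric[OF source.open_domain x smooth, of u v]
    by (simp add: pullback_cov_deriv_def target_connection_simps[OF x])
qed

section \<open>The horizontal projection\<close>

lemma horizontal_projection_exists:
  assumes x: "x \<in> U"
  obtains q where "hor x q" "df x q = df x u"
proof -
  let ?K = "{k. df x k = 0}"
  have "subspace ?K"
    using df_simps[OF x] by (auto simp: subspace_def)
  then obtain k where "k \<in> ?K" "\<And>y. y \<in> ?K \<Longrightarrow> G\<^sub>1 x (u - k) y = 0"
    using orthogonal_decomposition[OF source.inner_product_on_metric[OF x], of Basis ?K u]
    by (auto simp: finite_Basis)
  then show thesis
    by (intro that[of "u - k"]) (auto simp: coord_horizontal_def df_simps[OF x])
qed

text \<open>One horizontal argument suffices in the isometry condition: replacing \<open>w\<close>
  by its horizontal part changes neither \<open>df x w\<close> nor the pairing with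
  \<open>q\<close>, since the difference is vertical.\<close>

lemma horizontal_metric:
  assumes x: "x \<in> U" and q: "hor x q"
  shows "G\<^sub>2 (f x) (df x q) (df x w) = G\<^sub>1 x q w"
proof -
  obtain w' where w': "hor x w'" "df x w' = df x w"
    by (rule horizontal_projection_exists[OF x])
  have "G\<^sub>1 x q (w - w') = 0"
    using q w' by (simp add: coord_horizontal_def df_simps[OF x])
  then show ?thesis using isometric[OF x q w'(1)] w'(2) by (simp add: source.metric_simps[OF x])
qed

text \<open>The choice is forced for \<open>y\<close> in \<open>U\<close>: by
  \<open>P_metric\<close> all pairings of the chosen vector are determined.\<close>

definition P :: "real^'m \<Rightarrow> real^'m \<Rightarrow> real^'m" where
  "P y u = (SOME q. hor y q \<and> df y q = df y u)"

lemma P: "x \<in> U \<Longrightarrow> hor x (P x u)" "x \<in> U \<Longrightarrow> df x (P x u) = df x u"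
  unfolding P_def using someI_ex[of "\<lambda>q. hor x q \<and> df x q = df x u"] horizontal_projection_exists[of x u]
  by blast+

lemma P_metric: "x \<in> U \<Longrightarrow> G\<^sub>1 x (P x u) w = G\<^sub>2 (f x) (df x u) (df x w)"
  using horizontal_metric[OF _ P(1)] P(2) by simp

lemma P_horizontal: "x \<in> U \<Longrightarrow> hor x v \<Longrightarrow> P x v = v"
  by (rule source.metric_eqI[of x]) (simp_all add: P_metric horizontal_metric)

lemma P_vertical: "x \<in> U \<Longrightarrow> df x k = 0 \<Longrightarrow> P x k = 0"
  by (rule source.metric_eqI[of x]) (simp_all add: P_metric target_metric_simps source.metric_simps)

text \<open>Although \<open>P\<close> is defined by choice, it represents the functional that sends
  \<open>w\<close> to the pairing of \<open>df y u\<close> with \<open>df y w\<close>, and this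
  depends differentiably on \<open>y\<close>.\<close>

lemma P_differentiable: "x \<in> U \<Longrightarrow> (\<lambda>y. P y u) differentiable (at x)"
proof (rule source.riesz_differentiable[where b = "\<lambda>y w. G\<^sub>2 (f y) (df y u) (df y w)"])
  show "(\<lambda>y. G\<^sub>2 (f y) (df y u) (df y w)) differentiable (at x)" if "x \<in> U" for w
    using metric_pull[OF that df_differentiable[OF that] df_differentiable[OF that]]
    by (auto simp: differentiable_def)
qed (simp_all add: P_metric)

section \<open>The form C and its vanishing on horizontal vectors\<close>

definition C :: "real^'m \<Rightarrow> real^'m \<Rightarrow> real^'m \<Rightarrow> real^'m \<Rightarrow> real" where
  "C x u v w = G\<^sub>2 (f x) (B x u v) (df x w)"

lemmas C_simps = sff_simps target_metric_simps df_simps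

lemma C_sym: "x \<in> U \<Longrightarrow> C x u v w = C x v u w"
  by (simp add: C_def sff_sym[of x u v])

text \<open>Both sides of the identity for \<open>P\<close> are differentiated along
  \<open>u\<close>, with \<open>w\<close> constant. The terms with
  \<open>\<Gamma>\<^sub>1 x u w\<close> cancel by \<open>horizontal_metric\<close>, because
  \<open>v\<close> is horizontal.\<close>

lemma cov_deriv_P:
  assumes x: "x \<in> U" and v: "hor x v"
  shows "G\<^sub>1 x (D u (\<lambda>y. P y v) x) w =
    G\<^sub>2 (f x) (df x (D u (\<lambda>y. P y v) x)) (df x w) + C x u v w + C x u w v"
proof -
  note Pd = P_differentiable[OF x, of v]
  have eq: "frechet_derivative (\<lambda>y. G\<^sub>1 y (P y v) w) (at x) =
      frechet_derivative (\<lambda>y. G\<^sub>2 (f y) (df y (P y v)) (df y w)) (at x)"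
    by (rule frechet_derivative_cong_open[OF source.open_domain x]) (simp add: P_metric P(2))
  have "G\<^sub>1 x (D u (\<lambda>y. P y v) x) w + G\<^sub>1 x v (\<Gamma>\<^sub>1 x u w) =
     G\<^sub>2 (f x) (nab u (\<lambda>y. df y (P y v)) x) (df x w) + G\<^sub>2 (f x) (df x v) (nab u (\<lambda>y. df y w) x)"
    using fun_cong[OF eq, of u] P_horizontal[OF x v]
      frechet_derivative_eqI[OF source.metric_cov_deriv[OF x Pd, of "\<lambda>_. w"]]
      frechet_derivative_eqI[OF metric_pull[OF x push_differentiable[OF x Pd] df_differentiable[OF x, of w]]]
    by (simp add: cov_deriv_def)
  then show ?thesis
    using target.metric_sym[OF maps_into[OF x], of "df x v" "B x u w"]
    by (simp add: nab_push[OF x Pd] P_horizontal[OF x v] C_def target_metric_simps[OF x]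
        horizontal_metric[OF x v, symmetric] sff_eq[of x u w])
qed

text \<open>For horizontal \<open>w\<close> the two terms of \<open>cov_deriv_P\<close> that contain
  the derivative of \<open>P y v\<close> are equal by \<open>horizontal_metric\<close>, so the
  remaining two add up to zero.\<close>

lemma C_antisym:
  assumes x: "x \<in> U" and vw: "hor x v" "hor x w"
  shows "C x u w v = - C x u v w"
  using cov_deriv_P[OF x vw(1), of u w] horizontal_metric[OF x vw(2), of "D u (\<lambda>y. P y v) x"]
    source.metric_sym[OF x, of w] target.metric_sym[OF maps_into[OF x], of "df x w"]
  by simp

text \<open>Symmetry in the first two slots and antisymmetry in the last two are incompatible:
  alternating them six times returns to the start with three sign changes. The last argument may be
  arbitrary, since \<open>C\<close> sees it only through \<open>df\<close>, which does not
  distinguish \<open>w\<close> from \<open>P x w\<close>.\<close>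

lemma C_horizontal:
  assumes x: "x \<in> U" and uv: "hor x u" "hor x v"
  shows "C x u v w = 0"
proof -
  let ?w = "P x w"
  note w = P(1)[OF x, of w]
  have "C x u v ?w = - C x u ?w v" using C_antisym[OF x uv(2) w, of u] by simp
  also have "\<dots> = - C x ?w u v" by (simp add: C_sym[OF x, of u ?w])
  also have "\<dots> = C x ?w v u" using C_antisym[OF x uv(1,2), of ?w] by simp
  also have "\<dots> = C x v ?w u" by (rule C_sym[OF x])
  also have "\<dots> = - C x v u ?w" using C_antisym[OF x uv(1) w, of v] by simp
  also have "\<dots> = - C x u v ?w" by (simp add: C_sym[OF x, of u v])
  finally show ?thesis by (simp add: C_def P(2)[OF x])
qed

text \<open>The field \<open>k - P y k\<close> extends \<open>k\<close> by vertical vectors, so its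
  image under \<open>df\<close> is identically zero. Differentiating this zero field along
  \<open>u\<close> by \<open>nab_push\<close> leaves \<open>B x u k\<close> as an image under
  \<open>df x\<close>.\<close>

lemma sff_vertical:
  assumes x: "x \<in> U" and k: "df x k = 0"
  shows "B x u k \<in> range (df x)"
proof -
  let ?K = "\<lambda>y. k - P y k"
  have K: "?K differentiable (at x)" by (intro differentiable_diff differentiable_const P_differentiable x)
  have "frechet_derivative (\<lambda>y. df y (?K y)) (at x) = frechet_derivative (\<lambda>_. 0) (at x)"
    by (rule frechet_derivative_cong_open[OF source.open_domain x]) (simp add: P(2) df_simps)
  then have "nab u (\<lambda>y. df y (?K y)) x = 0"
    by (simp add: pullback_cov_deriv_def df_simps[OF x] P(2)[OF x] target_connection_simps[OF x])
  then have "B x u k = df x (- D u ?K x)"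
    using nab_push[OF x K, of u] P_vertical[OF x k] by (simp add: df_simps[OF x] eq_neg_iff_add_eq_0)
  then show ?thesis by blast
qed

section \<open>The integrability tensor and the Gauss equation\<close>

definition a :: "real^'m \<Rightarrow> real^'m \<Rightarrow> real^'m \<Rightarrow> real^'m" where
  "a x u v = D u (\<lambda>y. P y v) x - P x (D u (\<lambda>y. P y v) x)"

lemma a_vertical: "x \<in> U \<Longrightarrow> df x (a x u v) = 0"
  by (simp add: a_def df_simps P(2))

text \<open>In \<open>cov_deriv_P\<close>, tested on a vertical \<open>k\<close>, every term with
  \<open>df x k\<close> drops out; the horizontal part of the derivative is orthogonal to
  \<open>k\<close> as well.\<close>

lemma a_metric:
  assumes x: "x \<in> U" and v: "hor x v" and k: "df x k = 0"
  shows "G\<^sub>1 x (a x u v) k = C x u k v"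
  using cov_deriv_P[OF x v, of u k] k
  by (simp add: a_def source.metric_simps[OF x] P_metric[OF x] target_metric_simps[OF x] C_def)

text \<open>The sum \<open>?s\<close> is vertical, so \<open>a_metric\<close> gives its squared
  length as \<open>C x u ?s v + C x v ?s u\<close>, which is zero by \<open>C_antisym\<close> after
  moving \<open>?s\<close> to the front. Hence \<open>a\<close> is half the vertical part of the
  bracket of horizontal extensions, as O'Neill's tensor is for a submersion.\<close>

lemma a_antisym:
  assumes x: "x \<in> U" and uv: "hor x u" "hor x v"
  shows "a x v u = - a x u v"
proof -
  let ?s = "a x u v + a x v u"
  have "df x ?s = 0" by (simp add: df_simps[OF x] a_vertical[OF x])
  then have "G\<^sub>1 x ?s ?s = C x u ?s v + C x v ?s u"
    by (simp add: source.metric_simps(1)[OF x, of "a x u v"] a_metric[OF x] uv del: source.metric_simps)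
  also have "\<dots> = 0"
    using C_antisym[OF x uv, of ?s] by (simp add: C_sym[OF x, of _ ?s])
  finally have "?s = 0" using source.metric_pos[OF x, of ?s] by fastforce
  then show ?thesis by (simp add: eq_neg_iff_add_eq_0 add.commute)
qed

text \<open>The function \<open>C y (P y v) (P y w) z\<close> is identically zero, and
  \<open>z\<close> may stay constant because \<open>C_horizontal\<close> puts no condition on the
  last slot. In the derivative of \<open>P y v\<close> the horizontal part is killed by
  \<open>C_horizontal\<close>, the vertical part \<open>a x u v\<close> becomes a pairing by
  \<open>a_metric\<close>, and a connection term is left.\<close>

lemma C_derivative:
  assumes x: "x \<in> U" and vw: "hor x v" "hor x w" and z: "hor x z"
  shows "frechet_derivative (\<lambda>y. C y v w z) (at x) u =
    C x (\<Gamma>\<^sub>1 x u v) w z + C x v (\<Gamma>\<^sub>1 x u w) z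
    - G\<^sub>1 x (a x w z) (a x u v) - G\<^sub>1 x (a x v z) (a x u w)"
proof -
  have bil: "bilinear (\<lambda>p q. C y p q z)" if "y \<in> U" for y
    using that by (auto simp: bilinear_def linear_iff C_def C_simps)
  have dC: "(\<lambda>y. C y p q z) differentiable (at x)" for p q
    using metric_pull[OF x sff_differentiable[OF x] df_differentiable[OF x]]
    by (auto simp: differentiable_def C_def)
  have "frechet_derivative (\<lambda>y. C y (P y v) (P y w) z) (at x) = frechet_derivative (\<lambda>_. 0) (at x)"
    by (rule frechet_derivative_cong_open[OF source.open_domain x]) (simp add: C_horizontal P(1))
  then have sum0: "frechet_derivative (\<lambda>y. C y v w z) (at x) u
      + C x (frechet_derivative (\<lambda>y. P y v) (at x) u) w z
      + C x v (frechet_derivative (\<lambda>y. P y w) (at x) u) z = 0"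
    using frechet_derivative_eqI[OF bilinear_derivative[where \<beta> = "\<lambda>y p q. C y p q z",
          OF source.open_domain x bil dC P_differentiable[OF x, of v] P_differentiable[OF x, of w]]]
      P_horizontal[OF x] vw by (simp add: fun_eq_iff)
  have dP: "frechet_derivative (\<lambda>y. P y v) (at x) u
      = a x u v + P x (D u (\<lambda>y. P y v) x) - \<Gamma>\<^sub>1 x u v" if "hor x v" for v
    using P_horizontal[OF x that] by (simp add: a_def cov_deriv_def)
  have add: "C x (p + q - r) w z = C x p w z + C x q w z - C x r w z" for p q r w
    by (simp add: C_def C_simps[OF x])
  have 1: "C x (frechet_derivative (\<lambda>y. P y v) (at x) u) w z = G\<^sub>1 x (a x w z) (a x u v) - C x (\<Gamma>\<^sub>1 x u v) w z"
    if "hor x v" "hor x w" for v w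
    unfolding dP[OF that(1)] add
    using a_metric[OF x z a_vertical[OF x], of w u v] C_horizontal[OF x P(1)[OF x] that(2)]
    by (simp add: C_sym[OF x, of w])
  show ?thesis
    using sum0 1[OF vw] 1[OF vw(2,1)] by (simp add: C_sym[OF x, of v])
qed

text \<open>Commuting derivatives of the field \<open>df y v\<close> expresses the curvature of the
  target through derivatives of \<open>B\<close>. Paired with \<open>df x u\<close>, these are given
  by \<open>C_derivative\<close>; the terms with connection coefficients cancel, and antisymmetry
  removes \<open>a x u u\<close>.\<close>

lemma gauss:
  assumes x: "x \<in> U" and uv: "hor x u" "hor x v"
  shows "G\<^sub>1 x (coord_curvature \<Gamma>\<^sub>1 x u v v) u =
    G\<^sub>2 (f x) (coord_curvature \<Gamma>\<^sub>2 (f x) (df x u) (df x v) (df x v)) (df x u)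
    + G\<^sub>2 (f x) (B x u u) (B x v v) - G\<^sub>2 (f x) (B x u v) (B x u v)
    - 3 * G\<^sub>1 x (a x u v) (a x u v)"
proof -
  have nab2: "nab u (\<lambda>y. nab v (\<lambda>y. df y w) y) x
      = nab u (\<lambda>y. B y v w) x + B x u (\<Gamma>\<^sub>1 x v w) + df x (D u (\<lambda>y. \<Gamma>\<^sub>1 y v w) x)" for u v w
  proof -
    have "(\<lambda>y. nab v (\<lambda>y. df y w) y) = (\<lambda>y. B y v w + df y (\<Gamma>\<^sub>1 y v w))" by (simp add: sff_eq)
    then show ?thesis
      using nab_add[OF x sff_differentiable[OF x] push_differentiable[OF x source.connection_differentiable[OF x]]]
        nab_push[OF x source.connection_differentiable[OF x]] by (simp add: add.assoc)
  qed
  have dC: "G\<^sub>2 (f x) (nab u (\<lambda>y. B y p q) x) (df x z) =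
      frechet_derivative (\<lambda>y. C y p q z) (at x) u - G\<^sub>2 (f x) (B x p q) (B x u z) - C x p q (\<Gamma>\<^sub>1 x u z)"
    for u p q z
    using frechet_derivative_eqI[OF metric_pull[OF x sff_differentiable[OF x, of p q] df_differentiable[OF x, of z]]]
    by (simp add: C_def sff_eq[of x u z] target_metric_simps[OF x])
  have curv1: "coord_curvature \<Gamma>\<^sub>1 x u v v = D u (\<lambda>y. \<Gamma>\<^sub>1 y v v) x - D v (\<lambda>y. \<Gamma>\<^sub>1 y u v) x"
    by (simp add: coord_curvature_def cov_deriv_def)
  have "coord_curvature \<Gamma>\<^sub>2 (f x) (df x u) (df x v) (df x v) =
     nab u (\<lambda>y. B y v v) x + B x u (\<Gamma>\<^sub>1 x v v) + df x (D u (\<lambda>y. \<Gamma>\<^sub>1 y v v) x)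
     - (nab v (\<lambda>y. B y u v) x + B x v (\<Gamma>\<^sub>1 x u v) + df x (D v (\<lambda>y. \<Gamma>\<^sub>1 y u v) x))"
    using nab_commutator[OF x smooth_on_frechet_derivative[OF smooth], of u v v] by (simp add: nab2)
  then have "G\<^sub>2 (f x) (coord_curvature \<Gamma>\<^sub>2 (f x) (df x u) (df x v) (df x v)) (df x u) =
     G\<^sub>2 (f x) (nab u (\<lambda>y. B y v v) x) (df x u) + C x u (\<Gamma>\<^sub>1 x v v) u
     - G\<^sub>2 (f x) (nab v (\<lambda>y. B y u v) x) (df x u) - C x v (\<Gamma>\<^sub>1 x u v) u
     + G\<^sub>2 (f x) (df x (coord_curvature \<Gamma>\<^sub>1 x u v v)) (df x u)"
    by (simp add: curv1 C_def target_metric_simps[OF x] df_simps[OF x])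
  moreover have "G\<^sub>2 (f x) (df x (coord_curvature \<Gamma>\<^sub>1 x u v v)) (df x u)
      = G\<^sub>1 x (coord_curvature \<Gamma>\<^sub>1 x u v v) u"
    using horizontal_metric[OF x uv(1)] source.metric_sym[OF x] target.metric_sym[OF maps_into[OF x]] by metis
  moreover have "a x u u = 0" using a_antisym[OF x uv(1,1)] by (simp only: vec_eq_iff) simp
  moreover have "G\<^sub>2 (f x) (B x v v) (B x u u) = G\<^sub>2 (f x) (B x u u) (B x v v)"
    by (rule target.metric_sym[OF maps_into[OF x]])
  ultimately show ?thesis
    using uv C_horizontal[OF x] a_antisym[OF x uv]
    by (simp add: dC C_derivative[OF x] source.metric_simps[OF x] sff_sym[OF x, of v u]
        source.connection_sym[OF x, of v u] C_sym[OF x, of v "\<Gamma>\<^sub>1 x u v"])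
qed

end

section \<open>Ricci curvature and the second fundamental form at a point\<close>

text \<open>All that is needed at a single point, as linear algebra. The vertical vector of the
  Gauss equation is described by its pairings with \<open>K\<close>, so that no derivative is
  left.\<close>

locale pointwise_gauss =
  first: inner_product_on T\<^sub>1 g\<^sub>1 + second: inner_product_on T\<^sub>2 g\<^sub>2
  for T\<^sub>1 :: "'v::real_vector set" and g\<^sub>1 and T\<^sub>2 :: "'w::real_vector set" and g\<^sub>2 +
  fixes L :: "'v \<Rightarrow> 'w" and B :: "'v \<Rightarrow> 'v \<Rightarrow> 'w"
    and R\<^sub>1 :: "'v \<Rightarrow> 'v \<Rightarrow> 'v \<Rightarrow> 'v" and R\<^sub>2 :: "'w \<Rightarrow> 'w \<Rightarrow> 'w \<Rightarrow> 'w" and K H :: "'v set" and r n :: nat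
  assumes K_def: "K = {X \<in> T\<^sub>1. L X = 0}"
    and H_def: "H = {X \<in> T\<^sub>1. \<forall>V\<in>K. g\<^sub>1 X V = 0}"
    and finite_dim_first: "\<exists>A. finite A \<and> T\<^sub>1 \<subseteq> span A"
    and finite_dim_second: "\<exists>A. finite A \<and> T\<^sub>2 \<subseteq> span A"
    and dim_second: "dim T\<^sub>2 = n"
    and rank: "dim (L ` T\<^sub>1) = r"
    and L_linear: "linear L" and L_maps: "X \<in> T\<^sub>1 \<Longrightarrow> L X \<in> T\<^sub>2"
    and B_bilinear: "bilinear B" and B_sym: "B X Y = B Y X"
    and B_maps: "X \<in> T\<^sub>1 \<Longrightarrow> Y \<in> T\<^sub>1 \<Longrightarrow> B X Y \<in> T\<^sub>2"
    and isometric: "X \<in> H \<Longrightarrow> Y \<in> H \<Longrightarrow> g\<^sub>1 X Y = g\<^sub>2 (L X) (L Y)"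
    and B_horizontal: "X \<in> H \<Longrightarrow> Y \<in> H \<Longrightarrow> Z \<in> T\<^sub>1 \<Longrightarrow> g\<^sub>2 (B X Y) (L Z) = 0"
    and B_vertical: "X \<in> T\<^sub>1 \<Longrightarrow> V \<in> K \<Longrightarrow> B X V \<in> L ` T\<^sub>1"
    and B_mixed_antisym: "X \<in> H \<Longrightarrow> Y \<in> H \<Longrightarrow> V \<in> K \<Longrightarrow> g\<^sub>2 (B X V) (L Y) = - g\<^sub>2 (B Y V) (L X)"
    and gauss: "X \<in> H \<Longrightarrow> Y \<in> H \<Longrightarrow> \<exists>a\<in>K. (\<forall>V\<in>K. g\<^sub>1 a V = g\<^sub>2 (B X V) (L Y)) \<and>
      g\<^sub>1 (R\<^sub>1 X Y Y) X = g\<^sub>2 (R\<^sub>2 (L X) (L Y) (L Y)) (L X)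
        + g\<^sub>2 (B X X) (B Y Y) - g\<^sub>2 (B X Y) (B X Y) - 3 * g\<^sub>1 a a"
begin

declare One_nat_def [simp del]

lemmas L_simps = linear_add[OF L_linear] linear_diff[OF L_linear] linear_scale[OF L_linear]
  linear_0[OF L_linear]

lemmas B_simps = bilinear_ladd[OF B_bilinear] bilinear_radd[OF B_bilinear]
  bilinear_lsub[OF B_bilinear] bilinear_rsub[OF B_bilinear]
  bilinear_lmul[OF B_bilinear] bilinear_rmul[OF B_bilinear]
  bilinear_lzero[OF B_bilinear] bilinear_rzero[OF B_bilinear]

lemma K_subspace: "subspace K"
  using first.closed by (auto simp: K_def subspace_def L_simps)

lemma K_T: "V \<in> K \<Longrightarrow> V \<in> T\<^sub>1" and L_K: "V \<in> K \<Longrightarrow> L V = 0"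
  by (auto simp: K_def)

lemma H_T: "X \<in> H \<Longrightarrow> X \<in> T\<^sub>1" and H_K: "X \<in> H \<Longrightarrow> V \<in> K \<Longrightarrow> g\<^sub>1 X V = 0"
  by (auto simp: H_def)

lemma H_subspace: "subspace H"
  using first.closed K_T
  by (auto simp: H_def subspace_def first.zero_left first.add_left first.scale_left)

sublocale horizontal: inner_product_on H g\<^sub>1
  by (rule first.subspace_inner_product[OF H_subspace]) (auto intro: H_T)

sublocale vertical: inner_product_on K g\<^sub>1
  by (rule first.subspace_inner_product[OF K_subspace]) (auto intro: K_T)

section \<open>Horizontal and vertical parts, horizontal bases\<close>

lemma decomposition:
  assumes "X \<in> T\<^sub>1"
  obtains Y V where "Y \<in> H" "V \<in> K" "X = Y + V"
proof -
  obtain A where A: "finite A" "T\<^sub>1 \<subseteq> span A" using finite_dim_first by blast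
  obtain V where V: "V \<in> K" "\<And>W. W \<in> K \<Longrightarrow> g\<^sub>1 (X - V) W = 0"
    using orthogonal_decomposition[OF first.inner_product_on_axioms A K_subspace _ assms] K_T by blast
  then have "X - V \<in> H" using assms K_T first.closed by (auto simp: H_def)
  then show thesis using V by (intro that[of "X - V" V]) auto
qed

lemma range_eq: "L ` T\<^sub>1 = L ` H"
proof
  show "L ` T\<^sub>1 \<subseteq> L ` H"
  proof
    fix W assume "W \<in> L ` T\<^sub>1"
    then obtain X where X: "X \<in> T\<^sub>1" "W = L X" by blast
    obtain Y V where "Y \<in> H" "V \<in> K" "X = Y + V" by (rule decomposition[OF X(1)])
    then show "W \<in> L ` H" using X L_K by (auto simp: L_simps)
  qed
qed (auto intro: H_T)

lemma finite_dim_H: "\<exists>A. finite A \<and> H \<subseteq> span A"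
  using finite_dim_first H_T by (meson subset_iff)

lemma range_subspace: "subspace (L ` T\<^sub>1)"
  by (rule linear_subspace_image[OF L_linear first.subspace])

sublocale range: inner_product_on "L ` T\<^sub>1" g\<^sub>2
  by (rule second.subspace_inner_product[OF range_subspace]) (auto intro: L_maps)

lemma range_basis:
  assumes "orthonormal_basis g\<^sub>1 H I h"
  shows "orthonormal_basis g\<^sub>2 (L ` T\<^sub>1) I (L \<circ> h)"
proof -
  have h: "h ` I \<subseteq> H" "H \<subseteq> span (h ` I)" "\<And>i j. i \<in> I \<Longrightarrow> j \<in> I \<Longrightarrow> g\<^sub>1 (h i) (h j) = (if i = j then 1 else 0)"
    using assms by (auto simp: orthonormal_basis_def)
  have "L ` H \<subseteq> span (L ` h ` I)"
    using h(2) linear_span_image[OF L_linear] by (metis image_mono)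
  then have "L ` T\<^sub>1 \<subseteq> span ((L \<circ> h) ` I)"
    by (simp add: range_eq image_comp)
  moreover have "g\<^sub>2 (L (h i)) (L (h j)) = (if i = j then 1 else 0)" if "i \<in> I" "j \<in> I" for i j
  proof -
    have "h i \<in> H" "h j \<in> H" using h(1) that by auto
    then show ?thesis using h(3)[OF that] by (simp add: isometric[symmetric])
  qed
  moreover have "(L \<circ> h) ` I \<subseteq> L ` T\<^sub>1" using h(1) H_T by auto
  ultimately show ?thesis by (simp add: orthonormal_basis_def)
qed

text \<open>\<open>L\<close> is isometric on \<open>H\<close> and maps it onto the range, so an
  orthonormal basis of \<open>H\<close> is carried to one of the range, with the same index
  set.\<close>

lemma dim_H: "dim H = r"
proof -
  obtain A where A: "finite A" "H \<subseteq> span A" using finite_dim_H by blast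
  obtain e where e: "orthonormal_basis g\<^sub>1 H {0 + 1..0 + dim H} e"
    by (rule horizontal.orthonormal_basis_exists[OF A])
  show ?thesis
    using range.orthonormal_basis_dim[OF range_basis[OF e]] rank by simp
qed

abbreviation "hbasis h \<equiv> orthonormal_basis g\<^sub>1 H {1..r} h"

lemma hbasis_orthonormal:
  assumes "hbasis h"
  shows "horizontal.orthonormal h {1..r}"
    and "i \<in> {1..r} \<Longrightarrow> h i \<in> H" and "i \<in> {1..r} \<Longrightarrow> j \<in> {1..r} \<Longrightarrow> g\<^sub>1 (h i) (h j) = (if i = j then 1 else 0)"
    and "X \<in> H \<Longrightarrow> X = (\<Sum>i=1..r. g\<^sub>1 X (h i) *\<^sub>R h i)"
proof -
  show on: "horizontal.orthonormal h {1..r}"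
    using assms by (simp add: horizontal.orthonormal_basis_iff)
  show "i \<in> {1..r} \<Longrightarrow> h i \<in> H" "i \<in> {1..r} \<Longrightarrow> j \<in> {1..r} \<Longrightarrow> g\<^sub>1 (h i) (h j) = (if i = j then 1 else 0)"
    using horizontal.orthonormalD[OF on] by auto
  show "X \<in> H \<Longrightarrow> X = (\<Sum>i=1..r. g\<^sub>1 X (h i) *\<^sub>R h i)"
    using assms by (intro horizontal.orthonormal_span[OF on]) (auto simp: orthonormal_basis_def)
qed

lemma B_expand:
  assumes "hbasis h" "X \<in> H" "Y \<in> H"
  shows "B X Y = (\<Sum>i=1..r. \<Sum>j=1..r. (g\<^sub>1 X (h i) * g\<^sub>1 Y (h j)) *\<^sub>R B (h i) (h j))"
proof -
  have l: "linear (\<lambda>X. B X Y)" and s: "linear (\<lambda>Y. B X Y)" for X Y using B_bilinear by (auto simp: bilinear_def)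
  have "B X Y = B (\<Sum>i=1..r. g\<^sub>1 X (h i) *\<^sub>R h i) (\<Sum>j=1..r. g\<^sub>1 Y (h j) *\<^sub>R h j)"
    using hbasis_orthonormal(4)[OF assms(1)] assms(2,3) by simp
  also have "\<dots> = (\<Sum>i=1..r. g\<^sub>1 X (h i) *\<^sub>R B (h i) (\<Sum>j=1..r. g\<^sub>1 Y (h j) *\<^sub>R h j))"
    by (simp only: linear_sum[OF l] linear_scale[OF l])
  also have "\<dots> = (\<Sum>i=1..r. \<Sum>j=1..r. (g\<^sub>1 X (h i) * g\<^sub>1 Y (h j)) *\<^sub>R B (h i) (h j))"
    by (simp only: linear_sum[OF s] linear_scale[OF s] scaleR_sum_right scaleR_scaleR)
  finally show ?thesis .
qed

lemma hbasis_exists: obtains h where "hbasis h"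
proof -
  obtain A where A: "finite A" "H \<subseteq> span A" using finite_dim_H by blast
  show thesis
    using horizontal.orthonormal_basis_exists[OF A, of 0] that by (auto simp: dim_H)
qed

text \<open>In rank 0 the horizontal space is trivial. The bound guarantees that \<open>h 1\<close>
  really is a member of the basis.\<close>

lemma unit_rank:
  assumes "X \<in> H" "g\<^sub>1 X X = 1"
  shows "r \<ge> 1"
proof (rule ccontr)
  assume "\<not> r \<ge> 1"
  obtain h where "hbasis h" by (rule hbasis_exists)
  then have "X = (\<Sum>i=1..r. g\<^sub>1 X (h i) *\<^sub>R h i)" using assms(1) by (rule hbasis_orthonormal(4))
  then have "X = 0" using \<open>\<not> r \<ge> 1\<close> by simp
  then show False using assms horizontal.zero_left by simp
qed

section \<open>The Ricci inequality and its defect\<close>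

definition trace :: "(nat \<Rightarrow> 'v) \<Rightarrow> 'w" where
  "trace h = (\<Sum>i=1..r. B (h i) (h i))"

definition ric\<^sub>1 :: "(nat \<Rightarrow> 'v) \<Rightarrow> real" where
  "ric\<^sub>1 h = (\<Sum>i=1..r. g\<^sub>1 (R\<^sub>1 (h i) (h 1) (h 1)) (h i))"

definition bound :: "(nat \<Rightarrow> 'v) \<Rightarrow> real" where
  "bound h = (\<Sum>i=1..r. g\<^sub>2 (R\<^sub>2 (L (h i)) (L (h 1)) (L (h 1))) (L (h i))) + 1 / 4 * g\<^sub>2 (trace h) (trace h)"

lemma range_zeroI:
  assumes h: "hbasis h" and W: "W \<in> L ` T\<^sub>1" and "\<And>i. i \<in> {1..r} \<Longrightarrow> g\<^sub>2 W (L (h i)) = 0"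
  shows "W = 0"
proof -
  have b: "orthonormal_basis g\<^sub>2 (L ` T\<^sub>1) {1..r} (L \<circ> h)" by (rule range_basis[OF h])
  then have "range.orthonormal (L \<circ> h) {1..r}" "W \<in> span ((L \<circ> h) ` {1..r})"
    using W by (auto simp: range.orthonormal_basis_iff)
  then have "W = (\<Sum>i=1..r. g\<^sub>2 W ((L \<circ> h) i) *\<^sub>R (L \<circ> h) i)" by (rule range.orthonormal_span)
  then show ?thesis using assms(3) by simp
qed

text \<open>The vectors \<open>a i\<close> are the vertical parts of the covariant derivatives \<open>\<nabla>\<^bsub>h i\<^esub> h 1\<close>.\<close>

lemma ricci_defect:
  assumes h: "hbasis h" and r: "r \<ge> 1"
  obtains a where "\<And>i. i \<in> {1..r} \<Longrightarrow> a i \<in> K"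
    and "\<And>i V. i \<in> {1..r} \<Longrightarrow> V \<in> K \<Longrightarrow> g\<^sub>1 (a i) V = g\<^sub>2 (B (h i) V) (L (h 1))"
    and "bound h - ric\<^sub>1 h =
      g\<^sub>2 (B (h 1) (h 1) - (1 / 2) *\<^sub>R trace h) (B (h 1) (h 1) - (1 / 2) *\<^sub>R trace h)
      + (\<Sum>i=2..r. g\<^sub>2 (B (h i) (h 1)) (B (h i) (h 1))) + 3 * (\<Sum>i=1..r. g\<^sub>1 (a i) (a i))"
proof -
  note hH = hbasis_orthonormal(2)[OF h]
  have h1: "h 1 \<in> H" using hH r by simp
  have BT: "B (h i) (h j) \<in> T\<^sub>2" if "i \<in> {1..r}" "j \<in> {1..r}" for i j
    using hH[OF that(1)] hH[OF that(2)] by (intro B_maps H_T)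
  have "\<forall>i\<in>{1..r}. \<exists>a. a \<in> K \<and> (\<forall>V\<in>K. g\<^sub>1 a V = g\<^sub>2 (B (h i) V) (L (h 1))) \<and>
      g\<^sub>1 (R\<^sub>1 (h i) (h 1) (h 1)) (h i) = g\<^sub>2 (R\<^sub>2 (L (h i)) (L (h 1)) (L (h 1))) (L (h i))
        + g\<^sub>2 (B (h i) (h i)) (B (h 1) (h 1)) - g\<^sub>2 (B (h i) (h 1)) (B (h i) (h 1)) - 3 * g\<^sub>1 a a"
    using gauss[OF hH h1] by blast
  from bchoice[OF this] obtain a where a: "\<forall>i\<in>{1..r}. a i \<in> K \<and>
      (\<forall>V\<in>K. g\<^sub>1 (a i) V = g\<^sub>2 (B (h i) V) (L (h 1))) \<and>
      g\<^sub>1 (R\<^sub>1 (h i) (h 1) (h 1)) (h i) = g\<^sub>2 (R\<^sub>2 (L (h i)) (L (h 1)) (L (h 1))) (L (h i))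
        + g\<^sub>2 (B (h i) (h i)) (B (h 1) (h 1)) - g\<^sub>2 (B (h i) (h 1)) (B (h i) (h 1)) - 3 * g\<^sub>1 (a i) (a i)" ..
  have T: "trace h \<in> T\<^sub>2" unfolding trace_def by (intro second.closed_sum BT)
  have one: "1 \<in> {1..r}" using r by simp
  have "ric\<^sub>1 h = (\<Sum>i=1..r. g\<^sub>2 (R\<^sub>2 (L (h i)) (L (h 1)) (L (h 1))) (L (h i)))
      + (\<Sum>i=1..r. g\<^sub>2 (B (h i) (h i)) (B (h 1) (h 1)))
      - (\<Sum>i=1..r. g\<^sub>2 (B (h i) (h 1)) (B (h i) (h 1))) - 3 * (\<Sum>i=1..r. g\<^sub>1 (a i) (a i))"
    unfolding ric\<^sub>1_def sum_distrib_left sum.distrib[symmetric] sum_subtractf[symmetric]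
    using a by (intro sum.cong) blast+
  moreover have "(\<Sum>i=1..r. g\<^sub>2 (B (h i) (h i)) (B (h 1) (h 1))) = g\<^sub>2 (trace h) (B (h 1) (h 1))"
    unfolding trace_def by (rule second.sum_left[symmetric]) (intro BT one; assumption)+
  \<comment> \<open>The term for index 1 is split off because it is absorbed by the square completed
    next.\<close>
  moreover have "(\<Sum>i=1..r. g\<^sub>2 (B (h i) (h 1)) (B (h i) (h 1))) =
      g\<^sub>2 (B (h 1) (h 1)) (B (h 1) (h 1)) + (\<Sum>i=2..r. g\<^sub>2 (B (h i) (h 1)) (B (h i) (h 1)))"
    using r by (subst sum.atLeast_Suc_atMost) (auto simp: numeral_2_eq_2)
  \<comment> \<open>This completed square is the origin of the constant 1/4 in
    \<open>bound\<close>.\<close>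
  moreover have "g\<^sub>2 (B (h 1) (h 1) - (1 / 2) *\<^sub>R trace h) (B (h 1) (h 1) - (1 / 2) *\<^sub>R trace h)
      = g\<^sub>2 (B (h 1) (h 1)) (B (h 1) (h 1)) - g\<^sub>2 (trace h) (B (h 1) (h 1)) + 1 / 4 * g\<^sub>2 (trace h) (trace h)"
    using T BT[OF one one] second.sym[OF T BT[OF one one]]
    by (simp add: second.diff_left second.diff_right second.scale_left second.scale_right second.closed)
      (simp add: field_simps)
  ultimately have "bound h - ric\<^sub>1 h =
      g\<^sub>2 (B (h 1) (h 1) - (1 / 2) *\<^sub>R trace h) (B (h 1) (h 1) - (1 / 2) *\<^sub>R trace h)
      + (\<Sum>i=2..r. g\<^sub>2 (B (h i) (h 1)) (B (h i) (h 1))) + 3 * (\<Sum>i=1..r. g\<^sub>1 (a i) (a i))"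
    unfolding bound_def by linarith
  then show thesis using a by (intro that) auto
qed

text \<open>The defect is a sum of nonnegative terms, so it vanishes only if each of them does. The
  rest of the proof turns the conditions on the other basis vectors and on the vectors
  \<open>a i\<close> into conditions on all horizontal and vertical vectors.\<close>

lemma ricci_inequality_and_equality:
  assumes h: "hbasis h" and r: "r \<ge> 1"
  shows "ric\<^sub>1 h \<le> bound h"
    and "ric\<^sub>1 h = bound h \<longleftrightarrow>
      (\<forall>Y\<in>H. g\<^sub>1 (h 1) Y = 0 \<longrightarrow> B (h 1) Y = 0) \<and>
      B (h 1) (h 1) = (1 / 2) *\<^sub>R trace h \<and> (\<forall>V\<in>K. B (h 1) V = 0)"
proof -
  obtain a where aK: "\<And>i. i \<in> {1..r} \<Longrightarrow> a i \<in> K"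
    and aV: "\<And>i V. i \<in> {1..r} \<Longrightarrow> V \<in> K \<Longrightarrow> g\<^sub>1 (a i) V = g\<^sub>2 (B (h i) V) (L (h 1))"
    and defect: "bound h - ric\<^sub>1 h =
      g\<^sub>2 (B (h 1) (h 1) - (1 / 2) *\<^sub>R trace h) (B (h 1) (h 1) - (1 / 2) *\<^sub>R trace h)
      + (\<Sum>i=2..r. g\<^sub>2 (B (h i) (h 1)) (B (h i) (h 1))) + 3 * (\<Sum>i=1..r. g\<^sub>1 (a i) (a i))"
    using ricci_defect[OF h r] by blast
  note hH = hbasis_orthonormal(2)[OF h]
  have one: "1 \<in> {1..r}" using r by simp
  have BT: "B (h i) (h j) \<in> T\<^sub>2" if "i \<in> {1..r}" "j \<in> {1..r}" for i j
    using hH[OF that(1)] hH[OF that(2)] by (intro B_maps H_T)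
  have "trace h \<in> T\<^sub>2" unfolding trace_def by (intro second.closed_sum BT)
  then have d: "B (h 1) (h 1) - (1 / 2) *\<^sub>R trace h \<in> T\<^sub>2" using BT[OF one one] by (intro second.closed)
  have n1: "g\<^sub>2 (B (h 1) (h 1) - (1 / 2) *\<^sub>R trace h) (B (h 1) (h 1) - (1 / 2) *\<^sub>R trace h) \<ge> 0"
    using d by (rule second.nonneg)
  have n2: "g\<^sub>2 (B (h i) (h 1)) (B (h i) (h 1)) \<ge> 0" if "i \<in> {2..r}" for i
    using BT[OF _ one, of i] that by (intro second.nonneg) auto
  have n3: "g\<^sub>1 (a i) (a i) \<ge> 0" if "i \<in> {1..r}" for i
    using aK[OF that] by (rule vertical.nonneg)
  have n2': "(\<Sum>i=2..r. g\<^sub>2 (B (h i) (h 1)) (B (h i) (h 1))) \<ge> 0" by (rule sum_nonneg) (rule n2)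
  have n3': "(\<Sum>i=1..r. g\<^sub>1 (a i) (a i)) \<ge> 0" by (rule sum_nonneg) (rule n3)
  show "ric\<^sub>1 h \<le> bound h" using defect n1 n2' n3' by linarith
  have "ric\<^sub>1 h = bound h \<longleftrightarrow>
      g\<^sub>2 (B (h 1) (h 1) - (1 / 2) *\<^sub>R trace h) (B (h 1) (h 1) - (1 / 2) *\<^sub>R trace h) = 0
      \<and> (\<Sum>i=2..r. g\<^sub>2 (B (h i) (h 1)) (B (h i) (h 1))) = 0 \<and> (\<Sum>i=1..r. g\<^sub>1 (a i) (a i)) = 0"
    using defect n1 n2' n3' by linarith
  also have "\<dots> \<longleftrightarrow> B (h 1) (h 1) = (1 / 2) *\<^sub>R trace h \<and> (\<forall>i\<in>{2..r}. B (h 1) (h i) = 0) \<and> (\<forall>i\<in>{1..r}. a i = 0)"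
  proof -
    have "B (h i) (h 1) \<in> T\<^sub>2" if "i \<in> {2..r}" for i using BT[OF _ one, of i] that by simp
    then have "(\<forall>i\<in>{2..r}. g\<^sub>2 (B (h i) (h 1)) (B (h i) (h 1)) = 0) \<longleftrightarrow> (\<forall>i\<in>{2..r}. B (h 1) (h i) = 0)"
      by (metis B_sym second.self_zero_iff)
    moreover have "(\<Sum>i=2..r. g\<^sub>2 (B (h i) (h 1)) (B (h i) (h 1))) = 0 \<longleftrightarrow>
        (\<forall>i\<in>{2..r}. g\<^sub>2 (B (h i) (h 1)) (B (h i) (h 1)) = 0)"
      using n2 by (intro sum_nonneg_eq_0_iff) auto
    moreover have "(\<Sum>i=1..r. g\<^sub>1 (a i) (a i)) = 0 \<longleftrightarrow> (\<forall>i\<in>{1..r}. g\<^sub>1 (a i) (a i) = 0)"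
      using n3 by (intro sum_nonneg_eq_0_iff) auto
    moreover have "(\<forall>i\<in>{1..r}. g\<^sub>1 (a i) (a i) = 0) \<longleftrightarrow> (\<forall>i\<in>{1..r}. a i = 0)"
      using aK vertical.self_zero_iff by blast
    ultimately show ?thesis
      using second.self_zero_iff[OF d] by simp
  qed
  also have "(\<forall>i\<in>{2..r}. B (h 1) (h i) = 0) \<longleftrightarrow> (\<forall>Y\<in>H. g\<^sub>1 (h 1) Y = 0 \<longrightarrow> B (h 1) Y = 0)"
  proof (intro iffI ballI impI)
    fix Y assume z: "\<forall>i\<in>{2..r}. B (h 1) (h i) = 0" and Y: "Y \<in> H" "g\<^sub>1 (h 1) Y = 0"
    have s: "linear (B (h 1))" using B_bilinear by (auto simp: bilinear_def)
    have "B (h 1) Y = B (h 1) (\<Sum>i=1..r. g\<^sub>1 Y (h i) *\<^sub>R h i)"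
      using hbasis_orthonormal(4)[OF h Y(1)] by simp
    also have "\<dots> = (\<Sum>i=1..r. g\<^sub>1 Y (h i) *\<^sub>R B (h 1) (h i))"
      by (simp only: linear_sum[OF s] linear_scale[OF s])
    also have "\<dots> = 0"
    proof (rule sum.neutral, rule ballI)
      fix i assume i: "i \<in> {1..r}"
      show "g\<^sub>1 Y (h i) *\<^sub>R B (h 1) (h i) = 0"
        using z Y horizontal.sym[OF Y(1) hH[OF one]] i by (cases "i = 1") auto
    qed
    finally show "B (h 1) Y = 0" .
  next
    fix i assume z: "\<forall>Y\<in>H. g\<^sub>1 (h 1) Y = 0 \<longrightarrow> B (h 1) Y = 0" and i: "i \<in> {2..r}"
    then show "B (h 1) (h i) = 0"
      using hH[of i] hbasis_orthonormal(3)[OF h one, of i] by auto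
  qed
  \<comment> \<open>By \<open>B_vertical\<close> the vector \<open>B (h 1) V\<close> lies in the
    range, so it is tested on the vectors \<open>L (h i)\<close>; by \<open>B_mixed_antisym\<close>
    these pairings are those of \<open>a i\<close> with \<open>V\<close> up to sign. Conversely,
    \<open>V\<close> is taken to be \<open>a i\<close> itself.\<close>
  also have "(\<forall>i\<in>{1..r}. a i = 0) \<longleftrightarrow> (\<forall>V\<in>K. B (h 1) V = 0)"
  proof (intro iffI ballI)
    fix V assume z: "\<forall>i\<in>{1..r}. a i = 0" and V: "V \<in> K"
    show "B (h 1) V = 0"
    proof (rule range_zeroI[OF h])
      show "B (h 1) V \<in> L ` T\<^sub>1" using hH[OF one] V by (intro B_vertical H_T)
      fix i assume i: "i \<in> {1..r}"
      show "g\<^sub>2 (B (h 1) V) (L (h i)) = 0"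
        using B_mixed_antisym[OF hH[OF one] hH[OF i] V] aV[OF i V] z i V by (simp add: vertical.zero_left)
    qed
  next
    fix i assume z: "\<forall>V\<in>K. B (h 1) V = 0" and i: "i \<in> {1..r}"
    have "g\<^sub>1 (a i) (a i) = - g\<^sub>2 (B (h 1) (a i)) (L (h i))"
      using aV[OF i aK[OF i]] B_mixed_antisym[OF hH[OF one] hH[OF i] aK[OF i]] by simp
    also have "\<dots> = 0" using z aK[OF i] L_maps[OF H_T[OF hH[OF i]]] by (simp add: second.zero_left)
    finally show "a i = 0" using aK[OF i] by (simp add: vertical.self_zero_iff)
  qed
  finally show "ric\<^sub>1 h = bound h \<longleftrightarrow>
      (\<forall>Y\<in>H. g\<^sub>1 (h 1) Y = 0 \<longrightarrow> B (h 1) Y = 0) \<and>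
      B (h 1) (h 1) = (1 / 2) *\<^sub>R trace h \<and> (\<forall>V\<in>K. B (h 1) V = 0)" by blast
qed

section \<open>Equality at every unit horizontal vector\<close>

definition always_equal :: bool where
  "always_equal \<longleftrightarrow> (\<forall>X\<in>H. g\<^sub>1 X X = 1 \<longrightarrow> (\<forall>h. hbasis h \<longrightarrow> h 1 = X \<longrightarrow> ric\<^sub>1 h = bound h))"

lemma always_equal_hbasis:
  assumes "always_equal" "hbasis h" "r \<ge> 1"
  shows "ric\<^sub>1 h = bound h"
  using assms hbasis_orthonormal(2,3)[OF assms(2), of 1] by (auto simp: always_equal_def)

text \<open>The equality condition singles out the first basis vector. Swapping it with the
  \<open>j\<close>-th makes the condition available at \<open>h j\<close>, with the same
  trace.\<close>

lemma hbasis_permute: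
  assumes h: "hbasis h" and j: "j \<in> {1..r}"
  shows "hbasis (h \<circ> Transposition.transpose 1 j)" and "trace (h \<circ> Transposition.transpose 1 j) = trace h"
proof -
  have p: "Transposition.transpose 1 j permutes {1..r}" using j by (intro permutes_swap_id) auto
  have im: "(h \<circ> Transposition.transpose 1 j) ` {1..r} = h ` {1..r}"
    by (simp only: image_comp[symmetric] permutes_image[OF p])
  have "g\<^sub>1 (h (Transposition.transpose 1 j i)) (h (Transposition.transpose 1 j k)) = (if i = k then 1 else 0)"
    if "i \<in> {1..r}" "k \<in> {1..r}" for i k
    using hbasis_orthonormal(3)[OF h, of "Transposition.transpose 1 j i" "Transposition.transpose 1 j k"] that
      permutes_in_image[OF p] permutes_inj[OF p] by (auto simp: inj_eq)
  then show "hbasis (h \<circ> Transposition.transpose 1 j)"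
    using h im by (simp add: orthonormal_basis_def)
  show "trace (h \<circ> Transposition.transpose 1 j) = trace h"
    unfolding trace_def using sum.permute[OF p, of "\<lambda>i. B (h i) (h i)"] by (simp add: o_def)
qed

lemma always_equal_basis:
  assumes E: always_equal and h: "hbasis h" and i: "i \<in> {1..r}"
  shows "B (h i) (h i) = (1 / 2) *\<^sub>R trace h"
    and "j \<in> {1..r} \<Longrightarrow> j \<noteq> i \<Longrightarrow> B (h i) (h j) = 0"
    and "V \<in> K \<Longrightarrow> B (h i) V = 0"
proof -
  let ?h = "h \<circ> Transposition.transpose 1 i"
  have r: "r \<ge> 1" using i by simp
  note h' = hbasis_permute[OF h i]
  have 1: "?h 1 = h i" by simp
  have eq: "(\<forall>Y\<in>H. g\<^sub>1 (h i) Y = 0 \<longrightarrow> B (h i) Y = 0) \<and>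
      B (h i) (h i) = (1 / 2) *\<^sub>R trace h \<and> (\<forall>V\<in>K. B (h i) V = 0)"
    using ricci_inequality_and_equality(2)[OF h'(1) r, unfolded 1 h'(2)]
      always_equal_hbasis[OF E h'(1) r] by blast
  then show "B (h i) (h i) = (1 / 2) *\<^sub>R trace h" "V \<in> K \<Longrightarrow> B (h i) V = 0" by auto
  show "B (h i) (h j) = 0" if "j \<in> {1..r}" "j \<noteq> i"
    using eq hbasis_orthonormal(2,3)[OF h] i that by auto
qed

lemma always_equal_mixed:
  assumes E: always_equal and X: "X \<in> H" and V: "V \<in> K"
  shows "B X V = 0"
proof -
  obtain h where h: "hbasis h" by (rule hbasis_exists)
  have s: "linear (\<lambda>X. B X V)" using B_bilinear by (auto simp: bilinear_def)
  have "B X V = B (\<Sum>i=1..r. g\<^sub>1 X (h i) *\<^sub>R h i) V"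
    using hbasis_orthonormal(4)[OF h X] by simp
  also have "\<dots> = (\<Sum>i=1..r. g\<^sub>1 X (h i) *\<^sub>R B (h i) V)"
    by (simp only: linear_sum[OF s] linear_scale[OF s])
  also have "\<dots> = 0" using always_equal_basis(3)[OF E h _ V] by simp
  finally show ?thesis .
qed

text \<open>Each diagonal entry is half the trace, so summing shows that the trace is
  \<open>real r / 2\<close> times itself. For \<open>r\<close> other than 2 the trace is therefore
  zero, and the diagonal vanishes with it.\<close>

lemma always_equal_vanishing:
  assumes E: always_equal and r: "r \<noteq> 2" and XY: "X \<in> H" "Y \<in> H"
  shows "B X Y = 0"
proof -
  obtain h where h: "hbasis h" by (rule hbasis_exists)
  have "trace h = (\<Sum>i=1..r. (1 / 2) *\<^sub>R trace h)"
    using always_equal_basis(1)[OF E h] unfolding trace_def[of h] by (intro sum.cong) auto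
  then have "trace h = (real r / 2) *\<^sub>R trace h"
    by (simp only: sum_constant_scaleR) simp
  then have "(1 - real r / 2) *\<^sub>R trace h = 0" by (simp add: scaleR_left_diff_distrib)
  then have T: "trace h = 0" using r by auto
  have "B (h i) (h j) = 0" if "i \<in> {1..r}" "j \<in> {1..r}" for i j
    using always_equal_basis(1,2)[OF E h] that T by (cases "i = j") auto
  then show ?thesis by (simp add: B_expand[OF h XY])
qed

lemma always_equalI_vanishing:
  assumes "\<And>X Y. X \<in> H \<Longrightarrow> Y \<in> H \<Longrightarrow> B X Y = 0" and "\<And>X V. X \<in> H \<Longrightarrow> V \<in> K \<Longrightarrow> B X V = 0"
  shows always_equal
  unfolding always_equal_def
proof (intro ballI allI impI)
  fix X h assume X: "X \<in> H" "g\<^sub>1 X X = 1" "hbasis h" "h 1 = X"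
  have "trace h = 0" unfolding trace_def
    using assms(1) hbasis_orthonormal(2)[OF X(3)] by (intro sum.neutral) auto
  then show "ric\<^sub>1 h = bound h"
    using ricci_inequality_and_equality(2)[OF X(3) unit_rank[OF X(1,2)]] assms X by auto
qed

section \<open>The case of rank two\<close>

definition balanced :: bool where
  "balanced \<longleftrightarrow> (\<forall>h. hbasis h \<longrightarrow> B (h 1) (h 1) = B (h 2) (h 2))"

lemma balancedD: "balanced \<Longrightarrow> hbasis h \<Longrightarrow> B (h 1) (h 1) = B (h 2) (h 2)"
  unfolding balanced_def by blast

lemma always_equal_balanced:
  assumes E: always_equal and r: "r = 2"
  shows balanced
  unfolding balanced_def
proof (intro allI impI)
  fix h assume h: "hbasis h"
  show "B (h 1) (h 1) = B (h 2) (h 2)"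
    using always_equal_basis(1)[OF E h, of 1] always_equal_basis(1)[OF E h, of 2] r by simp
qed

text \<open>Rotating the basis by 45 degrees turns balance of the diagonal entries into the vanishing of
  the off-diagonal one.\<close>

lemma balanced_off_diagonal:
  assumes bal: balanced and r: "r = 2" and h: "hbasis h"
  shows "B (h 1) (h 2) = 0"
proof -
  define s where "s = 1 / sqrt 2"
  have s: "s * s = 1 / 2" by (simp add: s_def)
  define p q where "p = h 1 + h 2" and "q = h 1 - h 2"
  define h' where "h' i = s *\<^sub>R (if i = (1::nat) then p else q)" for i
  have h': "h' 1 = s *\<^sub>R p" "h' 2 = s *\<^sub>R q" by (simp_all add: h'_def)
  have I: "{1..r} = {1, 2}" using r by auto
  have hH: "h 1 \<in> H" "h 2 \<in> H" using hbasis_orthonormal(2)[OF h] I by auto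
  have g: "g\<^sub>1 (h 1) (h 1) = 1" "g\<^sub>1 (h 2) (h 2) = 1" "g\<^sub>1 (h 1) (h 2) = 0" "g\<^sub>1 (h 2) (h 1) = 0"
    using hbasis_orthonormal(3)[OF h] I by auto
  have pq: "p \<in> H" "q \<in> H" using hH by (auto simp: p_def q_def intro: horizontal.closed)
  have gpq: "g\<^sub>1 p p = 2" "g\<^sub>1 q q = 2" "g\<^sub>1 p q = 0" "g\<^sub>1 q p = 0"
    using hH by (simp_all add: p_def q_def horizontal.closed horizontal.add_left horizontal.add_right
        horizontal.diff_left horizontal.diff_right g)
  have "h 1 = s *\<^sub>R h' 1 + s *\<^sub>R h' 2" "h 2 = s *\<^sub>R h' 1 - s *\<^sub>R h' 2"
    by (simp_all add: h' p_def q_def s flip: scaleR_add_right scaleR_diff_right scaleR_2)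
  then have "h 1 \<in> span {h' 1, h' 2}" "h 2 \<in> span {h' 1, h' 2}"
    by (metis insertI1 insertI2 span_add span_base span_diff span_scale)+
  then have "span {h 1, h 2} \<subseteq> span {h' 1, h' 2}" by (intro span_minimal) auto
  moreover have "H \<subseteq> span {h 1, h 2}" using h I by (simp add: orthonormal_basis_def)
  ultimately have "H \<subseteq> span {h' 1, h' 2}" by blast
  moreover have "h' 1 \<in> H" "h' 2 \<in> H" using pq by (auto simp: h' intro: horizontal.closed)
  moreover have "g\<^sub>1 (h' 1) (h' 1) = 1" "g\<^sub>1 (h' 2) (h' 2) = 1" "g\<^sub>1 (h' 1) (h' 2) = 0" "g\<^sub>1 (h' 2) (h' 1) = 0"
    using pq s by (simp_all add: h' horizontal.scale_left horizontal.scale_right horizontal.closed gpq)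
  ultimately have "hbasis h'" by (simp add: orthonormal_basis_def I)
  then have "B (h' 1) (h' 1) = B (h' 2) (h' 2)" using bal by (rule balancedD[rotated])
  then have "B p p = B q q" by (simp add: h' B_simps s)
  moreover have "B p p = B (h 1) (h 1) + B (h 1) (h 2) + B (h 1) (h 2) + B (h 2) (h 2)"
    using B_sym[of "h 2" "h 1"] by (simp add: p_def B_simps)
  moreover have "B q q = B (h 1) (h 1) - B (h 1) (h 2) - B (h 1) (h 2) + B (h 2) (h 2)"
    using B_sym[of "h 2" "h 1"] by (simp add: q_def B_simps)
  ultimately have "B (h 1) (h 2) + B (h 1) (h 2) + B (h 1) (h 2) + B (h 1) (h 2) = 0"
    by (simp add: algebra_simps)
  then have "(1 + 1 + 1 + 1 :: real) *\<^sub>R B (h 1) (h 2) = 0"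
    by (simp only: scaleR_left_distrib scaleR_one)
  then show ?thesis by simp
qed

lemma balanced_umbilical:
  assumes bal: balanced and r: "r = 2" and h: "hbasis h" and XY: "X \<in> H" "Y \<in> H"
  shows "B X Y = g\<^sub>1 X Y *\<^sub>R B (h 1) (h 1)"
proof -
  have I: "{1..r} = {1, 2}" using r by auto
  have hH: "h 1 \<in> H" "h 2 \<in> H" using hbasis_orthonormal(2)[OF h] I by auto
  have "g\<^sub>1 X Y = g\<^sub>1 (\<Sum>i=1..r. g\<^sub>1 X (h i) *\<^sub>R h i) Y"
    using hbasis_orthonormal(4)[OF h XY(1)] by simp
  also have "\<dots> = g\<^sub>1 X (h 1) * g\<^sub>1 Y (h 1) + g\<^sub>1 X (h 2) * g\<^sub>1 Y (h 2)"
    using hH XY horizontal.sym[OF hH(1) XY(2)] horizontal.sym[OF hH(2) XY(2)]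
    by (simp add: I horizontal.add_left horizontal.scale_left horizontal.closed)
  finally show ?thesis
    using balanced_off_diagonal[OF bal r h] balancedD[OF bal h] B_sym[of "h 2" "h 1"]
    by (simp add: B_expand[OF h XY] I flip: scaleR_left_distrib)
qed

text \<open>In rank 2 equal diagonal entries are each half of the trace, which is what equality asks
  of \<open>B (h 1) (h 1)\<close>; orthogonal vectors are handled by
  \<open>balanced_umbilical\<close>.\<close>

lemma always_equalI_balanced:
  assumes bal: balanced and r: "r = 2" and mixed: "\<And>X V. X \<in> H \<Longrightarrow> V \<in> K \<Longrightarrow> B X V = 0"
  shows always_equal
  unfolding always_equal_def
proof (intro ballI allI impI)
  fix X h assume X: "X \<in> H" "g\<^sub>1 X X = 1" "hbasis h" "h 1 = X"
  have "{1..r} = {1, 2}" using r by auto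
  then have "trace h = B (h 1) (h 1) + B (h 2) (h 2)" by (simp add: trace_def)
  then have T: "trace h = 2 *\<^sub>R B (h 1) (h 1)" using balancedD[OF bal X(3)] by (simp add: scaleR_2)
  have "B (h 1) Y = 0" if "Y \<in> H" "g\<^sub>1 (h 1) Y = 0" for Y
    using balanced_umbilical[OF bal r X(3), of "h 1" Y] X that by simp
  then show "ric\<^sub>1 h = bound h"
    using ricci_inequality_and_equality(2)[OF X(3)] r mixed X T by simp
qed

section \<open>Normal vectors of the range, umbilicity and components\<close>

definition perp :: "'w set" where
  "perp = {W \<in> T\<^sub>2. \<forall>Z\<in>L ` T\<^sub>1. g\<^sub>2 W Z = 0}"

lemma B_perp: "X \<in> H \<Longrightarrow> Y \<in> H \<Longrightarrow> B X Y \<in> perp"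
  using B_horizontal B_maps H_T by (auto simp: perp_def)

text \<open>The normal vector is \<open>B (h 1) (h 1)\<close> for any horizontal basis, normal by
  \<open>B_perp\<close>. Conversely, evaluation on two unit vectors gives the same \<open>W\<close>
  twice.\<close>

lemma umbilical_iff_balanced:
  assumes r: "r = 2"
  shows "(\<exists>W\<in>perp. \<forall>X\<in>H. \<forall>Y\<in>H. B X Y = g\<^sub>1 X Y *\<^sub>R W) \<longleftrightarrow> balanced"
proof
  assume bal: balanced
  obtain h where h: "hbasis h" by (rule hbasis_exists)
  have "h 1 \<in> H" using hbasis_orthonormal(2)[OF h] r by simp
  then show "\<exists>W\<in>perp. \<forall>X\<in>H. \<forall>Y\<in>H. B X Y = g\<^sub>1 X Y *\<^sub>R W"
    using balanced_umbilical[OF bal r h] B_perp by blast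
next
  assume "\<exists>W\<in>perp. \<forall>X\<in>H. \<forall>Y\<in>H. B X Y = g\<^sub>1 X Y *\<^sub>R W"
  then obtain W where W: "\<forall>X\<in>H. \<forall>Y\<in>H. B X Y = g\<^sub>1 X Y *\<^sub>R W" by blast
  show balanced unfolding balanced_def
  proof (intro allI impI)
    fix h assume h: "hbasis h"
    show "B (h 1) (h 1) = B (h 2) (h 2)"
      using W hbasis_orthonormal(2,3)[OF h] r by simp
  qed
qed

text \<open>The image of a horizontal basis is an orthonormal basis of the range; it is extended to
  the whole tangent space of the target, and the vectors with index above \<open>r\<close> form a
  basis of the normal space. Without such a basis the condition on components would hold
  vacuously.\<close>

lemma perp_basis_exists: obtains V where "orthonormal_basis g\<^sub>2 perp {r + 1..n} V"
proof -
  obtain h where h: "hbasis h" by (rule hbasis_exists)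
  obtain A where A: "finite A" "T\<^sub>2 \<subseteq> span A" using finite_dim_second by blast
  have b: "orthonormal_basis g\<^sub>2 (L ` T\<^sub>1) {1..r} (L \<circ> h)" by (rule range_basis[OF h])
  then have "second.orthonormal (L \<circ> h) {0 + 1..0 + r}"
    using L_maps by (auto simp: orthonormal_basis_def second.orthonormal_def)
  from second.orthonormal_extend[OF A this] obtain e
    where e: "\<forall>i\<in>{1..r}. e i = L (h i)" "orthonormal_basis g\<^sub>2 T\<^sub>2 {1..n} e"
    by (auto simp: dim_second)
  then have on: "second.orthonormal e {1..n}" and sp: "T\<^sub>2 \<subseteq> span (e ` {1..n})"
    by (auto simp: second.orthonormal_basis_iff)
  have rT: "L ` T\<^sub>1 \<subseteq> span (e ` {1..r})"
  proof -
    have "(L \<circ> h) ` {1..r} = e ` {1..r}" using e(1) by (intro image_cong) auto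
    then show ?thesis using b by (simp add: orthonormal_basis_def)
  qed
  have Lh: "range.orthonormal (L \<circ> h) {1..r}" using b by (simp add: range.orthonormal_basis_iff)
  have "r \<le> n"
  proof -
    have "(L \<circ> h) ` {1..r} \<subseteq> T\<^sub>2"
      using L_maps[OF H_T[OF hbasis_orthonormal(2)[OF h]]] by auto
    then have "(L \<circ> h) ` {1..r} \<subseteq> span (e ` {1..n})" using sp by (rule subset_trans)
    from independent_span_bound[OF _ range.orthonormal_independent[OF Lh] this]
    have "card ((L \<circ> h) ` {1..r}) \<le> card (e ` {1..n})" by simp
    then show ?thesis
      using range.orthonormal_inj_on[OF Lh] second.orthonormal_inj_on[OF on]
      by (simp only: card_image card_atLeastAtMost diff_Suc_1)
  qed
  have "e i \<in> perp" if "i \<in> {r + 1..n}" for i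
    unfolding perp_def
  proof (intro CollectI conjI ballI)
    show ei: "e i \<in> T\<^sub>2" using second.orthonormalD(2)[OF on] that by simp
    fix Z assume Z: "Z \<in> L ` T\<^sub>1"
    have or: "second.orthonormal e {1..r}"
      using on \<open>r \<le> n\<close> by (auto simp: second.orthonormal_def)
    have Zeq: "Z = (\<Sum>j=1..r. g\<^sub>2 Z (e j) *\<^sub>R e j)"
      by (rule second.orthonormal_span[OF or subsetD[OF rT Z]])
    have "g\<^sub>2 (e i) (\<Sum>j=1..r. g\<^sub>2 Z (e j) *\<^sub>R e j) = 0"
      using second.orthonormalD[OF on] ei that \<open>r \<le> n\<close>
      by (subst second.sum_right) (auto intro: second.closed simp: second.scale_right)
    then show "g\<^sub>2 (e i) Z = 0" by (subst Zeq)
  qed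
  moreover have "perp \<subseteq> span (e ` {r + 1..n})"
  proof
    fix W assume W: "W \<in> perp"
    then have "W \<in> span (e ` {1..n})" using sp by (auto simp: perp_def)
    then have all: "W = (\<Sum>i=1..n. g\<^sub>2 W (e i) *\<^sub>R e i)"
      by (rule second.orthonormal_span[OF on])
    have "(\<Sum>i=1..n. g\<^sub>2 W (e i) *\<^sub>R e i) = (\<Sum>i=r+1..n. g\<^sub>2 W (e i) *\<^sub>R e i)"
    proof (rule sum.mono_neutral_right)
      show "\<forall>i\<in>{1..n} - {r + 1..n}. g\<^sub>2 W (e i) *\<^sub>R e i = 0"
      proof
        fix i assume "i \<in> {1..n} - {r + 1..n}"
        then have i: "i \<in> {1..r}" by auto
        then show "g\<^sub>2 W (e i) *\<^sub>R e i = 0"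
          using W e(1) H_T[OF hbasis_orthonormal(2)[OF h i]] i by (simp add: perp_def)
      qed
    qed auto
    with all have eq: "W = (\<Sum>i=r+1..n. g\<^sub>2 W (e i) *\<^sub>R e i)" by (rule trans)
    have "(\<Sum>i=r+1..n. g\<^sub>2 W (e i) *\<^sub>R e i) \<in> span (e ` {r + 1..n})"
      by (intro span_sum span_scale span_base) auto
    then show "W \<in> span (e ` {r + 1..n})" by (subst eq)
  qed
  moreover have "g\<^sub>2 (e i) (e j) = (if i = j then 1 else 0)" if "i \<in> {r + 1..n}" "j \<in> {r + 1..n}" for i j
    using second.orthonormalD(3)[OF on, of i j] that by simp
  ultimately have "orthonormal_basis g\<^sub>2 perp {r + 1..n} e"
    unfolding orthonormal_basis_def by blast
  then show thesis by (rule that)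
qed

text \<open>The values of \<open>B\<close> on horizontal vectors are normal, so they are determined
  by their components in a single normal basis. For \<open>r = 2\<close> the index sets
  \<open>{3..n}\<close> and \<open>{r + 1..n}\<close> coincide.\<close>

lemma components_iff_balanced:
  assumes r: "r = 2"
  shows "(\<forall>h V. \<forall>\<alpha>\<in>{3..n}. hbasis h \<longrightarrow> orthonormal_basis g\<^sub>2 perp {r + 1..n} V \<longrightarrow>
      g\<^sub>2 (B (h 1) (h 1)) (V \<alpha>) = g\<^sub>2 (B (h 2) (h 2)) (V \<alpha>)) \<longleftrightarrow> balanced"
proof
  assume *: "\<forall>h V. \<forall>\<alpha>\<in>{3..n}. hbasis h \<longrightarrow> orthonormal_basis g\<^sub>2 perp {r + 1..n} V \<longrightarrow>
      g\<^sub>2 (B (h 1) (h 1)) (V \<alpha>) = g\<^sub>2 (B (h 2) (h 2)) (V \<alpha>)"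
  obtain V where V: "orthonormal_basis g\<^sub>2 perp {r + 1..n} V" by (rule perp_basis_exists)
  have perpT: "perp \<subseteq> T\<^sub>2" by (auto simp: perp_def)
  have Von: "second.orthonormal V {r + 1..n}" and sp: "perp \<subseteq> span (V ` {r + 1..n})"
    using V perpT by (auto simp: orthonormal_basis_def second.orthonormal_def)
  show balanced unfolding balanced_def
  proof (intro allI impI)
    fix h assume h: "hbasis h"
    have hH: "h 1 \<in> H" "h 2 \<in> H" using hbasis_orthonormal(2)[OF h] r by auto
    note Bp = B_perp[OF hH(1) hH(1)] B_perp[OF hH(2) hH(2)]
    have "B (h 1) (h 1) = (\<Sum>i=r+1..n. g\<^sub>2 (B (h 1) (h 1)) (V i) *\<^sub>R V i)"
      by (rule second.orthonormal_span[OF Von subsetD[OF sp Bp(1)]])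
    also have "\<dots> = (\<Sum>i=r+1..n. g\<^sub>2 (B (h 2) (h 2)) (V i) *\<^sub>R V i)"
    proof (rule sum.cong)
      fix i assume "i \<in> {r + 1..n}"
      then have i: "i \<in> {3..n}" using r by simp
      have "g\<^sub>2 (B (h 1) (h 1)) (V i) = g\<^sub>2 (B (h 2) (h 2)) (V i)"
        by (rule *[rule_format, OF i h V])
      then show "g\<^sub>2 (B (h 1) (h 1)) (V i) *\<^sub>R V i = g\<^sub>2 (B (h 2) (h 2)) (V i) *\<^sub>R V i" by (simp only:)
    qed simp
    also have "\<dots> = B (h 2) (h 2)"
      by (rule second.orthonormal_span[OF Von subsetD[OF sp Bp(2)], symmetric])
    finally show "B (h 1) (h 1) = B (h 2) (h 2)" .
  qed
next
  assume balanced
  then have *: "g\<^sub>2 (B (h 1) (h 1)) W = g\<^sub>2 (B (h 2) (h 2)) W" if "hbasis h" for h W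
    using arg_cong[OF balancedD[OF _ that], of "\<lambda>Z. g\<^sub>2 Z W"] by blast
  show "\<forall>h V. \<forall>\<alpha>\<in>{3..n}. hbasis h \<longrightarrow> orthonormal_basis g\<^sub>2 perp {r + 1..n} V \<longrightarrow>
      g\<^sub>2 (B (h 1) (h 1)) (V \<alpha>) = g\<^sub>2 (B (h 2) (h 2)) (V \<alpha>)"
    by (intro allI ballI impI) (rule *)
qed

text \<open>Both arguments are split into horizontal and vertical parts; symmetry identifies the two
  mixed blocks, so three blocks remain.\<close>

lemma totally_geodesic_iff:
  "(\<forall>X\<in>T\<^sub>1. \<forall>Y\<in>T\<^sub>1. B X Y = 0) \<longleftrightarrow>
    (\<forall>X\<in>H. \<forall>Y\<in>H. B X Y = 0) \<and> (\<forall>X\<in>H. \<forall>V\<in>K. B X V = 0) \<and> (\<forall>V\<in>K. \<forall>W\<in>K. B V W = 0)" (is "?L \<longleftrightarrow> ?R")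
proof
  assume ?L
  then show ?R using H_T K_T by blast
next
  assume *: ?R
  show ?L
  proof (intro ballI)
    fix X Y assume XY: "X \<in> T\<^sub>1" "Y \<in> T\<^sub>1"
    obtain X1 X2 where X: "X1 \<in> H" "X2 \<in> K" "X = X1 + X2" by (rule decomposition[OF XY(1)])
    obtain Y1 Y2 where Y: "Y1 \<in> H" "Y2 \<in> K" "Y = Y1 + Y2" by (rule decomposition[OF XY(2)])
    have "B X1 Y1 = 0" "B X1 Y2 = 0" "B Y1 X2 = 0" "B X2 Y2 = 0" using * X Y by blast+
    then show "B X Y = 0" using B_sym[of X2 Y1] by (simp add: X(3) Y(3) B_simps)
  qed
qed

end

section \<open>Coordinates of a Riemannian map\<close>

lemma coords_simps [simp]:
  "coords (Tvec v) = v" "coords 0 c = 0" "coords (X + Y) c = coords X c + coords Y c"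
  "coords (X - Y) c = coords X c - coords Y c" "coords (a *\<^sub>R X) c = a *\<^sub>R coords X c"
  by (simp_all add: Tvec_inverse zero_tvec_def plus_tvec_def minus_tvec_def scaleR_tvec_def)

lemma tvec_eqI: "(\<And>c. coords X c = coords Y c) \<Longrightarrow> X = Y"
  by (metis coords_inject ext)

text \<open>The coordinate map of \<open>d\<close> and its inverse cancel only at points that
  \<open>F\<close> sends into the domain of \<open>d\<close>. Hence the composition rule is stated
  on an open set where this happens, which is enough for derivatives.\<close>

lemma local_rep_chain:
  fixes c :: "('a, 'm::finite) chart" and d :: "('b, 'n::finite) chart" and e :: "('c, 'k::finite) chart"
  assumes S: "open S" "x \<in> S" and F: "\<And>y. y \<in> S \<Longrightarrow> F (chart_inv c y) \<in> fst d"
    and d: "inj_on (snd d) (fst d)"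
    and diff: "local_rep F c d differentiable (at x)"
      "local_rep G d e differentiable (at (local_rep F c d x))"
  shows "local_rep (\<lambda>q. G (F q)) c e differentiable (at x)"
    and "frechet_derivative (local_rep (\<lambda>q. G (F q)) c e) (at x) u =
    frechet_derivative (local_rep G d e) (at (local_rep F c d x)) (frechet_derivative (local_rep F c d) (at x) u)"
proof -
  have eq: "(local_rep G d e \<circ> local_rep F c d) y = local_rep (\<lambda>q. G (F q)) c e y" if "y \<in> S" for y
    using inv_into_f_f[OF d F[OF that]] by (simp add: local_rep_def chart_inv_def)
  show "local_rep (\<lambda>q. G (F q)) c e differentiable (at x)"
    by (rule differentiable_cong_open[OF differentiable_chain_at[OF diff] S eq])
  show "frechet_derivative (local_rep (\<lambda>q. G (F q)) c e) (at x) u =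
    frechet_derivative (local_rep G d e) (at (local_rep F c d x)) (frechet_derivative (local_rep F c d) (at x) u)"
    using frechet_derivative_cong_open[OF S, of "local_rep G d e \<circ> local_rep F c d", OF eq]
      frechet_derivative_compose[OF diff] by (simp add: fun_eq_iff)
qed

section \<open>Tangent spaces in charts\<close>

locale smooth_mfd =
  fixes M :: "('a, 'm::finite) riem"
  assumes smooth_manifold: "smooth_manifold M"
begin

lemma chart_open: "c \<in> rm_atlas M \<Longrightarrow> openin (rm_top M) (fst c)" "c \<in> rm_atlas M \<Longrightarrow> open (snd c ` fst c)"
  and chart_homeomorphic: "c \<in> rm_atlas M \<Longrightarrow>
    homeomorphic_map (subtopology (rm_top M) (fst c)) (top_of_set (snd c ` fst c)) (snd c)"
  and transition_smooth: "c \<in> rm_atlas M \<Longrightarrow> d \<in> rm_atlas M \<Longrightarrow>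
    smooth_on (snd c ` (fst c \<inter> fst d)) (transition c d)"
  using smooth_manifold by (simp_all add: smooth_manifold_def)

lemma chart_subset: "c \<in> rm_atlas M \<Longrightarrow> fst c \<subseteq> topspace (rm_top M)"
  by (rule openin_subset[OF chart_open(1)])

lemma chart_inj: "c \<in> rm_atlas M \<Longrightarrow> inj_on (snd c) (fst c)"
  using chart_homeomorphic[of c] chart_subset[of c]
  by (simp add: homeomorphic_eq_injective_perfect_map Int_absorb1 homeomorphic_map_def)

lemma chart_inv_eq: "c \<in> rm_atlas M \<Longrightarrow> p \<in> fst c \<Longrightarrow> chart_inv c (snd c p) = p"
  by (simp add: chart_inv_def chart_inj)

lemma chart_image_open:
  assumes c: "c \<in> rm_atlas M" and W: "openin (rm_top M) W"
  shows "open (snd c ` (fst c \<inter> W))"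
proof -
  have "openin (subtopology (rm_top M) (fst c)) (fst c \<inter> W)"
    using W by (simp add: openin_subtopology_Int2)
  then have "openin (top_of_set (snd c ` fst c)) (snd c ` (fst c \<inter> W))"
    using homeomorphic_imp_open_map[OF chart_homeomorphic[OF c]] by (auto simp: open_map_def)
  then show ?thesis using chart_open(2)[OF c] openin_open_eq by blast
qed

lemma charts_atD: "c \<in> charts_at M p \<Longrightarrow> c \<in> rm_atlas M" "c \<in> charts_at M p \<Longrightarrow> p \<in> fst c"
  by (auto simp: charts_at_def)

lemma charts_at_topspace: "c \<in> charts_at M p \<Longrightarrow> p \<in> topspace (rm_top M)"
  using chart_subset charts_atD by blast

lemma chart_at: "p \<in> topspace (rm_top M) \<Longrightarrow> chart_at M p \<in> charts_at M p"
proof -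
  assume "p \<in> topspace (rm_top M)"
  then have "p \<in> (\<Union>c\<in>rm_atlas M. fst c)" using smooth_manifold by (simp add: smooth_manifold_def)
  then have "\<exists>c. c \<in> charts_at M p" by (auto simp: charts_at_def)
  then show ?thesis unfolding chart_at_def by (rule someI_ex)
qed

lemma transition_value: "c \<in> charts_at M p \<Longrightarrow> transition c d (snd c p) = snd d p"
  by (simp add: local_rep_def chart_inv_eq charts_atD)

lemma transition_differentiable:
  "c \<in> charts_at M p \<Longrightarrow> d \<in> charts_at M p \<Longrightarrow> transition c d differentiable (at (snd c p))"
  using transition_smooth[of c d] by (auto intro!: smooth_on_differentiable dest: charts_atD)

text \<open>This cocycle rule is what makes the coordinate family in \<open>tangent_vec\<close>
  compatible under changes of charts, hence a member of \<open>tangent_space\<close>.\<close>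

lemma transition_chain:
  assumes "c \<in> charts_at M p" "d \<in> charts_at M p" "e \<in> charts_at M p"
  shows "frechet_derivative (transition c e) (at (snd c p)) u =
    frechet_derivative (transition d e) (at (snd d p)) (frechet_derivative (transition c d) (at (snd c p)) u)"
proof -
  note a = charts_atD[OF assms(1)] charts_atD[OF assms(2)]
  let ?S = "snd c ` (fst c \<inter> fst d)"
  have S: "open ?S" "snd c p \<in> ?S"
    using chart_image_open[OF a(1) chart_open(1)[OF a(3)]] a by auto
  have "chart_inv c y \<in> fst d" if "y \<in> ?S" for y
    using that by (auto simp: chart_inv_eq[OF a(1)])
  from local_rep_chain(2)[where F = "\<lambda>p. p" and G = "\<lambda>p. p", OF S this chart_inj[OF a(3)], of e u]
  show ?thesis
    using assms by (simp add: transition_differentiable transition_value)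
qed

lemma transition_self:
  assumes "c \<in> charts_at M p"
  shows "frechet_derivative (transition c c) (at (snd c p)) u = u"
proof -
  note c = charts_atD[OF assms]
  have "frechet_derivative (transition c c) (at (snd c p)) = frechet_derivative (\<lambda>x. x) (at (snd c p))"
    using c by (intro frechet_derivative_cong_open[OF chart_open(2)[OF c(1)]])
      (auto simp: local_rep_def chart_inv_eq)
  then show ?thesis by simp
qed

lemma coords_tangent_vec:
  "c \<in> charts_at M p \<Longrightarrow> coords (tangent_vec M c p u) c = u"
  by (simp add: tangent_vec_def transition_self)

lemma tangent_vec_in: "c \<in> charts_at M p \<Longrightarrow> tangent_vec M c p u \<in> tangent_space M p"
  by (auto simp: tangent_space_def tangent_vec_def intro: transition_chain)

lemma coords_change:
  "X \<in> tangent_space M p \<Longrightarrow> c \<in> charts_at M p \<Longrightarrow> d \<in> charts_at M p \<Longrightarrow>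
    coords X d = frechet_derivative (transition c d) (at (snd c p)) (coords X c)"
  unfolding tangent_space_def by blast

lemma tangent_vec_coords:
  assumes c: "c \<in> charts_at M p" and X: "X \<in> tangent_space M p"
  shows "tangent_vec M c p (coords X c) = X"
proof (rule tvec_eqI)
  fix d
  have "coords X d = 0" if "d \<notin> charts_at M p" using X that unfolding tangent_space_def by blast
  then show "coords (tangent_vec M c p (coords X c)) d = coords X d"
    using coords_change[OF X c, of d] by (cases "d \<in> charts_at M p") (auto simp: tangent_vec_def)
qed

lemma tangent_vec_linear:
  assumes c: "c \<in> charts_at M p"
  shows "linear (tangent_vec M c p)"
  by (rule linearI; rule tvec_eqI)
    (auto simp: tangent_vec_def linear_add linear_scale
      linear_frechet_derivative[OF transition_differentiable[OF c]])

lemma tangent_vec_change: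
  assumes c: "c \<in> charts_at M p" and d: "d \<in> charts_at M p"
  shows "tangent_vec M d p (frechet_derivative (transition c d) (at (snd c p)) u) = tangent_vec M c p u"
  by (rule tvec_eqI) (auto simp: tangent_vec_def intro: transition_chain[OF c d, symmetric])

lemma tangent_vec_inj: "c \<in> charts_at M p \<Longrightarrow> inj (tangent_vec M c p)"
  by (metis coords_tangent_vec injI)

lemma tangent_space_eq: "c \<in> charts_at M p \<Longrightarrow> tangent_space M p = range (tangent_vec M c p)"
  using tangent_vec_in[of c p] tangent_vec_coords[of c p] by (metis image_subset_iff rangeI subsetI subset_antisym)

lemma tangent_space_subspace: "c \<in> charts_at M p \<Longrightarrow> subspace (tangent_space M p)"
  by (simp add: tangent_space_eq linear_subspace_image[OF tangent_vec_linear])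

lemma tangent_space_span: "c \<in> charts_at M p \<Longrightarrow> tangent_space M p = span (tangent_vec M c p ` Basis)"
  using linear_span_image[OF tangent_vec_linear, of c p Basis] by (simp add: tangent_space_eq)

lemma tangent_space_finite: "c \<in> charts_at M p \<Longrightarrow> \<exists>A. finite A \<and> tangent_space M p \<subseteq> span A"
  using tangent_space_span by (metis finite_Basis finite_imageI order_refl)

lemma tangent_space_dim:
  assumes c: "c \<in> charts_at M p"
  shows "dim (tangent_space M p) = CARD('m)"
proof -
  have "independent (tangent_vec M c p ` Basis)"
    by (rule linear_independent_injective_image[OF tangent_vec_linear[OF c] independent_Basis])
      (use tangent_vec_inj[OF c] in \<open>simp add: inj_on_def\<close>)
  then have "dim (tangent_space M p) = card (tangent_vec M c p ` (Basis :: (real^'m) set))"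
    unfolding tangent_space_span[OF c] by (rule dim_span_eq_card_independent)
  also have "\<dots> = card (Basis :: (real^'m) set)"
    by (rule card_image) (use tangent_vec_inj[OF c] in \<open>simp add: inj_on_def\<close>)
  finally show ?thesis by simp
qed

end

section \<open>Metric and connection in charts\<close>

locale riemannian_mfd =
  fixes M :: "('a, 'm::finite) riem" and \<Gamma> :: "('a, 'm) connection"
  assumes riemannian_manifold: "riemannian_manifold M" and levi_civita: "levi_civita M \<Gamma>"
begin

sublocale smooth_mfd M
  using riemannian_manifold by unfold_locales (simp add: riemannian_manifold_def)

lemma inner_product_on_tangent_space:
  assumes c: "c \<in> charts_at M p"
  shows "inner_product_on (tangent_space M p) (rm_metric M p)"
  using riemannian_manifold charts_at_topspace[OF c]
  by unfold_locales (auto simp: riemannian_manifold_def intro: tangent_space_subspace[OF c])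

lemma metric_coeff_eq:
  "c \<in> charts_at M p \<Longrightarrow>
    metric_coeff M c (snd c p) u v = rm_metric M p (tangent_vec M c p u) (tangent_vec M c p v)"
  by (simp add: metric_coeff_def chart_inv_eq charts_atD)

lemma metric_coords:
  "c \<in> charts_at M p \<Longrightarrow> X \<in> tangent_space M p \<Longrightarrow> Y \<in> tangent_space M p \<Longrightarrow>
    rm_metric M p X Y = metric_coeff M c (snd c p) (coords X c) (coords Y c)"
  by (simp add: metric_coeff_eq tangent_vec_coords)

text \<open>The open part \<open>S\<close> of the chart image is left free because the coordinate
  expression of a map lives only where its values stay in the target chart. Symmetry of the
  coefficients and the derivative of the metric come from constant fields.\<close>

lemma metric_connection:
  assumes c: "c \<in> rm_atlas M" and S: "open S" "S \<subseteq> snd c ` fst c"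
  shows "metric_connection S (metric_coeff M c) (\<Gamma> c)"
proof -
  let ?U = "snd c ` fst c"
  note L = bspec[OF levi_civita[unfolded levi_civita_def Let_def] c]
  note lc_bilinear = L[THEN conjunct1, rule_format]
  note lc_smooth = L[THEN conjunct2, THEN conjunct1, rule_format]
  note lc_torsion = L[THEN conjunct2, THEN conjunct2, THEN conjunct1, rule_format]
  note lc_metric = L[THEN conjunct2, THEN conjunct2, THEN conjunct2, rule_format]
  show ?thesis
  proof
    show "open S" by fact
    fix x assume x: "x \<in> S"
    then have xU: "x \<in> ?U" using S(2) by blast
    then obtain p where p: "x = snd c p" "p \<in> fst c" by blast
    then have cp: "c \<in> charts_at M p" using c by (simp add: charts_at_def)
    interpret inner_product_on "tangent_space M p" "rm_metric M p"
      by (rule inner_product_on_tangent_space[OF cp])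
    note t = tangent_vec_in[OF cp]
    note l = linear_add[OF tangent_vec_linear[OF cp]] linear_scale[OF tangent_vec_linear[OF cp]]
    show "bilinear (metric_coeff M c x)"
      by (auto simp: bilinear_def linear_iff p(1) metric_coeff_eq[OF cp] l t
          add_left add_right scale_left scale_right)
    show "metric_coeff M c x u v = metric_coeff M c x v u" for u v
      by (simp add: p(1) metric_coeff_eq[OF cp] sym t)
    show "metric_coeff M c x u u > 0" if "u \<noteq> 0" for u
    proof -
      have "tangent_vec M c p u \<noteq> 0"
        using coords_tangent_vec[OF cp, of u] that by (metis coords_simps(2))
      then show ?thesis by (simp add: p(1) metric_coeff_eq[OF cp] pos t)
    qed
    show "(\<lambda>y. metric_coeff M c y u v) differentiable (at x)" for u v
      using riemannian_manifold c
      by (intro smooth_on_differentiable[OF _ xU]) (simp add: riemannian_manifold_def)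
    show "bilinear (\<Gamma> c x)" by (rule lc_bilinear[OF xU])
    show "(\<lambda>y. \<Gamma> c y u v) differentiable (at x)" for u v
      by (rule smooth_on_differentiable[OF lc_smooth xU])
    show "\<Gamma> c x u v = \<Gamma> c x v u" for u v
      using lc_torsion[OF _ _ xU, of "\<lambda>_. u" "\<lambda>_. v"] by (simp add: smooth_on_const cov_deriv_def lie_bracket_def)
    show "frechet_derivative (\<lambda>y. metric_coeff M c y a b) (at x) u =
        metric_coeff M c x (\<Gamma> c x u a) b + metric_coeff M c x a (\<Gamma> c x u b)" for a b u
      using lc_metric[OF _ _ xU, of "\<lambda>_. a" "\<lambda>_. b" u] by (simp add: smooth_on_const cov_deriv_def)
  qed
qed

end

section \<open>Riemannian maps in charts\<close>

locale riemannian_mfd_map =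
  first: riemannian_mfd M\<^sub>1 \<Gamma>\<^sub>1 + second: riemannian_mfd M\<^sub>2 \<Gamma>\<^sub>2
  for M\<^sub>1 :: "('a, 'm::finite) riem" and \<Gamma>\<^sub>1 and M\<^sub>2 :: "('b, 'n::finite) riem" and \<Gamma>\<^sub>2 +
  fixes F :: "'a \<Rightarrow> 'b" and r :: nat
  assumes riemannian_map: "riemannian_map M\<^sub>1 M\<^sub>2 F r"
begin

lemma map_continuous: "continuous_map (rm_top M\<^sub>1) (rm_top M\<^sub>2) F"
  and map_smooth: "c \<in> rm_atlas M\<^sub>1 \<Longrightarrow> d \<in> rm_atlas M\<^sub>2 \<Longrightarrow>
    smooth_on (snd c ` (fst c \<inter> F -` fst d)) (local_rep F c d)"
  using riemannian_map by (simp_all add: riemannian_map_def smooth_map_def)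

lemma map_domain_open:
  assumes c: "c \<in> rm_atlas M\<^sub>1" and d: "d \<in> rm_atlas M\<^sub>2"
  shows "open (snd c ` (fst c \<inter> F -` fst d))"
proof -
  have "openin (rm_top M\<^sub>1) {q \<in> topspace (rm_top M\<^sub>1). F q \<in> fst d}"
    by (rule openin_continuous_map_preimage[OF map_continuous second.chart_open(1)[OF d]])
  moreover have "fst c \<inter> F -` fst d = fst c \<inter> {q \<in> topspace (rm_top M\<^sub>1). F q \<in> fst d}"
    using first.chart_subset[OF c] by auto
  ultimately show ?thesis using first.chart_image_open[OF c] by simp
qed

lemma map_value: "c \<in> charts_at M\<^sub>1 p \<Longrightarrow> local_rep F c d (snd c p) = snd d (F p)"
  by (simp add: local_rep_def first.chart_inv_eq first.charts_atD)

lemma map_differentiable: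
  assumes "c \<in> charts_at M\<^sub>1 p" "d \<in> charts_at M\<^sub>2 (F p)"
  shows "local_rep F c d differentiable (at (snd c p))"
  using map_smooth[OF first.charts_atD(1)[OF assms(1)] second.charts_atD(1)[OF assms(2)]]
    first.charts_atD(2)[OF assms(1)] second.charts_atD(2)[OF assms(2)]
  by (intro smooth_on_differentiable) auto

lemma map_charts:
  "p \<in> topspace (rm_top M\<^sub>1) \<Longrightarrow> chart_at M\<^sub>1 p \<in> charts_at M\<^sub>1 p"
  "p \<in> topspace (rm_top M\<^sub>1) \<Longrightarrow> chart_at M\<^sub>2 (F p) \<in> charts_at M\<^sub>2 (F p)"
  using first.chart_at second.chart_at continuous_map_image_subset_topspace[OF map_continuous] by blast+

lemma map_change:
  assumes c: "c \<in> charts_at M\<^sub>1 p" and c': "c' \<in> charts_at M\<^sub>1 p"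
    and d: "d \<in> charts_at M\<^sub>2 (F p)" and d': "d' \<in> charts_at M\<^sub>2 (F p)"
  shows "frechet_derivative (local_rep F c d) (at (snd c p)) u =
    frechet_derivative (transition d' d) (at (snd d' (F p)))
      (frechet_derivative (local_rep F c' d') (at (snd c' p))
        (frechet_derivative (transition c c') (at (snd c p)) u))"
proof -
  note a = first.charts_atD[OF c] first.charts_atD[OF c'] second.charts_atD[OF d] second.charts_atD[OF d']
  let ?S = "snd c ` (fst c \<inter> fst c')" and ?S' = "snd c ` (fst c \<inter> F -` fst d')"
  have "open ?S" "snd c p \<in> ?S" "open ?S'" "snd c p \<in> ?S'"
    using first.chart_image_open[OF a(1) first.chart_open(1)[OF a(3)]] map_domain_open[OF a(1) a(7)] a by auto
  note S = this
  have "frechet_derivative (local_rep (\<lambda>q. F q) c d') (at (snd c p)) u =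
    frechet_derivative (local_rep F c' d') (at (transition c c' (snd c p)))
      (frechet_derivative (transition c c') (at (snd c p)) u)"
    using S a first.chart_inj[OF a(3)] first.transition_differentiable[OF c c'] map_differentiable[OF c' d']
    by (intro local_rep_chain(2)[where S = ?S])
      (auto simp: first.chart_inv_eq first.transition_value[OF c])
  moreover have "frechet_derivative (local_rep (\<lambda>q. (\<lambda>p. p) (F q)) c d) (at (snd c p)) u =
    frechet_derivative (transition d' d) (at (local_rep F c d' (snd c p)))
      (frechet_derivative (local_rep F c d') (at (snd c p)) u)"
    using S a second.chart_inj[OF a(7)] second.transition_differentiable[OF d' d] map_differentiable[OF c d']
    by (intro local_rep_chain(2)[where S = ?S'])
      (auto simp: first.chart_inv_eq map_value[OF c])
  ultimately show ?thesis by (simp add: map_value[OF c] first.transition_value[OF c])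
qed

text \<open>The isometry condition is differentiated, so it must be known in one fixed pair of
  charts at all points of an open set, while \<open>differential\<close> uses the pair selected
  separately at each point. Independence of the charts bridges the two.\<close>

lemma differential_eq:
  assumes c: "c \<in> charts_at M\<^sub>1 p" and d: "d \<in> charts_at M\<^sub>2 (F p)" and X: "X \<in> tangent_space M\<^sub>1 p"
  shows "differential M\<^sub>1 M\<^sub>2 F p X =
    tangent_vec M\<^sub>2 d (F p) (frechet_derivative (local_rep F c d) (at (snd c p)) (coords X c))"
proof -
  note ch = map_charts[OF first.charts_at_topspace[OF c]]
  show ?thesis
    unfolding differential_def Let_def map_change[OF c ch(1) d ch(2)]
      first.coords_change[OF X c ch(1)] second.tangent_vec_change[OF ch(2) d] ..
qed

lemma kernel_coords:
  assumes c: "c \<in> charts_at M\<^sub>1 p" and d: "d \<in> charts_at M\<^sub>2 (F p)" and X: "X \<in> tangent_space M\<^sub>1 p"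
  shows "X \<in> kernel_at M\<^sub>1 M\<^sub>2 F p \<longleftrightarrow> frechet_derivative (local_rep F c d) (at (snd c p)) (coords X c) = 0"
  using X inj_eq[OF second.tangent_vec_inj[OF d], of _ 0] linear_0[OF second.tangent_vec_linear[OF d]]
  by (simp add: kernel_at_def differential_eq[OF c d X])

lemma horizontal_coords:
  assumes c: "c \<in> charts_at M\<^sub>1 p" and d: "d \<in> charts_at M\<^sub>2 (F p)" and X: "X \<in> tangent_space M\<^sub>1 p"
  shows "X \<in> horizontal M\<^sub>1 M\<^sub>2 F p \<longleftrightarrow>
    coord_horizontal (metric_coeff M\<^sub>1 c) (local_rep F c d) (snd c p) (coords X c)"
proof -
  have "(\<forall>V\<in>kernel_at M\<^sub>1 M\<^sub>2 F p. rm_metric M\<^sub>1 p X V = 0) \<longleftrightarrow>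
    (\<forall>V\<in>tangent_space M\<^sub>1 p. frechet_derivative (local_rep F c d) (at (snd c p)) (coords V c) = 0
       \<longrightarrow> metric_coeff M\<^sub>1 c (snd c p) (coords X c) (coords V c) = 0)"
    using kernel_coords[OF c d] first.metric_coords[OF c X] by (auto simp: kernel_at_def)
  also have "\<dots> \<longleftrightarrow> coord_horizontal (metric_coeff M\<^sub>1 c) (local_rep F c d) (snd c p) (coords X c)"
    by (auto simp: coord_horizontal_def first.tangent_space_eq[OF c] first.coords_tangent_vec[OF c])
  finally show ?thesis using X by (auto simp: horizontal_def)
qed

lemma coordinate_map:
  assumes c: "c \<in> rm_atlas M\<^sub>1" and d: "d \<in> rm_atlas M\<^sub>2"
  shows "coordinate_map (snd c ` (fst c \<inter> F -` fst d)) (metric_coeff M\<^sub>1 c) (\<Gamma>\<^sub>1 c)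
    (snd d ` fst d) (metric_coeff M\<^sub>2 d) (\<Gamma>\<^sub>2 d) (local_rep F c d)"
proof -
  let ?U = "snd c ` (fst c \<inter> F -` fst d)"
  have "local_rep F c d x \<in> snd d ` fst d" if "x \<in> ?U" for x
    using that by (auto simp: local_rep_def first.chart_inv_eq[OF c])
  moreover have "metric_coeff M\<^sub>2 d (local_rep F c d x) (frechet_derivative (local_rep F c d) (at x) u)
      (frechet_derivative (local_rep F c d) (at x) v) = metric_coeff M\<^sub>1 c x u v"
    if x: "x \<in> ?U" and hor: "coord_horizontal (metric_coeff M\<^sub>1 c) (local_rep F c d) x u"
      "coord_horizontal (metric_coeff M\<^sub>1 c) (local_rep F c d) x v" for x u v
  proof -
    obtain p where p: "x = snd c p" "p \<in> fst c" "F p \<in> fst d" using x by auto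
    have cp: "c \<in> charts_at M\<^sub>1 p" and dp: "d \<in> charts_at M\<^sub>2 (F p)"
      using p c d by (auto simp: charts_at_def)
    note t = first.tangent_vec_in[OF cp]
    have "tangent_vec M\<^sub>1 c p u \<in> horizontal M\<^sub>1 M\<^sub>2 F p" "tangent_vec M\<^sub>1 c p v \<in> horizontal M\<^sub>1 M\<^sub>2 F p"
      using hor by (auto simp: horizontal_coords[OF cp dp t] first.coords_tangent_vec[OF cp] p(1))
    then have "rm_metric M\<^sub>1 p (tangent_vec M\<^sub>1 c p u) (tangent_vec M\<^sub>1 c p v) =
      rm_metric M\<^sub>2 (F p) (differential M\<^sub>1 M\<^sub>2 F p (tangent_vec M\<^sub>1 c p u))
        (differential M\<^sub>1 M\<^sub>2 F p (tangent_vec M\<^sub>1 c p v))"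
      using riemannian_map first.charts_at_topspace[OF cp] by (simp add: riemannian_map_def)
    then show ?thesis
      by (simp add: p(1) map_value[OF cp] first.metric_coeff_eq[OF cp] second.metric_coeff_eq[OF dp]
          differential_eq[OF cp dp t] first.coords_tangent_vec[OF cp])
  qed
  ultimately show ?thesis
    using map_smooth[OF c d] map_domain_open[OF c d]
    by (intro coordinate_map.intro first.metric_connection[OF c] second.metric_connection[OF d]
        coordinate_map_axioms.intro second.chart_open(2)[OF d]) auto
qed

text \<open>The charts are those selected by \<open>chart_at\<close> at \<open>p\<close> and
  \<open>F p\<close>, so the differential, the second fundamental form and the curvatures unfold
  directly to their coordinate versions. The vertical vector of the Gauss equation is the tangent
  vector with coordinates \<open>a\<close>.\<close>

lemma pointwise_gauss:
  assumes p: "p \<in> topspace (rm_top M\<^sub>1)"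
  shows "pointwise_gauss (tangent_space M\<^sub>1 p) (rm_metric M\<^sub>1 p) (tangent_space M\<^sub>2 (F p)) (rm_metric M\<^sub>2 (F p))
    (differential M\<^sub>1 M\<^sub>2 F p) (second_fundamental_form M\<^sub>1 \<Gamma>\<^sub>1 M\<^sub>2 \<Gamma>\<^sub>2 F p)
    (curvature M\<^sub>1 \<Gamma>\<^sub>1 p) (curvature M\<^sub>2 \<Gamma>\<^sub>2 (F p)) (kernel_at M\<^sub>1 M\<^sub>2 F p) (horizontal M\<^sub>1 M\<^sub>2 F p) r CARD('n)"
proof -
  define c where "c = chart_at M\<^sub>1 p"
  define d where "d = chart_at M\<^sub>2 (F p)"
  define x where "x = snd c p"
  define f where "f = local_rep F c d"
  have cp: "c \<in> charts_at M\<^sub>1 p" and dp: "d \<in> charts_at M\<^sub>2 (F p)"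
    using map_charts[OF p] by (simp_all add: c_def d_def)
  note ca = first.charts_atD[OF cp] and da = second.charts_atD[OF dp]
  interpret coordinate_map "snd c ` (fst c \<inter> F -` fst d)" "metric_coeff M\<^sub>1 c" "\<Gamma>\<^sub>1 c"
    "snd d ` fst d" "metric_coeff M\<^sub>2 d" "\<Gamma>\<^sub>2 d" f
    unfolding f_def by (rule coordinate_map[OF ca(1) da(1)])
  have x: "x \<in> snd c ` (fst c \<inter> F -` fst d)" using ca da by (auto simp: x_def)
  have fx: "f x = snd d (F p)" unfolding f_def x_def by (rule map_value[OF cp])
  let ?T1 = "tangent_space M\<^sub>1 p" and ?T2 = "tangent_space M\<^sub>2 (F p)"
  let ?g1 = "rm_metric M\<^sub>1 p" and ?g2 = "rm_metric M\<^sub>2 (F p)"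
  let ?G1 = "metric_coeff M\<^sub>1 c x" and ?G2 = "metric_coeff M\<^sub>2 d (f x)"
  let ?t1 = "tangent_vec M\<^sub>1 c p" and ?t2 = "tangent_vec M\<^sub>2 d (F p)"
  let ?K = "kernel_at M\<^sub>1 M\<^sub>2 F p" and ?H = "horizontal M\<^sub>1 M\<^sub>2 F p"
  note in1 = first.tangent_vec_in[OF cp] and in2 = second.tangent_vec_in[OF dp]
  note co1 = first.coords_tangent_vec[OF cp] and co2 = second.coords_tangent_vec[OF dp]
  have L: "differential M\<^sub>1 M\<^sub>2 F p X = ?t2 (df x (coords X c))" for X
    by (simp add: differential_def Let_def c_def d_def x_def f_def)
  have Bt: "second_fundamental_form M\<^sub>1 \<Gamma>\<^sub>1 M\<^sub>2 \<Gamma>\<^sub>2 F p X Y = ?t2 (B x (coords X c) (coords Y c))" for X Y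
    by (simp add: second_fundamental_form_def coord_sff_def Let_def c_def d_def x_def f_def)
  have R1: "curvature M\<^sub>1 \<Gamma>\<^sub>1 p X Y Z = ?t1 (coord_curvature (\<Gamma>\<^sub>1 c) x (coords X c) (coords Y c) (coords Z c))" for X Y Z
    by (simp add: curvature_def coord_curvature_def Let_def c_def x_def)
  have R2: "curvature M\<^sub>2 \<Gamma>\<^sub>2 (F p) X Y Z =
      ?t2 (coord_curvature (\<Gamma>\<^sub>2 d) (f x) (coords X d) (coords Y d) (coords Z d))" for X Y Z
    by (simp add: curvature_def coord_curvature_def Let_def d_def fx)
  have g1: "?g1 X Y = ?G1 (coords X c) (coords Y c)" if "X \<in> ?T1" "Y \<in> ?T1" for X Y
    unfolding x_def by (rule first.metric_coords[OF cp that])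
  have g2: "?g2 X Y = ?G2 (coords X d) (coords Y d)" if "X \<in> ?T2" "Y \<in> ?T2" for X Y
    unfolding fx by (rule second.metric_coords[OF dp that])
  have KT: "X \<in> ?T1" if "X \<in> ?K" for X using that by (simp add: kernel_at_def)
  have K: "df x (coords X c) = 0" if "X \<in> ?K" for X
    using that kernel_coords[OF cp dp KT[OF that]] by (simp add: f_def x_def)
  have HT: "X \<in> ?T1" if "X \<in> ?H" for X using that by (simp add: horizontal_def)
  have H: "hor x (coords X c)" if "X \<in> ?H" for X
    using that horizontal_coords[OF cp dp HT[OF that]] by (simp add: f_def x_def)
  let ?L = "differential M\<^sub>1 M\<^sub>2 F p" and ?B = "second_fundamental_form M\<^sub>1 \<Gamma>\<^sub>1 M\<^sub>2 \<Gamma>\<^sub>2 F p"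
  note t2_simps = linear_add[OF second.tangent_vec_linear[OF dp]] linear_scale[OF second.tangent_vec_linear[OF dp]]
  have B_bilinear: "bilinear ?B"
    unfolding bilinear_def linear_iff Bt by (simp add: sff_simps[OF x] t2_simps)
  have B_sym: "?B X Y = ?B Y X" for X Y
    unfolding Bt by (simp only: sff_sym[OF x, of "coords X c" "coords Y c"])
  have B_maps: "?B X Y \<in> ?T2" for X Y unfolding Bt by (rule in2)
  have L_linear: "linear ?L"
    unfolding linear_iff L by (simp add: df_simps[OF x] t2_simps)
  have L_maps: "?L X \<in> ?T2" for X unfolding L by (rule in2)
  have B_horizontal: "?g2 (?B X Y) (?L Z) = 0" if "X \<in> ?H" "Y \<in> ?H" for X Y Z
    unfolding Bt L using C_horizontal[OF x H[OF that(1)] H[OF that(2)], of "coords Z c"]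
    by (simp add: g2 in2 co2 C_def)
  have B_vertical: "?B X V \<in> ?L ` ?T1" if V: "V \<in> ?K" for X V
  proof -
    obtain w where "B x (coords X c) (coords V c) = df x w" using sff_vertical[OF x K[OF V]] by blast
    then have "?B X V = ?L (?t1 w)" by (simp add: L Bt co1)
    then show ?thesis using in1 by blast
  qed
  have B_mixed: "?g2 (?B X V) (?L Y) = - ?g2 (?B Y V) (?L X)" if "X \<in> ?H" "Y \<in> ?H" for X Y V
    unfolding Bt L using C_antisym[OF x H[OF that(1)] H[OF that(2)], of "coords V c"]
      C_sym[OF x, of "coords X c" "coords V c"] C_sym[OF x, of "coords Y c" "coords V c"]
    by (simp add: g2 in2 co2 C_def)
  have gauss_equation: "\<exists>a\<in>?K. (\<forall>V\<in>?K. ?g1 a V = ?g2 (?B X V) (?L Y)) \<and>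
      ?g1 (curvature M\<^sub>1 \<Gamma>\<^sub>1 p X Y Y) X = ?g2 (curvature M\<^sub>2 \<Gamma>\<^sub>2 (F p) (?L X) (?L Y) (?L Y)) (?L X)
        + ?g2 (?B X X) (?B Y Y) - ?g2 (?B X Y) (?B X Y) - 3 * ?g1 a a"
    if XY: "X \<in> ?H" "Y \<in> ?H" for X Y
  proof (intro bexI conjI ballI)
    let ?a = "?t1 (a x (coords X c) (coords Y c))"
    show "?a \<in> ?K"
      using a_vertical[OF x] kernel_coords[OF cp dp in1, of "a x (coords X c) (coords Y c)"]
      by (simp add: co1 f_def x_def)
    show "?g1 ?a V = ?g2 (?B X V) (?L Y)" if "V \<in> ?K" for V
      unfolding Bt L using a_metric[OF x H[OF XY(2)] K[OF that], of "coords X c"]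
      by (simp add: g1 g2 in1 in2 co1 co2 KT[OF that] C_def)
    show "?g1 (curvature M\<^sub>1 \<Gamma>\<^sub>1 p X Y Y) X = ?g2 (curvature M\<^sub>2 \<Gamma>\<^sub>2 (F p) (?L X) (?L Y) (?L Y)) (?L X)
        + ?g2 (?B X X) (?B Y Y) - ?g2 (?B X Y) (?B X Y) - 3 * ?g1 ?a ?a"
      unfolding Bt L R1 R2 using gauss[OF x H[OF XY(1)] H[OF XY(2)]]
      by (simp add: g1 g2 in1 in2 co1 co2 HT[OF XY(1)])
  qed
  have rank: "dim (?L ` ?T1) = r"
    and isometric: "X \<in> ?H \<Longrightarrow> Y \<in> ?H \<Longrightarrow> ?g1 X Y = ?g2 (?L X) (?L Y)" for X Y
    using riemannian_map p by (simp_all add: riemannian_map_def range_at_def)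
  show ?thesis
    by (intro pointwise_gauss.intro pointwise_gauss_axioms.intro
        first.inner_product_on_tangent_space[OF cp] second.inner_product_on_tangent_space[OF dp])
      (rule kernel_at_def horizontal_def
        first.tangent_space_finite[OF cp] second.tangent_space_finite[OF dp]
        second.tangent_space_dim[OF dp] rank L_linear L_maps B_bilinear B_sym B_maps
        isometric B_horizontal B_vertical B_mixed gauss_equation | assumption)+
qed

end

section \<open>From single points to the whole manifold\<close>

theorem theorem4p1:
  fixes M\<^sub>1 :: "('a, 'm::finite) riem" and M\<^sub>2 :: "('b, 'n::finite) riem"
    and \<Gamma>\<^sub>1 :: "('a, 'm) connection" and \<Gamma>\<^sub>2 :: "('b, 'n) connection"
    and F :: "'a \<Rightarrow> 'b" and r :: nat
  assumes "riemannian_manifold M\<^sub>1" and "levi_civita M\<^sub>1 \<Gamma>\<^sub>1"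
    and "riemannian_manifold M\<^sub>2" and "levi_civita M\<^sub>2 \<Gamma>\<^sub>2"
    and "riemannian_map M\<^sub>1 M\<^sub>2 F r" and "r < CARD('n)"
  shows
    "(\<forall>p\<in>topspace (rm_top M\<^sub>1). \<forall>X\<in>horizontal M\<^sub>1 M\<^sub>2 F p. rm_metric M\<^sub>1 p X X = 1 \<longrightarrow>
       (\<forall>h. horizontal_basis M\<^sub>1 M\<^sub>2 F r p h \<longrightarrow> h 1 = X \<longrightarrow>
          Ric_H M\<^sub>1 \<Gamma>\<^sub>1 r p h 1 \<le> ricci_bound M\<^sub>1 \<Gamma>\<^sub>1 M\<^sub>2 \<Gamma>\<^sub>2 F r p h)) \<and>

     (\<forall>p\<in>topspace (rm_top M\<^sub>1). \<forall>X\<in>horizontal M\<^sub>1 M\<^sub>2 F p. rm_metric M\<^sub>1 p X X = 1 \<longrightarrow>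
       (\<forall>h. horizontal_basis M\<^sub>1 M\<^sub>2 F r p h \<longrightarrow> h 1 = X \<longrightarrow>
          (Ric_H M\<^sub>1 \<Gamma>\<^sub>1 r p h 1 = ricci_bound M\<^sub>1 \<Gamma>\<^sub>1 M\<^sub>2 \<Gamma>\<^sub>2 F r p h \<longleftrightarrow>
             (\<forall>Y\<in>horizontal M\<^sub>1 M\<^sub>2 F p. rm_metric M\<^sub>1 p X Y = 0 \<longrightarrow>
                second_fundamental_form M\<^sub>1 \<Gamma>\<^sub>1 M\<^sub>2 \<Gamma>\<^sub>2 F p X Y = 0) \<and>
             second_fundamental_form M\<^sub>1 \<Gamma>\<^sub>1 M\<^sub>2 \<Gamma>\<^sub>2 F p X X =
               (1 / 2) *\<^sub>R trace_B M\<^sub>1 \<Gamma>\<^sub>1 M\<^sub>2 \<Gamma>\<^sub>2 F r p h \<and>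
             (\<forall>V\<in>kernel_at M\<^sub>1 M\<^sub>2 F p. second_fundamental_form M\<^sub>1 \<Gamma>\<^sub>1 M\<^sub>2 \<Gamma>\<^sub>2 F p X V = 0)))) \<and>

     (equality_identically M\<^sub>1 \<Gamma>\<^sub>1 M\<^sub>2 \<Gamma>\<^sub>2 F r \<longleftrightarrow>
       ((\<forall>p\<in>topspace (rm_top M\<^sub>1). \<forall>X\<in>horizontal M\<^sub>1 M\<^sub>2 F p. \<forall>Y\<in>horizontal M\<^sub>1 M\<^sub>2 F p.
           second_fundamental_form M\<^sub>1 \<Gamma>\<^sub>1 M\<^sub>2 \<Gamma>\<^sub>2 F p X Y = 0) \<or>
        (r = 2 \<and>
         (\<forall>p\<in>topspace (rm_top M\<^sub>1). \<forall>h V. \<forall>\<alpha>\<in>{3..CARD('n)}.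
            horizontal_basis M\<^sub>1 M\<^sub>2 F r p h \<longrightarrow> range_perp_basis M\<^sub>1 M\<^sub>2 F r p V \<longrightarrow>
            B_comp M\<^sub>1 \<Gamma>\<^sub>1 M\<^sub>2 \<Gamma>\<^sub>2 F p h V \<alpha> 1 1 = B_comp M\<^sub>1 \<Gamma>\<^sub>1 M\<^sub>2 \<Gamma>\<^sub>2 F p h V \<alpha> 2 2))) \<and>
       mixed_vanishing M\<^sub>1 \<Gamma>\<^sub>1 M\<^sub>2 \<Gamma>\<^sub>2 F) \<and>

     (r > 2 \<longrightarrow>
       (equality_identically M\<^sub>1 \<Gamma>\<^sub>1 M\<^sub>2 \<Gamma>\<^sub>2 F r \<and> vertical_vanishing M\<^sub>1 \<Gamma>\<^sub>1 M\<^sub>2 \<Gamma>\<^sub>2 F \<longleftrightarrow>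
        totally_geodesic M\<^sub>1 \<Gamma>\<^sub>1 M\<^sub>2 \<Gamma>\<^sub>2 F)) \<and>

     (r = 2 \<longrightarrow>
       (equality_identically M\<^sub>1 \<Gamma>\<^sub>1 M\<^sub>2 \<Gamma>\<^sub>2 F r \<longleftrightarrow>
        umbilical M\<^sub>1 \<Gamma>\<^sub>1 M\<^sub>2 \<Gamma>\<^sub>2 F \<and> mixed_vanishing M\<^sub>1 \<Gamma>\<^sub>1 M\<^sub>2 \<Gamma>\<^sub>2 F))"
proof -
  interpret riemannian_mfd_map M\<^sub>1 \<Gamma>\<^sub>1 M\<^sub>2 \<Gamma>\<^sub>2 F r
    using assms by unfold_locales
  let ?S = "topspace (rm_top M\<^sub>1)" and ?H = "horizontal M\<^sub>1 M\<^sub>2 F" and ?K = "kernel_at M\<^sub>1 M\<^sub>2 F"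
  let ?B = "second_fundamental_form M\<^sub>1 \<Gamma>\<^sub>1 M\<^sub>2 \<Gamma>\<^sub>2 F" and ?hb = "horizontal_basis M\<^sub>1 M\<^sub>2 F r"
  let ?Ric = "Ric_H M\<^sub>1 \<Gamma>\<^sub>1 r" and ?bound = "ricci_bound M\<^sub>1 \<Gamma>\<^sub>1 M\<^sub>2 \<Gamma>\<^sub>2 F r"
  let ?E = "\<lambda>p. \<forall>X\<in>?H p. rm_metric M\<^sub>1 p X X = 1 \<longrightarrow>
    (\<forall>h. ?hb p h \<longrightarrow> h 1 = X \<longrightarrow> ?Ric p h 1 = ?bound p h)"
  let ?zero = "\<lambda>p. \<forall>X\<in>?H p. \<forall>Y\<in>?H p. ?B p X Y = 0"
  let ?mixed = "\<lambda>p. \<forall>X\<in>?H p. \<forall>V\<in>?K p. ?B p X V = 0"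
  let ?vert = "\<lambda>p. \<forall>V\<in>?K p. \<forall>W\<in>?K p. ?B p V W = 0"
  let ?comp = "\<lambda>p. \<forall>h V. \<forall>\<alpha>\<in>{3..CARD('n)}. ?hb p h \<longrightarrow> range_perp_basis M\<^sub>1 M\<^sub>2 F r p V \<longrightarrow>
    B_comp M\<^sub>1 \<Gamma>\<^sub>1 M\<^sub>2 \<Gamma>\<^sub>2 F p h V \<alpha> 1 1 = B_comp M\<^sub>1 \<Gamma>\<^sub>1 M\<^sub>2 \<Gamma>\<^sub>2 F p h V \<alpha> 2 2"
  let ?umb = "\<lambda>p. \<exists>W\<in>range_perp M\<^sub>1 M\<^sub>2 F p. \<forall>X\<in>?H p. \<forall>Y\<in>?H p. ?B p X Y = rm_metric M\<^sub>1 p X Y *\<^sub>R W"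
  have pointwise:
    "(\<forall>X\<in>?H p. rm_metric M\<^sub>1 p X X = 1 \<longrightarrow> (\<forall>h. ?hb p h \<longrightarrow> h 1 = X \<longrightarrow>
       ?Ric p h 1 \<le> ?bound p h \<and>
       (?Ric p h 1 = ?bound p h \<longleftrightarrow>
          (\<forall>Y\<in>?H p. rm_metric M\<^sub>1 p X Y = 0 \<longrightarrow> ?B p X Y = 0) \<and>
          ?B p X X = (1 / 2) *\<^sub>R trace_B M\<^sub>1 \<Gamma>\<^sub>1 M\<^sub>2 \<Gamma>\<^sub>2 F r p h \<and> (\<forall>V\<in>?K p. ?B p X V = 0))))"
    "?E p \<longrightarrow> ?mixed p" "r \<noteq> 2 \<longrightarrow> ?E p \<longrightarrow> ?zero p" "?zero p \<longrightarrow> ?mixed p \<longrightarrow> ?E p"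
    "r = 2 \<longrightarrow> (?E p \<longleftrightarrow> ?comp p \<and> ?mixed p) \<and> (?comp p \<longleftrightarrow> ?umb p)"
    "(\<forall>X\<in>tangent_space M\<^sub>1 p. \<forall>Y\<in>tangent_space M\<^sub>1 p. ?B p X Y = 0) \<longleftrightarrow> ?zero p \<and> ?mixed p \<and> ?vert p"
    if p: "p \<in> ?S" for p
  proof -
    interpret P: pointwise_gauss "tangent_space M\<^sub>1 p" "rm_metric M\<^sub>1 p" "tangent_space M\<^sub>2 (F p)"
      "rm_metric M\<^sub>2 (F p)" "differential M\<^sub>1 M\<^sub>2 F p" "?B p" "curvature M\<^sub>1 \<Gamma>\<^sub>1 p"
      "curvature M\<^sub>2 \<Gamma>\<^sub>2 (F p)" "?K p" "?H p" r "CARD('n)"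
      by (rule pointwise_gauss[OF p])
    have hb: "?hb p h \<longleftrightarrow> orthonormal_basis (rm_metric M\<^sub>1 p) (?H p) {1..r} h" for h
      by (rule horizontal_basis_def)
    have ric: "?Ric p h 1 = P.ric\<^sub>1 h" for h
      unfolding Ric_H_def P.ric\<^sub>1_def ..
    have tr: "trace_B M\<^sub>1 \<Gamma>\<^sub>1 M\<^sub>2 \<Gamma>\<^sub>2 F r p h = P.trace h" for h
      unfolding trace_B_def P.trace_def ..
    have bnd: "?bound p h = P.bound h" for h
      unfolding ricci_bound_def Ric_R_def Let_def tr P.bound_def ..
    have E: "?E p \<longleftrightarrow> P.always_equal"
      unfolding P.always_equal_def hb ric bnd ..
    have perp: "range_perp M\<^sub>1 M\<^sub>2 F p = P.perp"
      unfolding range_perp_def P.perp_def range_at_def ..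
    have comp: "?comp p \<longleftrightarrow> P.balanced" if "r = 2"
      unfolding P.components_iff_balanced[OF that, symmetric] hb range_perp_basis_def B_comp_def perp ..
    show "\<forall>X\<in>?H p. rm_metric M\<^sub>1 p X X = 1 \<longrightarrow> (\<forall>h. ?hb p h \<longrightarrow> h 1 = X \<longrightarrow>
       ?Ric p h 1 \<le> ?bound p h \<and>
       (?Ric p h 1 = ?bound p h \<longleftrightarrow>
          (\<forall>Y\<in>?H p. rm_metric M\<^sub>1 p X Y = 0 \<longrightarrow> ?B p X Y = 0) \<and>
          ?B p X X = (1 / 2) *\<^sub>R trace_B M\<^sub>1 \<Gamma>\<^sub>1 M\<^sub>2 \<Gamma>\<^sub>2 F r p h \<and> (\<forall>V\<in>?K p. ?B p X V = 0)))"
      unfolding hb ric bnd tr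
    proof (intro ballI allI impI)
      fix X h assume X: "X \<in> ?H p" "rm_metric M\<^sub>1 p X X = 1"
        and h: "orthonormal_basis (rm_metric M\<^sub>1 p) (?H p) {1..r} h" "h 1 = X"
      show "P.ric\<^sub>1 h \<le> P.bound h \<and> (P.ric\<^sub>1 h = P.bound h \<longleftrightarrow>
          (\<forall>Y\<in>?H p. rm_metric M\<^sub>1 p X Y = 0 \<longrightarrow> ?B p X Y = 0) \<and>
          ?B p X X = (1 / 2) *\<^sub>R P.trace h \<and> (\<forall>V\<in>?K p. ?B p X V = 0))"
        using P.ricci_inequality_and_equality[OF h(1) P.unit_rank[OF X]] unfolding h(2) by (rule conjI)
    qed
    show "?E p \<longrightarrow> ?mixed p" unfolding E using P.always_equal_mixed by blast
    show "r \<noteq> 2 \<longrightarrow> ?E p \<longrightarrow> ?zero p" unfolding E using P.always_equal_vanishing by blast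
    show "?zero p \<longrightarrow> ?mixed p \<longrightarrow> ?E p" unfolding E using P.always_equalI_vanishing by blast
    show "r = 2 \<longrightarrow> (?E p \<longleftrightarrow> ?comp p \<and> ?mixed p) \<and> (?comp p \<longleftrightarrow> ?umb p)"
    proof
      assume r: "r = 2"
      have "P.always_equal \<longleftrightarrow> P.balanced \<and> ?mixed p"
        using P.always_equal_balanced[OF _ r] P.always_equal_mixed P.always_equalI_balanced[OF _ r] by blast
      then show "(?E p \<longleftrightarrow> ?comp p \<and> ?mixed p) \<and> (?comp p \<longleftrightarrow> ?umb p)"
        unfolding E comp[OF r] perp P.umbilical_iff_balanced[OF r] by blast
    qed
    show "(\<forall>X\<in>tangent_space M\<^sub>1 p. \<forall>Y\<in>tangent_space M\<^sub>1 p. ?B p X Y = 0) \<longleftrightarrow>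
        ?zero p \<and> ?mixed p \<and> ?vert p"
      by (rule P.totally_geodesic_iff)
  qed
  \<comment> \<open>With the pointwise statements hidden behind predicates, the global equivalences
    reduce to reasoning about quantifiers over \<open>p\<close>.\<close>
  define eq zero mixed vert comp umb where eq_def: "eq p \<longleftrightarrow> ?E p" and zero_def: "zero p \<longleftrightarrow> ?zero p"
    and mixed_def: "mixed p \<longleftrightarrow> ?mixed p" and vert_def: "vert p \<longleftrightarrow> ?vert p"
    and comp_def: "comp p \<longleftrightarrow> ?comp p" and umb_def: "umb p \<longleftrightarrow> ?umb p"
    for p
  note defs = eq_def zero_def mixed_def vert_def comp_def umb_def
  note facts = pointwise(2-6)[folded defs]
  have eq: "equality_identically M\<^sub>1 \<Gamma>\<^sub>1 M\<^sub>2 \<Gamma>\<^sub>2 F r \<longleftrightarrow> (\<forall>p\<in>?S. eq p)"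
    unfolding defs by (rule equality_identically_def)
  have mixed: "mixed_vanishing M\<^sub>1 \<Gamma>\<^sub>1 M\<^sub>2 \<Gamma>\<^sub>2 F \<longleftrightarrow> (\<forall>p\<in>?S. mixed p)"
    unfolding defs by (rule mixed_vanishing_def)
  have vert: "vertical_vanishing M\<^sub>1 \<Gamma>\<^sub>1 M\<^sub>2 \<Gamma>\<^sub>2 F \<longleftrightarrow> (\<forall>p\<in>?S. vert p)"
    unfolding defs by (rule vertical_vanishing_def)
  have tg: "totally_geodesic M\<^sub>1 \<Gamma>\<^sub>1 M\<^sub>2 \<Gamma>\<^sub>2 F \<longleftrightarrow> (\<forall>p\<in>?S. zero p \<and> mixed p \<and> vert p)"
    unfolding totally_geodesic_def using facts(5) by (intro ball_cong refl)
  \<comment> \<open>The definition asks for one map \<open>H\<close> on the manifold; it is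
    assembled by choice from the normal vectors found at the single points.\<close>
  have umb: "umbilical M\<^sub>1 \<Gamma>\<^sub>1 M\<^sub>2 \<Gamma>\<^sub>2 F \<longleftrightarrow> (\<forall>p\<in>?S. umb p)"
    unfolding defs umbilical_def Bex_def by (rule bchoice_iff[symmetric])
  \<comment> \<open>The rank is the same everywhere, so the alternative is decided for all points at
    once: outside rank 2 equality forces \<open>zero\<close>, in rank 2 it forces
    \<open>comp\<close>. Conversely, \<open>zero\<close> together with \<open>mixed\<close> gives
    equality in every rank.\<close>
  have iii: "(\<forall>p\<in>?S. eq p) \<longleftrightarrow>
      ((\<forall>p\<in>?S. zero p) \<or> (r = 2 \<and> (\<forall>p\<in>?S. comp p))) \<and> (\<forall>p\<in>?S. mixed p)"
    using facts(1-4) by (cases "r = 2") blast+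
  have iv: "r > 2 \<longrightarrow> ((\<forall>p\<in>?S. eq p) \<and> (\<forall>p\<in>?S. vert p) \<longleftrightarrow> (\<forall>p\<in>?S. zero p \<and> mixed p \<and> vert p))"
    using facts(1-3) by (cases "r = 2") (simp, blast)
  have v: "r = 2 \<longrightarrow> ((\<forall>p\<in>?S. eq p) \<longleftrightarrow> (\<forall>p\<in>?S. umb p) \<and> (\<forall>p\<in>?S. mixed p))"
    using facts(4) by blast
  have ineq: "\<forall>p\<in>?S. \<forall>X\<in>?H p. rm_metric M\<^sub>1 p X X = 1 \<longrightarrow>
      (\<forall>h. ?hb p h \<longrightarrow> h 1 = X \<longrightarrow> ?Ric p h 1 \<le> ?bound p h)"
    by (intro ballI allI impI) (rule pointwise(1)[rule_format, THEN conjunct1])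
  have i: "\<forall>p\<in>?S. \<forall>X\<in>?H p. rm_metric M\<^sub>1 p X X = 1 \<longrightarrow>
      (\<forall>h. ?hb p h \<longrightarrow> h 1 = X \<longrightarrow> (?Ric p h 1 = ?bound p h \<longleftrightarrow>
          (\<forall>Y\<in>?H p. rm_metric M\<^sub>1 p X Y = 0 \<longrightarrow> ?B p X Y = 0) \<and>
          ?B p X X = (1 / 2) *\<^sub>R trace_B M\<^sub>1 \<Gamma>\<^sub>1 M\<^sub>2 \<Gamma>\<^sub>2 F r p h \<and> (\<forall>V\<in>?K p. ?B p X V = 0)))"
    by (intro ballI allI impI) (rule pointwise(1)[rule_format, THEN conjunct2])
  show ?thesis
    unfolding eq mixed vert tg umb using ineq i iii[unfolded zero_def comp_def] iv v by (intro conjI)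
qed

end
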